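(* Let $X$ be a set with two distinguished distinct elements $0^X,1^X$, let $C$ be a braided bimonoidal category, and let $\varphi:X\to\mathrm{Ob}(C)$ be a function with $\varphi(0^X)=0$ and $\varphi(1^X)=1$. Suppose that the value in $C$ of each $\delta$-prime edge of $\mathrm{Gr}(X)$ is a monomorphism. If $P$ and $Q$ are two paths in $\mathrm{Gr}(X)$ with the same domain and the same codomain that have the same braided distortion, then $P$ and $Q$ have the same value in $C$.
   Context: Write $AB$ for $A\otimes B$; $\otimes$ binds tighter than $\oplus$. A bimonoidal category is a category $C$ with a symmetric monoidal structure $(\oplus,0,\alpha^\oplus,\lambda^\oplus,\rho^\oplus,\zeta^\oplus)$, a monoidal structure $(\otimes,1,\alpha^\otimes,\lambda^\otimes,\rho^\otimes)$ (with $\alpha_{A,B,C}:(AB)C\to A(BC)$, $\lambda_A$, $\rho_A$ the left/right unit isomorphisms), natural isomorphisms $\lambda^\bullet_A:0A\to0$, $\rho^\bullet_A:A0\to 0$, and natural monomorphisms $\delta^l_{A,B,C}:A(B\oplus C)\to AB\oplus AC$, $\delta^r_{A,B,C}:(A\oplus B)C\to AC\oplus BC$, such that for all objects: $\delta^l_{A,C,B}(1\otimes\zeta^\oplus_{B,C})=\zeta^\oplus_{AB,AC}\delta^l_{A,B,C}$; $\delta^r_{B,A,C}(\zeta^\oplus_{A,B}\otimes1)=\zeta^\oplus_{AC,BC}\delta^r_{A,B,C}$; $\alpha^\oplus(\delta^r_{A,B,D}\oplus1)\delta^r_{A\oplus B,C,D}=(1\oplus\delta^r_{B,C,D})\delta^r_{A,B\oplus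 C,D}(\alpha^\oplus_{A,B,C}\otimes1)$; $\alpha^\oplus(\delta^l_{A,B,C}\oplus1)\delta^l_{A,B\oplus C,D}=(1\oplus\delta^l_{A,C,D})\delta^l_{A,B,C\oplus D}(1\otimes\alpha^\oplus_{B,C,D})$; $\delta^l_{A,BC,BD}(1\otimes\delta^l_{B,C,D})\alpha^\otimes_{A,B,C\oplus D}=(\alpha^\otimes_{A,B,C}\oplus\alpha^\otimes_{A,B,D})\delta^l_{AB,C,D}$; $(\alpha^\otimes_{A,C,D}\oplus\alpha^\otimes_{B,C,D})\delta^r_{AC,BC,D}(\delta^r_{A,B,C}\otimes1)=\delta^r_{A,B,CD}\alpha^\otimes_{A\oplus B,C,D}$; $(\alpha^\otimes_{A,B,D}\oplus\alpha^\otimes_{A,C,D})\delta^r_{AB,AC,D}(\delta^l_{A,B,C}\otimes1)=\delta^l_{A,BD,CD}(1\otimes\delta^r_{B,C,D})\alpha^\otimes_{A,B\oplus C,D}$; $\mu(\delta^l_{A,C,D}\oplus\delta^l_{B,C,D})\delta^r_{A,B,C\oplus D}=(\delta^r_{A,B,C}\oplus\delta^r_{A,B,D})\delta^l_{A\oplus B,C,D}$, where $\mu:(AC\oplus AD)\oplus(BC\oplus BD)\to(AC\oplus BC)\oplus(AD\oplus BD)$ is the coherence isomorphism exchanging the two middle summands; $\lambda^\bullet_0=\rho^\bullet_0$; $\lambda^\oplus_0(\lambda^\bullet_A\oplus\lambda^\bullet_B)\delta^l_{0,A,B}=\lambda^\bullet_{A\oplus B}$; $\lambda^\oplus_0(\rho^\bullet_A\oplus\rho^\bullet_B)\delta^r_{A,B,0}=\rho^\bullet_{A\oplus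 B}$; $\rho^\otimes_0=\lambda^\bullet_1$; $\lambda^\otimes_0=\rho^\bullet_1$; $\lambda^\bullet_{AB}\alpha^\otimes_{0,A,B}=\lambda^\bullet_B(\lambda^\bullet_A\otimes1)$; $\rho^\bullet_A(1\otimes\lambda^\bullet_B)\alpha^\otimes_{A,0,B}=\lambda^\bullet_B(\rho^\bullet_A\otimes1)$; $\rho^\bullet_A(1\otimes\rho^\bullet_B)\alpha^\otimes_{A,B,0}=\rho^\bullet_{AB}$; $\lambda^\oplus_{AB}(\rho^\bullet_A\oplus1)\delta^l_{A,0,B}=1\otimes\lambda^\oplus_B$; $\lambda^\oplus_{BA}(\lambda^\bullet_A\oplus1)\delta^r_{0,B,A}=\lambda^\oplus_B\otimes1$; $\rho^\oplus_{AB}(1\oplus\rho^\bullet_A)\delta^l_{A,B,0}=1\otimes\rho^\oplus_B$; $\rho^\oplus_{AB}(1\oplus\lambda^\bullet_B)\delta^r_{A,0,B}=\rho^\oplus_A\otimes1$; $(\lambda^\otimes_A\oplus\lambda^\otimes_B)\delta^l_{1,A,B}=\lambda^\otimes_{A\oplus B}$; $(\rho^\otimes_A\oplus\rho^\otimes_B)\delta^r_{A,B,1}=\rho^\otimes_{A\oplus B}$. A braided bimonoidal category is a bimonoidal category with a braiding $\zeta^\otimes$ making $\otimes$ braided monoidal, such that $\delta^l_{C,A,B}\zeta^\otimes_{A\oplus B,C}=(\zeta^\otimes_{A,C}\oplus\zeta^\otimes_{B,C})\delta^r_{A,B,C}$, $\delta^r_{B,C,A}\zeta^\otimes_{A,B\oplus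 C}=(\zeta^\otimes_{A,B}\oplus\zeta^\otimes_{A,C})\delta^l_{A,B,C}$, $\lambda^\bullet_A\zeta^\otimes_{A,0}=\rho^\bullet_A$, and $\rho^\bullet_A\zeta^\otimes_{0,A}=\lambda^\bullet_A$. The graph $\mathrm{Gr}(X)$. Its vertices are the elements of $X^{\mathrm{fr}}$, the set of all formal fully bracketed expressions in elements of $X$ with two binary operations $\oplus,\otimes$ (the free $\{\oplus,\otimes\}$-algebra on $X$). Elementary edges are, for all $a,b,c\in X^{\mathrm{fr}}$: an identity edge $1_a:a\to a$; formal edges $\alpha^\oplus_{a,b,c}$, $\lambda^\oplus_a:0^X\oplus a\to a$, $\rho^\oplus_a$, $\zeta^\oplus_{a,b}$, $\alpha^\otimes_{a,b,c}$, $\lambda^\otimes_a:1^X\otimes a\to a$, $\rho^\otimes_a$, $\zeta^\otimes_{a,b}$, $\lambda^\bullet_a:0^X\otimes a\to 0^X$, $\rho^\bullet_a:a\otimes0^X\to0^X$, with the evident (co)domains, and formal inverses of all of these; and $\delta^l_{a,b,c}:a\otimes(b\oplus c)\to(a\otimes b)\oplus(a\otimes c)$, $\delta^r_{a,b,c}:(a\oplus b)\otimes c\to(a\otimes c)\oplus(b\otimes c)$ (without formal inverses). The edges of $\mathrm{Gr}(X)$ (prime edges) are the formal $\{\oplus,\otimes\}$-expressions in elementary edges involving at most one nonidentity elementary edge, with the induced (co)domains. A $\delta$-prime edge is a prime edge whose nonidentity elementary edge is some $\delta^l$ or $\delta^r$. A path is a finite composable sequence of edges. The function $\varphi$ extends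 to vertices by sending formal $\oplus,\otimes$ to those of $C$, and to edges by sending each formal elementary edge to the corresponding structure morphism (or identity or inverse) and formal $\oplus,\otimes$ to $\oplus,\otimes$ of morphisms; the value of a path in $C$ is the composite of the images of its edges. The braided distortion category $\mathcal D^{\mathrm{br}}$. Objects: finite sequences $\underline r=(r_1,\dots,r_m)$ of nonnegative integers, including the empty sequence $\emptyset$. A morphism $\underline r\to\underline s$ exists only if the lengths are both some $m$, and is a tuple $(\sigma;\sigma_1,\dots,\sigma_m)$ with $\sigma\in\Sigma_m$, $s_{\sigma(i)}=r_i$ and $\sigma_i\in B_{r_i}$ (the braid group on $r_i$ strings); composition is $(\tau;\tau_i)(\sigma;\sigma_i)=(\tau\sigma;\tau_{\sigma(i)}\sigma_i)$. Sum: concatenation, with block sum of permutations, zero object $\emptyset$, and $\zeta^\oplus$ the block swap with identity braids. Product: $\underline r\otimes\underline s$ (lengths $m,n$) has length $mn$ with entry $r_i+s_j$ in position $(i,j):=i+(j-1)m$; $(\sigma;\sigma_i)\otimes(\tau;\tau_j)$ has permutation $(i,j)\mapsto(\sigma i,\tau j)$ and braids the juxtapositions $\sigma_i\oplus\tau_j\in B_{r_i+s_j}$; unit object $(0)$; $\zeta^\otimes_{\underline r,\underline s}$ has permutation $(i,j)\mapsto(j,i)$ and braids $b_{r_i,s_j}\in B_{r_i+s_j}$, the block braid crossing the first $r_i$ strings with the last $s_j$ strings obtained from the generator $s_1\in B_2$. All $\alpha,\lambda,\rho$ (for $\oplus$ and $\otimes$), $\lambda^\bullet$, $\rho^\bullet$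 and $\delta^l$ are identities; $\delta^r$ has the evident reordering permutation and identity braids. This is a tight braided bimonoidal category. The braided distortion of a path in $\mathrm{Gr}(X)$ is its value in $\mathcal D^{\mathrm{br}}$ with respect to the function $X\to\mathrm{Ob}(\mathcal D^{\mathrm{br}})$ sending $0^X\mapsto\emptyset$, $1^X\mapsto(0)$, and every other $x\mapsto(1)$. *)

theory Defs
  imports "HOL-Algebra.Group" "HOL-Combinatorics.Permutations"
begin

section \<open>Categories\<close>

record ('o, 'm) category_data =
  Obj :: "'o set"
  Arr :: "'m set"
  Dom :: "'m \<Rightarrow> 'o"
  Cod :: "'m \<Rightarrow> 'o"
  Idn :: "'o \<Rightarrow> 'm"  ("\<iota>\<index>")
  Cmp :: "'m \<Rightarrow> 'm \<Rightarrow> 'm"  (infixr "\<cdot>\<index>" 55)  (* g \<cdot> f applies f first *)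

definition homs :: "('o, 'm, 'z) category_data_scheme \<Rightarrow> 'o \<Rightarrow> 'o \<Rightarrow> 'm set" where
  "homs C A B = {f \<in> Arr C. Dom C f = A \<and> Cod C f = B}"

definition isos :: "('o, 'm, 'z) category_data_scheme \<Rightarrow> 'o \<Rightarrow> 'o \<Rightarrow> 'm set" where
  "isos C A B = {f \<in> homs C A B. \<exists>g \<in> homs C B A. Cmp C g f = Idn C A \<and> Cmp C f g = Idn C B}"

definition inv_arr :: "('o, 'm, 'z) category_data_scheme \<Rightarrow> 'm \<Rightarrow> 'm" where
  "inv_arr C f = (THE g. g \<in> homs C (Cod C f) (Dom C f) \<and>
     Cmp C g f = Idn C (Dom C f) \<and> Cmp C f g = Idn C (Cod C f))"

definition monic :: "('o, 'm, 'z) category_data_scheme \<Rightarrow> 'm \<Rightarrow> bool" where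
  "monic C f \<longleftrightarrow> f \<in> Arr C \<and>
     (\<forall>A. \<forall>g \<in> homs C A (Dom C f). \<forall>h \<in> homs C A (Dom C f). Cmp C f g = Cmp C f h \<longrightarrow> g = h)"

locale category =
  fixes C :: "('o, 'm, 'z) category_data_scheme" (structure)
  assumes Dom_Obj: "f \<in> Arr C \<Longrightarrow> Dom C f \<in> Obj C"
    and Cod_Obj: "f \<in> Arr C \<Longrightarrow> Cod C f \<in> Obj C"
    and Idn_homs: "A \<in> Obj C \<Longrightarrow> \<iota> A \<in> homs C A A"
    and Cmp_homs: "f \<in> homs C A B \<Longrightarrow> g \<in> homs C B D \<Longrightarrow> g \<cdot> f \<in> homs C A D"
    and Idn_left: "f \<in> homs C A B \<Longrightarrow> \<iota> B \<cdot> f = f"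
    and Idn_right: "f \<in> homs C A B \<Longrightarrow> f \<cdot> \<iota> A = f"
    and Cmp_assoc: "f \<in> homs C A B \<Longrightarrow> g \<in> homs C B D \<Longrightarrow> h \<in> homs C D E
      \<Longrightarrow> (h \<cdot> g) \<cdot> f = h \<cdot> (g \<cdot> f)"

section \<open>Monoidal, braided and symmetric monoidal structures\<close>

locale monoidal_structure = category C
  for C :: "('o, 'm, 'z) category_data_scheme" (structure) +
  fixes tensO :: "'o \<Rightarrow> 'o \<Rightarrow> 'o" (infixl "\<star>" 70)
    and tensM :: "'m \<Rightarrow> 'm \<Rightarrow> 'm" (infixl "\<star>\<^sub>m" 70)
    and unit :: 'o
    and \<alpha> :: "'o \<Rightarrow> 'o \<Rightarrow> 'o \<Rightarrow> 'm"
    and lunit :: "'o \<Rightarrow> 'm"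
    and runit :: "'o \<Rightarrow> 'm"
  assumes unit_Obj: "unit \<in> Obj C"
    and tensO_Obj: "A \<in> Obj C \<Longrightarrow> B \<in> Obj C \<Longrightarrow> A \<star> B \<in> Obj C"
    and tensM_homs: "f \<in> homs C A A' \<Longrightarrow> g \<in> homs C B B' \<Longrightarrow> f \<star>\<^sub>m g \<in> homs C (A \<star> B) (A' \<star> B')"
    and tensM_Idn: "A \<in> Obj C \<Longrightarrow> B \<in> Obj C \<Longrightarrow> \<iota> A \<star>\<^sub>m \<iota> B = \<iota> (A \<star> B)"
    and tensM_Cmp: "f \<in> homs C A A' \<Longrightarrow> f' \<in> homs C A' A'' \<Longrightarrow> g \<in> homs C B B' \<Longrightarrow> g' \<in> homs C B' B''
      \<Longrightarrow> (f' \<cdot> f) \<star>\<^sub>m (g' \<cdot> g) = (f' \<star>\<^sub>m g') \<cdot> (f \<star>\<^sub>m g)"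
    and \<alpha>_isos: "A \<in> Obj C \<Longrightarrow> B \<in> Obj C \<Longrightarrow> D \<in> Obj C
      \<Longrightarrow> \<alpha> A B D \<in> isos C ((A \<star> B) \<star> D) (A \<star> (B \<star> D))"
    and \<alpha>_natural: "f \<in> homs C A A' \<Longrightarrow> g \<in> homs C B B' \<Longrightarrow> h \<in> homs C D D'
      \<Longrightarrow> \<alpha> A' B' D' \<cdot> ((f \<star>\<^sub>m g) \<star>\<^sub>m h) = (f \<star>\<^sub>m (g \<star>\<^sub>m h)) \<cdot> \<alpha> A B D"
    and lunit_isos: "A \<in> Obj C \<Longrightarrow> lunit A \<in> isos C (unit \<star> A) A"
    and lunit_natural: "f \<in> homs C A A' \<Longrightarrow> lunit A' \<cdot> (\<iota> unit \<star>\<^sub>m f) = f \<cdot> lunit A"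
    and runit_isos: "A \<in> Obj C \<Longrightarrow> runit A \<in> isos C (A \<star> unit) A"
    and runit_natural: "f \<in> homs C A A' \<Longrightarrow> runit A' \<cdot> (f \<star>\<^sub>m \<iota> unit) = f \<cdot> runit A"
    and pentagon: "A \<in> Obj C \<Longrightarrow> B \<in> Obj C \<Longrightarrow> D \<in> Obj C \<Longrightarrow> E \<in> Obj C
      \<Longrightarrow> \<alpha> A B (D \<star> E) \<cdot> \<alpha> (A \<star> B) D E
        = (\<iota> A \<star>\<^sub>m \<alpha> B D E) \<cdot> \<alpha> A (B \<star> D) E \<cdot> (\<alpha> A B D \<star>\<^sub>m \<iota> E)"
    and triangle: "A \<in> Obj C \<Longrightarrow> B \<in> Obj C
      \<Longrightarrow> (\<iota> A \<star>\<^sub>m lunit B) \<cdot> \<alpha> A unit B = runit A \<star>\<^sub>m \<iota> B"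

locale braided_monoidal_structure = monoidal_structure C tensO tensM unit \<alpha> lunit runit
  for C :: "('o, 'm, 'z) category_data_scheme" (structure)
    and tensO (infixl "\<star>" 70) and tensM (infixl "\<star>\<^sub>m" 70) and unit and \<alpha> and lunit and runit +
  fixes \<zeta> :: "'o \<Rightarrow> 'o \<Rightarrow> 'm"
  assumes \<zeta>_isos: "A \<in> Obj C \<Longrightarrow> B \<in> Obj C \<Longrightarrow> \<zeta> A B \<in> isos C (A \<star> B) (B \<star> A)"
    and \<zeta>_natural: "f \<in> homs C A A' \<Longrightarrow> g \<in> homs C B B'
      \<Longrightarrow> \<zeta> A' B' \<cdot> (f \<star>\<^sub>m g) = (g \<star>\<^sub>m f) \<cdot> \<zeta> A B"
    and hexagon1: "A \<in> Obj C \<Longrightarrow> B \<in> Obj C \<Longrightarrow> D \<in> Obj C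
      \<Longrightarrow> \<alpha> B D A \<cdot> \<zeta> A (B \<star> D) \<cdot> \<alpha> A B D
        = (\<iota> B \<star>\<^sub>m \<zeta> A D) \<cdot> \<alpha> B A D \<cdot> (\<zeta> A B \<star>\<^sub>m \<iota> D)"
    and hexagon2: "A \<in> Obj C \<Longrightarrow> B \<in> Obj C \<Longrightarrow> D \<in> Obj C
      \<Longrightarrow> inv_arr C (\<alpha> D A B) \<cdot> \<zeta> (A \<star> B) D \<cdot> inv_arr C (\<alpha> A B D)
        = (\<zeta> A D \<star>\<^sub>m \<iota> B) \<cdot> inv_arr C (\<alpha> A D B) \<cdot> (\<iota> A \<star>\<^sub>m \<zeta> B D)"

locale symmetric_monoidal_structure = braided_monoidal_structure C tensO tensM unit \<alpha> lunit runit \<zeta>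
  for C :: "('o, 'm, 'z) category_data_scheme" (structure)
    and tensO (infixl "\<star>" 70) and tensM (infixl "\<star>\<^sub>m" 70) and unit and \<alpha> and lunit and runit and \<zeta> +
  assumes symmetry: "A \<in> Obj C \<Longrightarrow> B \<in> Obj C \<Longrightarrow> \<zeta> B A \<cdot> \<zeta> A B = \<iota> (A \<star> B)"

section \<open>Bimonoidal and braided bimonoidal categories\<close>

text \<open>
  The suffix \<open>P\<close> marks the structure of the sum, \<open>T\<close> that of the product; \<open>lambdaZ\<close> and
  \<open>rhoZ\<close> are the annihilators \<open>0A \<rightarrow> 0\<close> and \<open>A0 \<rightarrow> 0\<close>.
\<close>

record ('o, 'm) bimonoidal_data = "('o, 'm) category_data" +
  sumO :: "'o \<Rightarrow> 'o \<Rightarrow> 'o"  (infixl "\<oplus>\<index>" 65)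
  sumM :: "'m \<Rightarrow> 'm \<Rightarrow> 'm"  (infixl "\<oplus>\<^sub>m\<index>" 65)
  zeroO :: 'o
  alphaP :: "'o \<Rightarrow> 'o \<Rightarrow> 'o \<Rightarrow> 'm"
  lambdaP :: "'o \<Rightarrow> 'm"
  rhoP :: "'o \<Rightarrow> 'm"
  zetaP :: "'o \<Rightarrow> 'o \<Rightarrow> 'm"
  prodO :: "'o \<Rightarrow> 'o \<Rightarrow> 'o"  (infixl "\<odot>\<index>" 70)
  prodM :: "'m \<Rightarrow> 'm \<Rightarrow> 'm"  (infixl "\<odot>\<^sub>m\<index>" 70)
  oneO :: 'o
  alphaT :: "'o \<Rightarrow> 'o \<Rightarrow> 'o \<Rightarrow> 'm"
  lambdaT :: "'o \<Rightarrow> 'm"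
  rhoT :: "'o \<Rightarrow> 'm"
  lambdaZ :: "'o \<Rightarrow> 'm"
  rhoZ :: "'o \<Rightarrow> 'm"
  deltaL :: "'o \<Rightarrow> 'o \<Rightarrow> 'o \<Rightarrow> 'm"
  deltaR :: "'o \<Rightarrow> 'o \<Rightarrow> 'o \<Rightarrow> 'm"

record ('o, 'm) braided_bimonoidal_data = "('o, 'm) bimonoidal_data" +
  zetaT :: "'o \<Rightarrow> 'o \<Rightarrow> 'm"

text \<open>
  The coherence isomorphism \<open>(W + X) + (Y + Z) \<rightarrow> (W + Y) + (X + Z)\<close>. By coherence of symmetric
  monoidal categories it does not depend on the way it is written in terms of associativities
  and the symmetry \<open>X + Y \<rightarrow> Y + X\<close>.
\<close>

definition middle_swap ::
  "('o, 'm, 'z) bimonoidal_data_scheme \<Rightarrow> 'o \<Rightarrow> 'o \<Rightarrow> 'o \<Rightarrow> 'o \<Rightarrow> 'm" where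
  "middle_swap C W X Y Z =
     inv_arr C (alphaP C W Y (X \<oplus>\<^bsub>C\<^esub> Z))
     \<cdot>\<^bsub>C\<^esub> (\<iota>\<^bsub>C\<^esub> W \<oplus>\<^sub>m\<^bsub>C\<^esub>
         (alphaP C Y X Z \<cdot>\<^bsub>C\<^esub> (zetaP C X Y \<oplus>\<^sub>m\<^bsub>C\<^esub> \<iota>\<^bsub>C\<^esub> Z) \<cdot>\<^bsub>C\<^esub> inv_arr C (alphaP C X Y Z)))
     \<cdot>\<^bsub>C\<^esub> alphaP C W X (Y \<oplus>\<^bsub>C\<^esub> Z)"

locale bimonoidal_category =
  plus: symmetric_monoidal_structure C "sumO C" "sumM C" "zeroO C" "alphaP C" "lambdaP C" "rhoP C" "zetaP C" +
  times: monoidal_structure C "prodO C" "prodM C" "oneO C" "alphaT C" "lambdaT C" "rhoT C"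
  for C :: "('o, 'm, 'z) bimonoidal_data_scheme" (structure) +
  assumes lambdaZ_isos: "A \<in> Obj C \<Longrightarrow> lambdaZ C A \<in> isos C (zeroO C \<odot> A) (zeroO C)"
    and lambdaZ_natural: "f \<in> homs C A A'
      \<Longrightarrow> lambdaZ C A' \<cdot> (\<iota> (zeroO C) \<odot>\<^sub>m f) = lambdaZ C A"
    and rhoZ_isos: "A \<in> Obj C \<Longrightarrow> rhoZ C A \<in> isos C (A \<odot> zeroO C) (zeroO C)"
    and rhoZ_natural: "f \<in> homs C A A'
      \<Longrightarrow> rhoZ C A' \<cdot> (f \<odot>\<^sub>m \<iota> (zeroO C)) = rhoZ C A"
    and deltaL_homs: "A \<in> Obj C \<Longrightarrow> B \<in> Obj C \<Longrightarrow> D \<in> Obj C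
      \<Longrightarrow> deltaL C A B D \<in> homs C (A \<odot> (B \<oplus> D)) (A \<odot> B \<oplus> A \<odot> D)"
    and deltaL_monic: "A \<in> Obj C \<Longrightarrow> B \<in> Obj C \<Longrightarrow> D \<in> Obj C \<Longrightarrow> monic C (deltaL C A B D)"
    and deltaL_natural: "f \<in> homs C A A' \<Longrightarrow> g \<in> homs C B B' \<Longrightarrow> h \<in> homs C D D'
      \<Longrightarrow> deltaL C A' B' D' \<cdot> (f \<odot>\<^sub>m (g \<oplus>\<^sub>m h)) = (f \<odot>\<^sub>m g \<oplus>\<^sub>m f \<odot>\<^sub>m h) \<cdot> deltaL C A B D"
    and deltaR_homs: "A \<in> Obj C \<Longrightarrow> B \<in> Obj C \<Longrightarrow> D \<in> Obj C
      \<Longrightarrow> deltaR C A B D \<in> homs C ((A \<oplus> B) \<odot> D) (A \<odot> D \<oplus> B \<odot> D)"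
    and deltaR_monic: "A \<in> Obj C \<Longrightarrow> B \<in> Obj C \<Longrightarrow> D \<in> Obj C \<Longrightarrow> monic C (deltaR C A B D)"
    and deltaR_natural: "f \<in> homs C A A' \<Longrightarrow> g \<in> homs C B B' \<Longrightarrow> h \<in> homs C D D'
      \<Longrightarrow> deltaR C A' B' D' \<cdot> ((f \<oplus>\<^sub>m g) \<odot>\<^sub>m h) = (f \<odot>\<^sub>m h \<oplus>\<^sub>m g \<odot>\<^sub>m h) \<cdot> deltaR C A B D"
    and deltaL_zetaP: "A \<in> Obj C \<Longrightarrow> B \<in> Obj C \<Longrightarrow> D \<in> Obj C
      \<Longrightarrow> deltaL C A D B \<cdot> (\<iota> A \<odot>\<^sub>m zetaP C B D) = zetaP C (A \<odot> B) (A \<odot> D) \<cdot> deltaL C A B D"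
    and deltaR_zetaP: "A \<in> Obj C \<Longrightarrow> B \<in> Obj C \<Longrightarrow> D \<in> Obj C
      \<Longrightarrow> deltaR C B A D \<cdot> (zetaP C A B \<odot>\<^sub>m \<iota> D) = zetaP C (A \<odot> D) (B \<odot> D) \<cdot> deltaR C A B D"
    and deltaR_alphaP: "A \<in> Obj C \<Longrightarrow> B \<in> Obj C \<Longrightarrow> D \<in> Obj C \<Longrightarrow> E \<in> Obj C
      \<Longrightarrow> alphaP C (A \<odot> E) (B \<odot> E) (D \<odot> E) \<cdot> (deltaR C A B E \<oplus>\<^sub>m \<iota> (D \<odot> E)) \<cdot> deltaR C (A \<oplus> B) D E
        = (\<iota> (A \<odot> E) \<oplus>\<^sub>m deltaR C B D E) \<cdot> deltaR C A (B \<oplus> D) E \<cdot> (alphaP C A B D \<odot>\<^sub>m \<iota> E)"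
    and deltaL_alphaP: "A \<in> Obj C \<Longrightarrow> B \<in> Obj C \<Longrightarrow> D \<in> Obj C \<Longrightarrow> E \<in> Obj C
      \<Longrightarrow> alphaP C (A \<odot> B) (A \<odot> D) (A \<odot> E) \<cdot> (deltaL C A B D \<oplus>\<^sub>m \<iota> (A \<odot> E)) \<cdot> deltaL C A (B \<oplus> D) E
        = (\<iota> (A \<odot> B) \<oplus>\<^sub>m deltaL C A D E) \<cdot> deltaL C A B (D \<oplus> E) \<cdot> (\<iota> A \<odot>\<^sub>m alphaP C B D E)"
    and deltaL_alphaT: "A \<in> Obj C \<Longrightarrow> B \<in> Obj C \<Longrightarrow> D \<in> Obj C \<Longrightarrow> E \<in> Obj C
      \<Longrightarrow> deltaL C A (B \<odot> D) (B \<odot> E) \<cdot> (\<iota> A \<odot>\<^sub>m deltaL C B D E) \<cdot> alphaT C A B (D \<oplus> E)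
        = (alphaT C A B D \<oplus>\<^sub>m alphaT C A B E) \<cdot> deltaL C (A \<odot> B) D E"
    and deltaR_alphaT: "A \<in> Obj C \<Longrightarrow> B \<in> Obj C \<Longrightarrow> D \<in> Obj C \<Longrightarrow> E \<in> Obj C
      \<Longrightarrow> (alphaT C A D E \<oplus>\<^sub>m alphaT C B D E) \<cdot> deltaR C (A \<odot> D) (B \<odot> D) E \<cdot> (deltaR C A B D \<odot>\<^sub>m \<iota> E)
        = deltaR C A B (D \<odot> E) \<cdot> alphaT C (A \<oplus> B) D E"
    and deltaLR_alphaT: "A \<in> Obj C \<Longrightarrow> B \<in> Obj C \<Longrightarrow> D \<in> Obj C \<Longrightarrow> E \<in> Obj C
      \<Longrightarrow> (alphaT C A B E \<oplus>\<^sub>m alphaT C A D E) \<cdot> deltaR C (A \<odot> B) (A \<odot> D) E \<cdot> (deltaL C A B D \<odot>\<^sub>m \<iota> E)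
        = deltaL C A (B \<odot> E) (D \<odot> E) \<cdot> (\<iota> A \<odot>\<^sub>m deltaR C B D E) \<cdot> alphaT C A (B \<oplus> D) E"
    and deltaLR_middle_swap: "A \<in> Obj C \<Longrightarrow> B \<in> Obj C \<Longrightarrow> D \<in> Obj C \<Longrightarrow> E \<in> Obj C
      \<Longrightarrow> middle_swap C (A \<odot> D) (A \<odot> E) (B \<odot> D) (B \<odot> E)
            \<cdot> (deltaL C A D E \<oplus>\<^sub>m deltaL C B D E) \<cdot> deltaR C A B (D \<oplus> E)
        = (deltaR C A B D \<oplus>\<^sub>m deltaR C A B E) \<cdot> deltaL C (A \<oplus> B) D E"
    and lambdaZ_rhoZ_zero: "lambdaZ C (zeroO C) = rhoZ C (zeroO C)"
    and lambdaZ_deltaL: "A \<in> Obj C \<Longrightarrow> B \<in> Obj C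
      \<Longrightarrow> lambdaP C (zeroO C) \<cdot> (lambdaZ C A \<oplus>\<^sub>m lambdaZ C B) \<cdot> deltaL C (zeroO C) A B = lambdaZ C (A \<oplus> B)"
    and rhoZ_deltaR: "A \<in> Obj C \<Longrightarrow> B \<in> Obj C
      \<Longrightarrow> lambdaP C (zeroO C) \<cdot> (rhoZ C A \<oplus>\<^sub>m rhoZ C B) \<cdot> deltaR C A B (zeroO C) = rhoZ C (A \<oplus> B)"
    and rhoT_zero: "rhoT C (zeroO C) = lambdaZ C (oneO C)"
    and lambdaT_zero: "lambdaT C (zeroO C) = rhoZ C (oneO C)"
    and lambdaZ_alphaT: "A \<in> Obj C \<Longrightarrow> B \<in> Obj C
      \<Longrightarrow> lambdaZ C (A \<odot> B) \<cdot> alphaT C (zeroO C) A B = lambdaZ C B \<cdot> (lambdaZ C A \<odot>\<^sub>m \<iota> B)"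
    and lambdaZ_rhoZ_alphaT: "A \<in> Obj C \<Longrightarrow> B \<in> Obj C
      \<Longrightarrow> rhoZ C A \<cdot> (\<iota> A \<odot>\<^sub>m lambdaZ C B) \<cdot> alphaT C A (zeroO C) B = lambdaZ C B \<cdot> (rhoZ C A \<odot>\<^sub>m \<iota> B)"
    and rhoZ_alphaT: "A \<in> Obj C \<Longrightarrow> B \<in> Obj C
      \<Longrightarrow> rhoZ C A \<cdot> (\<iota> A \<odot>\<^sub>m rhoZ C B) \<cdot> alphaT C A B (zeroO C) = rhoZ C (A \<odot> B)"
    and lambdaP_deltaL: "A \<in> Obj C \<Longrightarrow> B \<in> Obj C
      \<Longrightarrow> lambdaP C (A \<odot> B) \<cdot> (rhoZ C A \<oplus>\<^sub>m \<iota> (A \<odot> B)) \<cdot> deltaL C A (zeroO C) B = \<iota> A \<odot>\<^sub>m lambdaP C B"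
    and lambdaP_deltaR: "A \<in> Obj C \<Longrightarrow> B \<in> Obj C
      \<Longrightarrow> lambdaP C (B \<odot> A) \<cdot> (lambdaZ C A \<oplus>\<^sub>m \<iota> (B \<odot> A)) \<cdot> deltaR C (zeroO C) B A = lambdaP C B \<odot>\<^sub>m \<iota> A"
    and rhoP_deltaL: "A \<in> Obj C \<Longrightarrow> B \<in> Obj C
      \<Longrightarrow> rhoP C (A \<odot> B) \<cdot> (\<iota> (A \<odot> B) \<oplus>\<^sub>m rhoZ C A) \<cdot> deltaL C A B (zeroO C) = \<iota> A \<odot>\<^sub>m rhoP C B"
    and rhoP_deltaR: "A \<in> Obj C \<Longrightarrow> B \<in> Obj C
      \<Longrightarrow> rhoP C (A \<odot> B) \<cdot> (\<iota> (A \<odot> B) \<oplus>\<^sub>m lambdaZ C B) \<cdot> deltaR C A (zeroO C) B = rhoP C A \<odot>\<^sub>m \<iota> B"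
    and lambdaT_deltaL: "A \<in> Obj C \<Longrightarrow> B \<in> Obj C
      \<Longrightarrow> (lambdaT C A \<oplus>\<^sub>m lambdaT C B) \<cdot> deltaL C (oneO C) A B = lambdaT C (A \<oplus> B)"
    and rhoT_deltaR: "A \<in> Obj C \<Longrightarrow> B \<in> Obj C
      \<Longrightarrow> (rhoT C A \<oplus>\<^sub>m rhoT C B) \<cdot> deltaR C A B (oneO C) = rhoT C (A \<oplus> B)"

locale braided_bimonoidal_category =
  bimonoidal_category C +
  braided_times: braided_monoidal_structure C "prodO C" "prodM C" "oneO C" "alphaT C" "lambdaT C" "rhoT C" "zetaT C"
  for C :: "('o, 'm, 'z) braided_bimonoidal_data_scheme" (structure) +
  assumes deltaL_zetaT: "A \<in> Obj C \<Longrightarrow> B \<in> Obj C \<Longrightarrow> D \<in> Obj C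
      \<Longrightarrow> deltaL C D A B \<cdot> zetaT C (A \<oplus> B) D = (zetaT C A D \<oplus>\<^sub>m zetaT C B D) \<cdot> deltaR C A B D"
    and deltaR_zetaT: "A \<in> Obj C \<Longrightarrow> B \<in> Obj C \<Longrightarrow> D \<in> Obj C
      \<Longrightarrow> deltaR C B D A \<cdot> zetaT C A (B \<oplus> D) = (zetaT C A B \<oplus>\<^sub>m zetaT C A D) \<cdot> deltaL C A B D"
    and lambdaZ_zetaT: "A \<in> Obj C \<Longrightarrow> lambdaZ C A \<cdot> zetaT C A (zeroO C) = rhoZ C A"
    and rhoZ_zetaT: "A \<in> Obj C \<Longrightarrow> rhoZ C A \<cdot> zetaT C (zeroO C) A = lambdaZ C A"

section \<open>The graph \<open>Gr(X)\<close>, its paths and their values\<close>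

datatype (atoms: 'x) vertex =
    Atom 'x
  | VSum "'x vertex" "'x vertex"
  | VProd "'x vertex" "'x vertex"

text \<open>The invertible formal elementary edges other than the identities.\<close>

datatype 'x iso_edge =
    AlphaP "'x vertex" "'x vertex" "'x vertex"
  | LambdaP "'x vertex"
  | RhoP "'x vertex"
  | ZetaP "'x vertex" "'x vertex"
  | AlphaT "'x vertex" "'x vertex" "'x vertex"
  | LambdaT "'x vertex"
  | RhoT "'x vertex"
  | ZetaT "'x vertex" "'x vertex"
  | LambdaZ "'x vertex"
  | RhoZ "'x vertex"

datatype 'x elem_edge =
    IdE "'x vertex"
  | Iso "'x iso_edge"
  | IsoInv "'x iso_edge"
  | DeltaL "'x vertex" "'x vertex" "'x vertex"
  | DeltaR "'x vertex" "'x vertex" "'x vertex"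

text \<open>
  The set function \<open>edge_atoms\<close> generated by the package collects the elements of \<open>X\<close> occurring
  in the labels of an edge.
\<close>

datatype (edge_atoms: 'x) edge =
    Elem "'x elem_edge"
  | ESum "'x edge" "'x edge"
  | EProd "'x edge" "'x edge"

text \<open>In the following, \<open>z\<close> and \<open>u\<close> are the distinguished elements written \<open>0\<close> and \<open>1\<close> of \<open>X\<close>.\<close>

fun iso_dom :: "'x \<Rightarrow> 'x \<Rightarrow> 'x iso_edge \<Rightarrow> 'x vertex" where
  "iso_dom z u (AlphaP a b c) = VSum (VSum a b) c"
| "iso_dom z u (LambdaP a) = VSum (Atom z) a"
| "iso_dom z u (RhoP a) = VSum a (Atom z)"
| "iso_dom z u (ZetaP a b) = VSum a b"
| "iso_dom z u (AlphaT a b c) = VProd (VProd a b) c"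
| "iso_dom z u (LambdaT a) = VProd (Atom u) a"
| "iso_dom z u (RhoT a) = VProd a (Atom u)"
| "iso_dom z u (ZetaT a b) = VProd a b"
| "iso_dom z u (LambdaZ a) = VProd (Atom z) a"
| "iso_dom z u (RhoZ a) = VProd a (Atom z)"

fun iso_cod :: "'x \<Rightarrow> 'x iso_edge \<Rightarrow> 'x vertex" where
  "iso_cod z (AlphaP a b c) = VSum a (VSum b c)"
| "iso_cod z (LambdaP a) = a"
| "iso_cod z (RhoP a) = a"
| "iso_cod z (ZetaP a b) = VSum b a"
| "iso_cod z (AlphaT a b c) = VProd a (VProd b c)"
| "iso_cod z (LambdaT a) = a"
| "iso_cod z (RhoT a) = a"
| "iso_cod z (ZetaT a b) = VProd b a"
| "iso_cod z (LambdaZ a) = Atom z"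
| "iso_cod z (RhoZ a) = Atom z"

fun elem_dom :: "'x \<Rightarrow> 'x \<Rightarrow> 'x elem_edge \<Rightarrow> 'x vertex" where
  "elem_dom z u (IdE a) = a"
| "elem_dom z u (Iso e) = iso_dom z u e"
| "elem_dom z u (IsoInv e) = iso_cod z e"
| "elem_dom z u (DeltaL a b c) = VProd a (VSum b c)"
| "elem_dom z u (DeltaR a b c) = VProd (VSum a b) c"

fun elem_cod :: "'x \<Rightarrow> 'x \<Rightarrow> 'x elem_edge \<Rightarrow> 'x vertex" where
  "elem_cod z u (IdE a) = a"
| "elem_cod z u (Iso e) = iso_cod z e"
| "elem_cod z u (IsoInv e) = iso_dom z u e"
| "elem_cod z u (DeltaL a b c) = VSum (VProd a b) (VProd a c)"
| "elem_cod z u (DeltaR a b c) = VSum (VProd a c) (VProd b c)"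

primrec edge_dom :: "'x \<Rightarrow> 'x \<Rightarrow> 'x edge \<Rightarrow> 'x vertex" where
  "edge_dom z u (Elem e) = elem_dom z u e"
| "edge_dom z u (ESum e f) = VSum (edge_dom z u e) (edge_dom z u f)"
| "edge_dom z u (EProd e f) = VProd (edge_dom z u e) (edge_dom z u f)"

primrec edge_cod :: "'x \<Rightarrow> 'x \<Rightarrow> 'x edge \<Rightarrow> 'x vertex" where
  "edge_cod z u (Elem e) = elem_cod z u e"
| "edge_cod z u (ESum e f) = VSum (edge_cod z u e) (edge_cod z u f)"
| "edge_cod z u (EProd e f) = VProd (edge_cod z u e) (edge_cod z u f)"

primrec nonidentities :: "'x edge \<Rightarrow> 'x elem_edge list" where
  "nonidentities (Elem e) = (if \<exists>a. e = IdE a then [] else [e])"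
| "nonidentities (ESum e f) = nonidentities e @ nonidentities f"
| "nonidentities (EProd e f) = nonidentities e @ nonidentities f"

definition prime_edges :: "'x set \<Rightarrow> 'x edge set" where
  "prime_edges X = {e. edge_atoms e \<subseteq> X \<and> length (nonidentities e) \<le> 1}"

definition delta_prime_edges :: "'x set \<Rightarrow> 'x edge set" where
  "delta_prime_edges X = {e \<in> prime_edges X.
     \<exists>a b c. nonidentities e = [DeltaL a b c] \<or> nonidentities e = [DeltaR a b c]}"

text \<open>
  \<open>gr_path X z u a es b\<close>: \<open>es\<close> is a path from \<open>a\<close> to \<open>b\<close> in \<open>Gr(X)\<close>, the edge traversed first being
  the head of the list. The empty sequence is a path from each vertex to itself.
\<close>

fun gr_path :: "'x set \<Rightarrow> 'x \<Rightarrow> 'x \<Rightarrow> 'x vertex \<Rightarrow> 'x edge list \<Rightarrow> 'x vertex \<Rightarrow> bool" where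
  "gr_path X z u a [] b \<longleftrightarrow> atoms a \<subseteq> X \<and> a = b"
| "gr_path X z u a (e # es) b \<longleftrightarrow>
     e \<in> prime_edges X \<and> edge_dom z u e = a \<and> gr_path X z u (edge_cod z u e) es b"

primrec vertex_val :: "('o, 'm, 'z) braided_bimonoidal_data_scheme \<Rightarrow> ('x \<Rightarrow> 'o) \<Rightarrow> 'x vertex \<Rightarrow> 'o" where
  "vertex_val C \<phi> (Atom x) = \<phi> x"
| "vertex_val C \<phi> (VSum a b) = vertex_val C \<phi> a \<oplus>\<^bsub>C\<^esub> vertex_val C \<phi> b"
| "vertex_val C \<phi> (VProd a b) = vertex_val C \<phi> a \<odot>\<^bsub>C\<^esub> vertex_val C \<phi> b"

fun iso_val :: "('o, 'm, 'z) braided_bimonoidal_data_scheme \<Rightarrow> ('x \<Rightarrow> 'o) \<Rightarrow> 'x iso_edge \<Rightarrow> 'm" where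
  "iso_val C \<phi> (AlphaP a b c) = alphaP C (vertex_val C \<phi> a) (vertex_val C \<phi> b) (vertex_val C \<phi> c)"
| "iso_val C \<phi> (LambdaP a) = lambdaP C (vertex_val C \<phi> a)"
| "iso_val C \<phi> (RhoP a) = rhoP C (vertex_val C \<phi> a)"
| "iso_val C \<phi> (ZetaP a b) = zetaP C (vertex_val C \<phi> a) (vertex_val C \<phi> b)"
| "iso_val C \<phi> (AlphaT a b c) = alphaT C (vertex_val C \<phi> a) (vertex_val C \<phi> b) (vertex_val C \<phi> c)"
| "iso_val C \<phi> (LambdaT a) = lambdaT C (vertex_val C \<phi> a)"
| "iso_val C \<phi> (RhoT a) = rhoT C (vertex_val C \<phi> a)"
| "iso_val C \<phi> (ZetaT a b) = zetaT C (vertex_val C \<phi> a) (vertex_val C \<phi> b)"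
| "iso_val C \<phi> (LambdaZ a) = lambdaZ C (vertex_val C \<phi> a)"
| "iso_val C \<phi> (RhoZ a) = rhoZ C (vertex_val C \<phi> a)"

fun elem_val :: "('o, 'm, 'z) braided_bimonoidal_data_scheme \<Rightarrow> ('x \<Rightarrow> 'o) \<Rightarrow> 'x elem_edge \<Rightarrow> 'm" where
  "elem_val C \<phi> (IdE a) = \<iota>\<^bsub>C\<^esub> (vertex_val C \<phi> a)"
| "elem_val C \<phi> (Iso e) = iso_val C \<phi> e"
| "elem_val C \<phi> (IsoInv e) = inv_arr C (iso_val C \<phi> e)"
| "elem_val C \<phi> (DeltaL a b c) = deltaL C (vertex_val C \<phi> a) (vertex_val C \<phi> b) (vertex_val C \<phi> c)"
| "elem_val C \<phi> (DeltaR a b c) = deltaR C (vertex_val C \<phi> a) (vertex_val C \<phi> b) (vertex_val C \<phi> c)"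

primrec edge_val :: "('o, 'm, 'z) braided_bimonoidal_data_scheme \<Rightarrow> ('x \<Rightarrow> 'o) \<Rightarrow> 'x edge \<Rightarrow> 'm" where
  "edge_val C \<phi> (Elem e) = elem_val C \<phi> e"
| "edge_val C \<phi> (ESum e f) = edge_val C \<phi> e \<oplus>\<^sub>m\<^bsub>C\<^esub> edge_val C \<phi> f"
| "edge_val C \<phi> (EProd e f) = edge_val C \<phi> e \<odot>\<^sub>m\<^bsub>C\<^esub> edge_val C \<phi> f"

definition path_val ::
  "('o, 'm, 'z) braided_bimonoidal_data_scheme \<Rightarrow> ('x \<Rightarrow> 'o) \<Rightarrow> 'x vertex \<Rightarrow> 'x edge list \<Rightarrow> 'm" where
  "path_val C \<phi> a es = foldl (\<lambda>g e. edge_val C \<phi> e \<cdot>\<^bsub>C\<^esub> g) (\<iota>\<^bsub>C\<^esub> (vertex_val C \<phi> a)) es"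

section \<open>Braid groups\<close>

text \<open>
  Artin's presentation. The letter \<open>(i, True)\<close> is the generator crossing the strings in positions
  \<open>i\<close> and \<open>i + 1\<close>, counted from 0, and \<open>(i, False)\<close> is its inverse. Products are read
  like compositions of maps: the rightmost letter comes first.
\<close>

type_synonym braid = "(nat \<times> bool) list set"

definition braid_words :: "nat \<Rightarrow> (nat \<times> bool) list set" where
  "braid_words n = lists ({i. Suc i < n} \<times> UNIV)"

inductive_set braid_rel :: "nat \<Rightarrow> ((nat \<times> bool) list \<times> (nat \<times> bool) list) set" for n :: nat where
  refl: "v \<in> braid_words n \<Longrightarrow> (v, v) \<in> braid_rel n"
| sym: "(v, w) \<in> braid_rel n \<Longrightarrow> (w, v) \<in> braid_rel n"
| trans: "(v, w) \<in> braid_rel n \<Longrightarrow> (w, x) \<in> braid_rel n \<Longrightarrow> (v, x) \<in> braid_rel n"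
| cong: "(v, w) \<in> braid_rel n \<Longrightarrow> x \<in> braid_words n \<Longrightarrow> y \<in> braid_words n
    \<Longrightarrow> (x @ v @ y, x @ w @ y) \<in> braid_rel n"
| cancel: "Suc i < n \<Longrightarrow> ([(i, b), (i, \<not> b)], []) \<in> braid_rel n"
| far: "Suc i < j \<Longrightarrow> Suc j < n \<Longrightarrow> ([(i, True), (j, True)], [(j, True), (i, True)]) \<in> braid_rel n"
| braid: "Suc (Suc i) < n \<Longrightarrow>
    ([(i, True), (Suc i, True), (i, True)], [(Suc i, True), (i, True), (Suc i, True)]) \<in> braid_rel n"

definition braid_group :: "nat \<Rightarrow> braid monoid" where
  "braid_group n =
     \<lparr>carrier = braid_words n // braid_rel n,
      monoid.mult = (\<lambda>\<beta> \<gamma>. {x. \<exists>v \<in> \<beta>. \<exists>w \<in> \<gamma>. (v @ w, x) \<in> braid_rel n}),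
      one = braid_rel n `` {[]}\<rparr>"

text \<open>Juxtaposition of a braid on \<open>p\<close> strings (left) and one on \<open>q\<close> strings (right).\<close>

definition braid_juxt :: "nat \<Rightarrow> nat \<Rightarrow> braid \<Rightarrow> braid \<Rightarrow> braid" where
  "braid_juxt p q \<beta> \<gamma> =
     {x. \<exists>v \<in> \<beta>. \<exists>w \<in> \<gamma>. (v @ map (\<lambda>(i, b). (p + i, b)) w, x) \<in> braid_rel (p + q)}"

text \<open>
  The block braid on \<open>p + q\<close> strings that crosses the first \<open>p\<close> strings with the last \<open>q\<close>. Writing
  \<open>s\<^sub>i\<close> for the generator at positions \<open>i\<close>, \<open>i + 1\<close>, it is the product over \<open>i = 0, \<dots>, p - 1\<close>
  (from left to right) of \<open>s\<^bsub>i+q-1\<^esub> \<dots> s\<^bsub>i+1\<^esub> s\<^sub>i\<close>. It is determined by \<open>b\<^bsub>1,1\<^esub> = s\<^sub>0\<close> and the hexagon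
  identities \<open>b\<^bsub>p,q+q'\<^esub> = (1 + b\<^bsub>p,q'\<^esub>)(b\<^bsub>p,q\<^esub> + 1)\<close> and \<open>b\<^bsub>p+p',q\<^esub> = (b\<^bsub>p,q\<^esub> + 1)(1 + b\<^bsub>p',q\<^esub>)\<close>.
\<close>

definition block_braid :: "nat \<Rightarrow> nat \<Rightarrow> braid" where
  "block_braid p q =
     braid_rel (p + q) `` {concat (map (\<lambda>i. rev (map (\<lambda>k. (k, True)) [i..<i + q])) [0..<p])}"

section \<open>The braided distortion category\<close>

text \<open>
  Positions in sequences are counted from 0, so that the pair \<open>(i, j)\<close> is encoded by \<open>i + j * m\<close>.
  Permutations of \<open>{..<m}\<close> are functions that are the identity outside this set.
\<close>

record dist_mor =
  dsrc :: "nat list"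
  dtgt :: "nat list"
  dperm :: "nat \<Rightarrow> nat"
  dbraids :: "braid list"

definition dist_arrows :: "dist_mor set" where
  "dist_arrows = {f. let m = length (dsrc f) in
     length (dtgt f) = m \<and> length (dbraids f) = m \<and> dperm f permutes {..<m} \<and>
     (\<forall>i<m. dtgt f ! dperm f i = dsrc f ! i \<and> dbraids f ! i \<in> carrier (braid_group (dsrc f ! i)))}"

definition dist_reorder :: "nat list \<Rightarrow> nat list \<Rightarrow> (nat \<Rightarrow> nat) \<Rightarrow> dist_mor" where
  "dist_reorder r s \<sigma> =
     \<lparr>dsrc = r, dtgt = s, dperm = \<sigma>, dbraids = map (\<lambda>n. one (braid_group n)) r\<rparr>"

definition dist_id :: "nat list \<Rightarrow> dist_mor" where
  "dist_id r = dist_reorder r r id"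

definition dist_comp :: "dist_mor \<Rightarrow> dist_mor \<Rightarrow> dist_mor" where
  "dist_comp g f =
     \<lparr>dsrc = dsrc f, dtgt = dtgt g, dperm = dperm g \<circ> dperm f,
      dbraids = map (\<lambda>i. dbraids g ! dperm f i \<otimes>\<^bsub>braid_group (dsrc f ! i)\<^esub> dbraids f ! i)
        [0..<length (dsrc f)]\<rparr>"

definition dist_sum :: "dist_mor \<Rightarrow> dist_mor \<Rightarrow> dist_mor" where
  "dist_sum f g = (let m = length (dsrc f); n = length (dsrc g) in
     \<lparr>dsrc = dsrc f @ dsrc g, dtgt = dtgt f @ dtgt g,
      dperm = (\<lambda>k. if k < m then dperm f k else if k < m + n then m + dperm g (k - m) else k),
      dbraids = dbraids f @ dbraids g\<rparr>)"

definition dist_swap :: "nat list \<Rightarrow> nat list \<Rightarrow> dist_mor" where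
  "dist_swap r s = (let m = length r; n = length s in
     dist_reorder (r @ s) (s @ r) (\<lambda>k. if k < m then n + k else if k < m + n then k - m else k))"

definition dist_prod_obj :: "nat list \<Rightarrow> nat list \<Rightarrow> nat list" where
  "dist_prod_obj r s = (let m = length r; n = length s in
     map (\<lambda>k. r ! (k mod m) + s ! (k div m)) [0..<m * n])"

definition dist_prod :: "dist_mor \<Rightarrow> dist_mor \<Rightarrow> dist_mor" where
  "dist_prod f g = (let m = length (dsrc f); n = length (dsrc g) in
     \<lparr>dsrc = dist_prod_obj (dsrc f) (dsrc g), dtgt = dist_prod_obj (dtgt f) (dtgt g),
      dperm = (\<lambda>k. if k < m * n then dperm f (k mod m) + dperm g (k div m) * m else k),
      dbraids = map (\<lambda>k. braid_juxt (dsrc f ! (k mod m)) (dsrc g ! (k div m))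
        (dbraids f ! (k mod m)) (dbraids g ! (k div m))) [0..<m * n]\<rparr>)"

definition dist_braiding :: "nat list \<Rightarrow> nat list \<Rightarrow> dist_mor" where
  "dist_braiding r s = (let m = length r; n = length s in
     \<lparr>dsrc = dist_prod_obj r s, dtgt = dist_prod_obj s r,
      dperm = (\<lambda>k. if k < m * n then k div m + (k mod m) * n else k),
      dbraids = map (\<lambda>k. block_braid (r ! (k mod m)) (s ! (k div m))) [0..<m * n]\<rparr>)"

text \<open>
  The source of \<open>\<delta>\<^sup>r\<close> is indexed by pairs \<open>(i, j)\<close> with \<open>i < m + n\<close>; those with \<open>i < m\<close> go to the
  first summand of the target, the others to the second one, in both cases keeping their order.
\<close>

definition dist_deltaR :: "nat list \<Rightarrow> nat list \<Rightarrow> nat list \<Rightarrow> dist_mor" where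
  "dist_deltaR r s t = (let m = length r; n = length s; p = length t in
     dist_reorder (dist_prod_obj (r @ s) t) (dist_prod_obj r t @ dist_prod_obj s t)
       (\<lambda>k. if k < (m + n) * p
            then let i = k mod (m + n); j = k div (m + n)
                 in if i < m then i + j * m else m * p + ((i - m) + j * n)
            else k))"

definition Dbr :: "(nat list, dist_mor) braided_bimonoidal_data" where
  "Dbr =
     \<lparr>Obj = UNIV, Arr = dist_arrows, Dom = dsrc, Cod = dtgt, Idn = dist_id, Cmp = dist_comp,
      sumO = (@), sumM = dist_sum, zeroO = [],
      alphaP = (\<lambda>r s t. dist_id (r @ s @ t)), lambdaP = dist_id, rhoP = dist_id, zetaP = dist_swap,
      prodO = dist_prod_obj, prodM = dist_prod, oneO = [0],
      alphaT = (\<lambda>r s t. dist_id (dist_prod_obj r (dist_prod_obj s t))),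
      lambdaT = dist_id, rhoT = dist_id,
      lambdaZ = (\<lambda>r. dist_id []), rhoZ = (\<lambda>r. dist_id []),
      deltaL = (\<lambda>r s t. dist_id (dist_prod_obj r (s @ t))), deltaR = dist_deltaR,
      zetaT = dist_braiding\<rparr>"

definition dist_obj :: "'x \<Rightarrow> 'x \<Rightarrow> 'x \<Rightarrow> nat list" where
  "dist_obj z u x = (if x = z then [] else if x = u then [0] else [1])"

definition braided_distortion :: "'x \<Rightarrow> 'x \<Rightarrow> 'x vertex \<Rightarrow> 'x edge list \<Rightarrow> dist_mor" where
  "braided_distortion z u a es = path_val Dbr (dist_obj z u) a es"

end

theory Submission
  imports Defs
begin

text \<open>
  Multiplying out turns every vertex into a sum of monomials, where a monomial is a word in the atoms
  other than \<open>0\<close> and \<open>1\<close>. The arrow \<open>expand a\<close> from the value of a vertex \<open>a\<close> to the value of its sum of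
  monomials is a composite of associativities, unit arrows, annihilators and distributivities.
  Along every edge \<open>e : a \<rightarrow> b\<close> there is a commuting square \<open>expand b \<bullet> e = \<rho> \<bullet> expand a\<close> in which \<open>\<rho>\<close>
  permutes the summands and braids the factors of each monomial in the way that the distortion of
  \<open>e\<close> prescribes (\<open>tracks_edge\<close>). The arrow \<open>\<rho>\<close> is determined by the distortion and by the monomials of
  \<open>a\<close> (\<open>Track_unique\<close>): the arrows between the orderings of an iterated sum are coherent
  (\<open>perm_trans\<close>), and the relations of the braid group hold for the braidings of adjacent factors of a
  word (\<open>braid_respects\<close>). Hence two parallel paths with the same distortion agree after composition
  with \<open>expand b\<close> (\<open>expand_path_arrow\<close>). They agree because \<open>expand b\<close> is monic
  (\<open>stable_mono_expand\<close>): it is a composite of isomorphisms and of distributivities applied inside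
  sums and products, and the latter are values of \<open>\<delta>\<close>-prime edges.

  The squares come from the way in which the arrow \<open>distr k l\<close>, which multiplies out a product of two sums of
  monomials, interacts with the remaining structure: it is natural (\<open>distr_nat\<close>), it carries
  reorderings of the factors to reorderings of the product (\<open>distr_shuffle_left\<close>,
  \<open>distr_shuffle_right\<close>), and it is compatible with sums in either factor (\<open>distr_append\<close>,
  \<open>distr_append_left\<close>), with the braiding (\<open>distr_ze\<close>) and with associativity (\<open>distr_assoc\<close>).
  Permutations of summands are handled by distinct tags attached to the summands, so that index
  arithmetic is confined to the comparison with the distortion category (\<open>represents\<close>).

  All diagrams are chased in an auxiliary category which has the vertices as objects and, as arrows
  from \<open>a\<close> to \<open>b\<close>, the arrows of \<open>C\<close> between the values of \<open>a\<close> and \<open>b\<close>. Its sums and products of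
  objects are formal, which removes nearly all typing conditions from the equations.
\<close>

section \<open>Categories with a total composition\<close>

text \<open>
  Associativity carries no typing condition: in the intended model an ill-typed composite is one fixed
  value that is not an arrow. Diagram chases thereby become rewriting, and only the unit laws ask for types.
\<close>

locale total_category =
  fixes arr :: "'a \<Rightarrow> bool" and src tgt :: "'a \<Rightarrow> 'v" and idn :: "'v \<Rightarrow> 'a"
    and cmp :: "'a \<Rightarrow> 'a \<Rightarrow> 'a" (infixr "\<bullet>" 55)
  assumes arr_idn [simp]: "arr (idn A)" and src_idn [simp]: "src (idn A) = A" and tgt_idn [simp]: "tgt (idn A) = A"
    and arr_cmp [simp]: "arr (g \<bullet> f) \<longleftrightarrow> arr g \<and> arr f \<and> src g = tgt f"
    and src_cmp [simp]: "arr g \<Longrightarrow> arr f \<Longrightarrow> src g = tgt f \<Longrightarrow> src (g \<bullet> f) = src f"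
    and tgt_cmp [simp]: "arr g \<Longrightarrow> arr f \<Longrightarrow> src g = tgt f \<Longrightarrow> tgt (g \<bullet> f) = tgt g"
    and cmp_assoc [simp]: "(h \<bullet> g) \<bullet> f = h \<bullet> (g \<bullet> f)"
    and idn_left [simp]: "arr f \<Longrightarrow> tgt f = A \<Longrightarrow> idn A \<bullet> f = f"
    and idn_right [simp]: "arr f \<Longrightarrow> src f = A \<Longrightarrow> f \<bullet> idn A = f"
begin

lemma cancel_idn: "g \<bullet> f = idn A \<Longrightarrow> arr x \<Longrightarrow> tgt x = A \<Longrightarrow> g \<bullet> (f \<bullet> x) = x"
  by (metis cmp_assoc idn_left)

text \<open>
  Composites are kept associated to the right, so an equation between composites is also needed in
  front of a further arrow \<open>x\<close>.
\<close>

lemma reassoc: "g \<bullet> f = h \<Longrightarrow> g \<bullet> (f \<bullet> x) = h \<bullet> x"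
  by auto

lemma reassoc3: "g \<bullet> f \<bullet> e = h \<Longrightarrow> g \<bullet> (f \<bullet> (e \<bullet> x)) = h \<bullet> x"
  by auto

lemma iso_cancel_left:
  assumes "g \<bullet> f = g \<bullet> f'" "g' \<bullet> g = idn A" "arr f" "arr f'" "tgt f = A" "tgt f' = A"
  shows "f = f'"
  by (metis assms cmp_assoc idn_left)

lemma iso_cancel_right:
  assumes "f \<bullet> g = f' \<bullet> g" "g \<bullet> g' = idn A" "arr f" "arr f'" "src f = A" "src f' = A"
  shows "f = f'"
  by (metis assms cmp_assoc idn_right)

end

text \<open>
  The interchange law \<open>tA_cmp\<close> carries no typing condition either. In the model \<open>A \<diamond> B\<close> determines
  \<open>A\<close> and \<open>B\<close>, so a composable pair of products has composable factors. Primed names are inverses.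
\<close>

locale total_monoidal = total_category arr src tgt idn cmp
  for arr :: "'a \<Rightarrow> bool" and src tgt :: "'a \<Rightarrow> 'v" and idn and cmp (infixr "\<bullet>" 55) +
  fixes tO :: "'v \<Rightarrow> 'v \<Rightarrow> 'v" (infixr "\<diamond>" 65)
    and tA :: "'a \<Rightarrow> 'a \<Rightarrow> 'a" (infixr "\<diamond>\<^sub>a" 65)
    and unit :: 'v
    and al al' :: "'v \<Rightarrow> 'v \<Rightarrow> 'v \<Rightarrow> 'a" and la la' rh rh' :: "'v \<Rightarrow> 'a"
  assumes arr_tA [simp]: "arr (f \<diamond>\<^sub>a g) \<longleftrightarrow> arr f \<and> arr g"
    and src_tA [simp]: "arr f \<Longrightarrow> arr g \<Longrightarrow> src (f \<diamond>\<^sub>a g) = src f \<diamond> src g"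
    and tgt_tA [simp]: "arr f \<Longrightarrow> arr g \<Longrightarrow> tgt (f \<diamond>\<^sub>a g) = tgt f \<diamond> tgt g"
    and tA_idn [simp]: "idn A \<diamond>\<^sub>a idn B = idn (A \<diamond> B)"
    and tA_cmp: "(f' \<diamond>\<^sub>a g') \<bullet> (f \<diamond>\<^sub>a g) = (f' \<bullet> f) \<diamond>\<^sub>a (g' \<bullet> g)"
    and al_arr [simp]: "arr (al A B D)" "src (al A B D) = (A \<diamond> B) \<diamond> D" "tgt (al A B D) = A \<diamond> (B \<diamond> D)"
    and al'_arr [simp]: "arr (al' A B D)" "src (al' A B D) = A \<diamond> (B \<diamond> D)" "tgt (al' A B D) = (A \<diamond> B) \<diamond> D"
    and la_arr [simp]: "arr (la A)" "src (la A) = unit \<diamond> A" "tgt (la A) = A"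
    and la'_arr [simp]: "arr (la' A)" "src (la' A) = A" "tgt (la' A) = unit \<diamond> A"
    and rh_arr [simp]: "arr (rh A)" "src (rh A) = A \<diamond> unit" "tgt (rh A) = A"
    and rh'_arr [simp]: "arr (rh' A)" "src (rh' A) = A" "tgt (rh' A) = A \<diamond> unit"
    and al_inv [simp]: "al A B D \<bullet> al' A B D = idn (A \<diamond> (B \<diamond> D))" "al' A B D \<bullet> al A B D = idn ((A \<diamond> B) \<diamond> D)"
    and la_inv [simp]: "la A \<bullet> la' A = idn A" "la' A \<bullet> la A = idn (unit \<diamond> A)"
    and rh_inv [simp]: "rh A \<bullet> rh' A = idn A" "rh' A \<bullet> rh A = idn (A \<diamond> unit)"
    and al_natural: "al (tgt f) (tgt g) (tgt h) \<bullet> ((f \<diamond>\<^sub>a g) \<diamond>\<^sub>a h)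
      = (f \<diamond>\<^sub>a (g \<diamond>\<^sub>a h)) \<bullet> al (src f) (src g) (src h)"
    and la_natural: "la (tgt f) \<bullet> (idn unit \<diamond>\<^sub>a f) = f \<bullet> la (src f)"
    and rh_natural: "rh (tgt f) \<bullet> (f \<diamond>\<^sub>a idn unit) = f \<bullet> rh (src f)"
    and pentagon: "al A B (D \<diamond> E) \<bullet> al (A \<diamond> B) D E
      = (idn A \<diamond>\<^sub>a al B D E) \<bullet> al A (B \<diamond> D) E \<bullet> (al A B D \<diamond>\<^sub>a idn E)"
    and triangle: "(idn A \<diamond>\<^sub>a la B) \<bullet> al A unit B = rh A \<diamond>\<^sub>a idn B"
begin

lemmas al_cancel [simp] = cancel_idn[OF al_inv(1)] cancel_idn[OF al_inv(2)]
lemmas la_cancel [simp] = cancel_idn[OF la_inv(2)]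
lemmas rh_cancel [simp] = cancel_idn[OF rh_inv(2)]

lemma tA_cmp' : "(f' \<diamond>\<^sub>a g') \<bullet> ((f \<diamond>\<^sub>a g) \<bullet> x) = ((f' \<bullet> f) \<diamond>\<^sub>a (g' \<bullet> g)) \<bullet> x"
  by (rule reassoc[OF tA_cmp])

lemmas tA_merge = tA_cmp tA_cmp'

lemma whisker_left: "idn A \<diamond>\<^sub>a (g \<bullet> f) = (idn A \<diamond>\<^sub>a g) \<bullet> (idn A \<diamond>\<^sub>a f)"
  by (simp add: tA_cmp)
lemma whisker_right: "(g \<bullet> f) \<diamond>\<^sub>a idn A = (g \<diamond>\<^sub>a idn A) \<bullet> (f \<diamond>\<^sub>a idn A)"
  by (simp add: tA_cmp)
lemmas whisker = whisker_left whisker_right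

lemma tensor_split: "arr h \<Longrightarrow> (f \<bullet> g) \<diamond>\<^sub>a h = (f \<diamond>\<^sub>a h) \<bullet> (g \<diamond>\<^sub>a idn (src h))"
  "arr h \<Longrightarrow> h \<diamond>\<^sub>a (f \<bullet> g) = (h \<diamond>\<^sub>a f) \<bullet> (idn (src h) \<diamond>\<^sub>a g)"
  by (simp_all add: tA_merge)

lemma al_nat: "tgt f = A \<Longrightarrow> tgt g = B \<Longrightarrow> tgt h = D \<Longrightarrow> al A B D \<bullet> ((f \<diamond>\<^sub>a g) \<diamond>\<^sub>a h)
      = (f \<diamond>\<^sub>a (g \<diamond>\<^sub>a h)) \<bullet> al (src f) (src g) (src h)"
  using al_natural by blast
lemma al_nat3: "arr h \<Longrightarrow> tgt h = D \<Longrightarrow> al A B D \<bullet> (idn (A \<diamond> B) \<diamond>\<^sub>a h)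
      = (idn A \<diamond>\<^sub>a (idn B \<diamond>\<^sub>a h)) \<bullet> al A B (src h)"
  using al_nat[of "idn A" A "idn B" B h D] by simp
lemmas al_push = al_nat al_nat3 reassoc[OF al_nat] reassoc[OF al_nat3]

lemma al'_nat:
  assumes "arr f" "arr g" "arr h" "tgt f = A" "tgt g = B" "tgt h = D"
  shows "al' A B D \<bullet> (f \<diamond>\<^sub>a (g \<diamond>\<^sub>a h)) = ((f \<diamond>\<^sub>a g) \<diamond>\<^sub>a h) \<bullet> al' (src f) (src g) (src h)"
  by (rule iso_cancel_left[where g="al A B D" and g'="al' A B D"])
    (use assms in \<open>simp_all add: al_push\<close>)
lemmas al'_push = al'_nat reassoc[OF al'_nat]

lemma unit_faithful:
  assumes "idn unit \<diamond>\<^sub>a f = idn unit \<diamond>\<^sub>a g" "arr f" "arr g" "src f = src g" "tgt f = tgt g"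
  shows "f = g"
  using la_natural[of f] la_natural[of g] assms
  by (metis iso_cancel_right la_inv(1))

lemma faithful_unit:
  assumes "f \<diamond>\<^sub>a idn unit = g \<diamond>\<^sub>a idn unit" "arr f" "arr g" "src f = src g" "tgt f = tgt g"
  shows "f = g"
  using rh_natural[of f] rh_natural[of g] assms
  by (metis iso_cancel_right rh_inv(1))

text \<open>
  Kelly's argument: with two units in front, the pentagon and the triangle give the equation up to
  multiplication by the unit, and multiplication by the unit is faithful.
\<close>

lemma la_tensor: "la (A \<diamond> B) \<bullet> al unit A B = la A \<diamond>\<^sub>a idn B"
proof (rule unit_faithful)
  \<comment> \<open>The last two factors of the pentagon, which are invertible and will be cancelled.\<close>
  let ?k = "al unit (unit \<diamond> A) B \<bullet> (al unit unit A \<diamond>\<^sub>a idn B)"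
  let ?k' = "(al' unit unit A \<diamond>\<^sub>a idn B) \<bullet> al' unit (unit \<diamond> A) B"
  have k: "?k \<bullet> ?k' = idn (unit \<diamond> ((unit \<diamond> A) \<diamond> B))"
    by (simp add: tA_merge)
  have "(idn unit \<diamond>\<^sub>a (la (A \<diamond> B) \<bullet> al unit A B)) \<bullet> ?k
      = (idn unit \<diamond>\<^sub>a la (A \<diamond> B)) \<bullet> al unit unit (A \<diamond> B) \<bullet> al (unit \<diamond> unit) A B"
    unfolding pentagon by (simp add: whisker)
  also have "\<dots> = al unit A B \<bullet> ((rh unit \<diamond>\<^sub>a idn A) \<diamond>\<^sub>a idn B)"
    by (simp add: reassoc[OF triangle] al_push)
  also have "\<dots> = (idn unit \<diamond>\<^sub>a (la A \<diamond>\<^sub>a idn B)) \<bullet> ?k"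
    by (simp add: triangle[symmetric] whisker al_push)
  finally show "idn unit \<diamond>\<^sub>a (la (A \<diamond> B) \<bullet> al unit A B) = idn unit \<diamond>\<^sub>a la A \<diamond>\<^sub>a idn B"
    by (rule iso_cancel_right[OF _ k]) simp_all
qed simp_all

lemma rh_tensor: "(idn A \<diamond>\<^sub>a rh B) \<bullet> al A B unit = rh (A \<diamond> B)"
proof (rule faithful_unit)
  have "al A B unit \<bullet> (((idn A \<diamond>\<^sub>a rh B) \<bullet> al A B unit) \<diamond>\<^sub>a idn unit)
     = (idn A \<diamond>\<^sub>a (idn B \<diamond>\<^sub>a la unit)) \<bullet> al A B (unit \<diamond> unit) \<bullet> al (A \<diamond> B) unit unit"
    unfolding pentagon by (simp add: whisker al_push triangle[symmetric])
  also have "\<dots> = al A B unit \<bullet> (rh (A \<diamond> B) \<diamond>\<^sub>a idn unit)"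
    by (simp add: triangle[symmetric] al_push)
  finally show "((idn A \<diamond>\<^sub>a rh B) \<bullet> al A B unit) \<diamond>\<^sub>a idn unit = rh (A \<diamond> B) \<diamond>\<^sub>a idn unit"
    by (rule iso_cancel_left[OF _ al_inv(2)]) simp_all
qed simp_all

lemma la_unit: "la unit = rh unit"
proof (rule faithful_unit)
  have "idn unit \<diamond>\<^sub>a la unit = la (unit \<diamond> unit)"
    using la_natural[of "la unit"] by (simp add: iso_cancel_left[OF _ la_inv(2)])
  then show "la unit \<diamond>\<^sub>a idn unit = rh unit \<diamond>\<^sub>a idn unit"
    using triangle[of unit unit] la_tensor[of unit unit] by simp
qed simp_all

lemma la_nat: "tgt f = A \<Longrightarrow> la A \<bullet> (idn unit \<diamond>\<^sub>a f) = f \<bullet> la (src f)"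
  using la_natural by blast
lemma rh_nat: "tgt f = A \<Longrightarrow> rh A \<bullet> (f \<diamond>\<^sub>a idn unit) = f \<bullet> rh (src f)"
  using rh_natural by blast
lemmas unit_push = la_nat rh_nat reassoc[OF la_nat] reassoc[OF rh_nat]

end

section \<open>Braidings inside a right-nested product\<close>

locale total_braided = total_monoidal arr src tgt idn cmp tO tA unit al al' la la' rh rh'
  for arr :: "'a \<Rightarrow> bool" and src tgt :: "'a \<Rightarrow> 'v" and idn and cmp (infixr "\<bullet>" 55)
    and tO (infixr "\<diamond>" 65) and tA (infixr "\<diamond>\<^sub>a" 65) and unit al al' la la' rh rh' +
  fixes ze ze' :: "'v \<Rightarrow> 'v \<Rightarrow> 'a"
  assumes ze_arr [simp]: "arr (ze A B)" "src (ze A B) = A \<diamond> B" "tgt (ze A B) = B \<diamond> A"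
    and ze'_arr [simp]: "arr (ze' A B)" "src (ze' A B) = B \<diamond> A" "tgt (ze' A B) = A \<diamond> B"
    and ze_inv [simp]: "ze A B \<bullet> ze' A B = idn (B \<diamond> A)" "ze' A B \<bullet> ze A B = idn (A \<diamond> B)"
    and ze_natural: "ze (tgt f) (tgt g) \<bullet> (f \<diamond>\<^sub>a g) = (g \<diamond>\<^sub>a f) \<bullet> ze (src f) (src g)"
    and hexagon1: "al B D A \<bullet> ze A (B \<diamond> D) \<bullet> al A B D
        = (idn B \<diamond>\<^sub>a ze A D) \<bullet> al B A D \<bullet> (ze A B \<diamond>\<^sub>a idn D)"
    and hexagon2: "al' D A B \<bullet> ze (A \<diamond> B) D \<bullet> al' A B D
        = (ze A D \<diamond>\<^sub>a idn B) \<bullet> al' A D B \<bullet> (idn A \<diamond>\<^sub>a ze B D)"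
begin

lemmas ze_cancel [simp] = cancel_idn[OF ze_inv(2)]

lemma ze_nat: "tgt f = A \<Longrightarrow> tgt g = B \<Longrightarrow> ze A B \<bullet> (f \<diamond>\<^sub>a g) = (g \<diamond>\<^sub>a f) \<bullet> ze (src f) (src g)"
  using ze_natural by blast
lemmas ze_push = ze_nat reassoc[OF ze_nat]

text \<open>
  The braiding is mostly used through its effect on the first two factors of a right-nested product. In
  this form the hexagons become statements about passing one factor after another, and the Yang-Baxter
  equation contains no associativity.
\<close>

definition sw where "sw A B Z = al B A Z \<bullet> (ze A B \<diamond>\<^sub>a idn Z) \<bullet> al' A B Z"
definition sw' where "sw' A B Z = al A B Z \<bullet> (ze' A B \<diamond>\<^sub>a idn Z) \<bullet> al' B A Z"

lemma sw_arr [simp]: "arr (sw A B Z)" "src (sw A B Z) = A \<diamond> (B \<diamond> Z)" "tgt (sw A B Z) = B \<diamond> (A \<diamond> Z)"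
  by (simp_all add: sw_def)
lemma sw'_arr [simp]: "arr (sw' A B Z)" "src (sw' A B Z) = B \<diamond> (A \<diamond> Z)" "tgt (sw' A B Z) = A \<diamond> (B \<diamond> Z)"
  by (simp_all add: sw'_def)
lemma sw_inv [simp]: "sw A B Z \<bullet> sw' A B Z = idn (B \<diamond> (A \<diamond> Z))" "sw' A B Z \<bullet> sw A B Z = idn (A \<diamond> (B \<diamond> Z))"
  by (simp_all add: sw_def sw'_def tA_merge)
lemmas sw_cancel [simp] = cancel_idn[OF sw_inv(1)] cancel_idn[OF sw_inv(2)]

lemma sw_nat:
  assumes "arr f" "arr g" "arr h" "tgt f = A" "tgt g = B" "tgt h = D"
  shows "sw A B D \<bullet> (f \<diamond>\<^sub>a (g \<diamond>\<^sub>a h)) = (g \<diamond>\<^sub>a (f \<diamond>\<^sub>a h)) \<bullet> sw (src f) (src g) (src h)"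
  using assms
  by (simp add: sw_def al'_push tA_merge ze_push)
     (simp add: tensor_split al_push)

lemma pentagon': "(al' A B D \<diamond>\<^sub>a idn E) \<bullet> al' A (B \<diamond> D) E \<bullet> (idn A \<diamond>\<^sub>a al' B D E)
  = al' (A \<diamond> B) D E \<bullet> al' A B (D \<diamond> E)" (is "?l = ?r")
proof (rule iso_cancel_left)
  have "(al A B (D \<diamond> E) \<bullet> al (A \<diamond> B) D E) \<bullet> ?l = idn (A \<diamond> (B \<diamond> (D \<diamond> E)))"
    unfolding pentagon by (simp add: tA_merge)
  then show "(al A B (D \<diamond> E) \<bullet> al (A \<diamond> B) D E) \<bullet> ?l = (al A B (D \<diamond> E) \<bullet> al (A \<diamond> B) D E) \<bullet> ?r"
    by simp
  show "?r \<bullet> (al A B (D \<diamond> E) \<bullet> al (A \<diamond> B) D E) = idn (((A \<diamond> B) \<diamond> D) \<diamond> E)" by simp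
qed simp_all

lemma rh_al': "rh (A \<diamond> B) \<bullet> al' A B unit = idn A \<diamond>\<^sub>a rh B"
  by (simp add: rh_tensor[symmetric])

lemma sw_hexagon1: "al B D (A \<diamond> Z) \<bullet> sw A (B \<diamond> D) Z
   = (idn B \<diamond>\<^sub>a sw A D Z) \<bullet> sw A B (D \<diamond> Z) \<bullet> (idn A \<diamond>\<^sub>a al B D Z)"
proof -
  have h: "al B D A \<bullet> ze A (B \<diamond> D)
        = (idn B \<diamond>\<^sub>a ze A D) \<bullet> al B A D \<bullet> (ze A B \<diamond>\<^sub>a idn D) \<bullet> al' A B D"
    by (rule iso_cancel_right[OF _ al_inv(1)[of A B D]]) (simp_all add: hexagon1)
  have p: "al' A B (D \<diamond> Z) \<bullet> (idn A \<diamond>\<^sub>a al B D Z)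
    = al (A \<diamond> B) D Z \<bullet> (al' A B D \<diamond>\<^sub>a idn Z) \<bullet> al' A (B \<diamond> D) Z"
    by (rule iso_cancel_left[where g="al' (A \<diamond> B) D Z" and g'="al (A \<diamond> B) D Z"])
      (simp_all add: reassoc[OF pentagon'[symmetric]] tA_merge)
  have q: "(idn B \<diamond>\<^sub>a al' A D Z) \<bullet> al B A (D \<diamond> Z) \<bullet> al (B \<diamond> A) D Z = al B (A \<diamond> D) Z \<bullet> (al B A D \<diamond>\<^sub>a idn Z)"
    by (simp add: pentagon tA_merge)
  have "al B D (A \<diamond> Z) \<bullet> sw A (B \<diamond> D) Z
    = (idn B \<diamond>\<^sub>a al D A Z) \<bullet> al B (D \<diamond> A) Z \<bullet> ((al B D A \<bullet> ze A (B \<diamond> D)) \<diamond>\<^sub>a idn Z) \<bullet> al' A (B \<diamond> D) Z"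
    by (simp add: sw_def reassoc[OF pentagon] whisker)
  also have "\<dots> = (idn B \<diamond>\<^sub>a (al D A Z \<bullet> (ze A D \<diamond>\<^sub>a idn Z))) \<bullet> al B (A \<diamond> D) Z \<bullet> (al B A D \<diamond>\<^sub>a idn Z)
      \<bullet> ((ze A B \<diamond>\<^sub>a idn D) \<diamond>\<^sub>a idn Z) \<bullet> (al' A B D \<diamond>\<^sub>a idn Z) \<bullet> al' A (B \<diamond> D) Z"
    unfolding h by (simp add: whisker al_push)
  also have "\<dots> = (idn B \<diamond>\<^sub>a sw A D Z) \<bullet> sw A B (D \<diamond> Z) \<bullet> (idn A \<diamond>\<^sub>a al B D Z)"
    unfolding sw_def cmp_assoc p by (simp add: q[symmetric, THEN reassoc] whisker al_push)
  finally show ?thesis .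
qed

lemma sw_hexagon2: "(idn D \<diamond>\<^sub>a al A B Z) \<bullet> sw (A \<diamond> B) D Z
   = sw A D (B \<diamond> Z) \<bullet> (idn A \<diamond>\<^sub>a sw B D Z) \<bullet> al A B (D \<diamond> Z)"
proof -
  have h: "ze (A \<diamond> B) D = al D A B \<bullet> (ze A D \<diamond>\<^sub>a idn B) \<bullet> al' A D B \<bullet> (idn A \<diamond>\<^sub>a ze B D) \<bullet> al A B D"
    using arg_cong[OF hexagon2[of D A B], of "\<lambda>x. al D A B \<bullet> x \<bullet> al A B D"] by simp
  have p: "(idn A \<diamond>\<^sub>a al' B D Z) \<bullet> al A B (D \<diamond> Z) = al A (B \<diamond> D) Z \<bullet> (al A B D \<diamond>\<^sub>a idn Z) \<bullet> al' (A \<diamond> B) D Z"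
    by (rule iso_cancel_right[OF _ al_inv(1)[of "A \<diamond> B" D Z]]) (simp_all add: pentagon tA_merge)
  have q: "al' A D (B \<diamond> Z) \<bullet> (idn A \<diamond>\<^sub>a al D B Z) \<bullet> al A (D \<diamond> B) Z = al (A \<diamond> D) B Z \<bullet> (al' A D B \<diamond>\<^sub>a idn Z)"
    by (rule iso_cancel_right[where g="al A D B \<diamond>\<^sub>a idn Z" and g'="al' A D B \<diamond>\<^sub>a idn Z"])
       (simp_all add: pentagon[symmetric] tA_merge)
  have "(idn D \<diamond>\<^sub>a al A B Z) \<bullet> sw (A \<diamond> B) D Z
    = (idn D \<diamond>\<^sub>a al A B Z) \<bullet> al D (A \<diamond> B) Z \<bullet> (al D A B \<diamond>\<^sub>a idn Z) \<bullet> ((ze A D \<diamond>\<^sub>a idn B) \<diamond>\<^sub>a idn Z) \<bullet> (al' A D B \<diamond>\<^sub>a idn Z)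
      \<bullet> ((idn A \<diamond>\<^sub>a ze B D) \<diamond>\<^sub>a idn Z) \<bullet> (al A B D \<diamond>\<^sub>a idn Z) \<bullet> al' (A \<diamond> B) D Z"
    unfolding sw_def h by (simp add: whisker)
  also have "\<dots> = al D A (B \<diamond> Z) \<bullet> (ze A D \<diamond>\<^sub>a idn (B \<diamond> Z)) \<bullet> al (A \<diamond> D) B Z \<bullet> (al' A D B \<diamond>\<^sub>a idn Z)
      \<bullet> ((idn A \<diamond>\<^sub>a ze B D) \<diamond>\<^sub>a idn Z) \<bullet> (al A B D \<diamond>\<^sub>a idn Z) \<bullet> al' (A \<diamond> B) D Z"
    by (simp add: reassoc3[OF pentagon[symmetric]] al_push)
  also have "\<dots> = sw A D (B \<diamond> Z) \<bullet> (idn A \<diamond>\<^sub>a sw B D Z) \<bullet> al A B (D \<diamond> Z)"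
    unfolding sw_def whisker cmp_assoc p by (simp add: q[symmetric, THEN reassoc] al_push)
  finally show ?thesis .
qed

text \<open>
  The first hexagon with both passed factors equal to the unit, after cancellation of one \<open>sw\<close>, is the
  claim for tails of the form \<open>unit \<diamond> Y\<close>; \<open>la\<close> carries it over to all tails.
\<close>

lemma sw_unit_right: "la (A \<diamond> Z) \<bullet> sw A unit Z = idn A \<diamond>\<^sub>a la Z"
proof -
  have *: "la (A \<diamond> (unit \<diamond> Y)) \<bullet> sw A unit (unit \<diamond> Y) = idn A \<diamond>\<^sub>a la (unit \<diamond> Y)" for Y
  proof -
    have "sw A unit Y \<bullet> (idn A \<diamond>\<^sub>a (la (unit \<diamond> Y) \<bullet> al unit unit Y))
      = la (unit \<diamond> (A \<diamond> Y)) \<bullet> al unit unit (A \<diamond> Y) \<bullet> sw A (unit \<diamond> unit) Y"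
      using sw_nat[of "idn A" "la unit" "idn Y" A unit Y] by (simp add: la_tensor reassoc[OF la_tensor])
    also have "\<dots> = sw A unit Y \<bullet> la (A \<diamond> (unit \<diamond> Y)) \<bullet> sw A unit (unit \<diamond> Y) \<bullet> (idn A \<diamond>\<^sub>a al unit unit Y)"
      by (simp add: sw_hexagon1 unit_push)
    finally have "(idn A \<diamond>\<^sub>a (la (unit \<diamond> Y) \<bullet> al unit unit Y))
       = la (A \<diamond> (unit \<diamond> Y)) \<bullet> sw A unit (unit \<diamond> Y) \<bullet> (idn A \<diamond>\<^sub>a al unit unit Y)"
      by (rule iso_cancel_left[OF _ sw_inv(2)]) simp_all
    then show ?thesis
      by - (rule iso_cancel_right[where g="idn A \<diamond>\<^sub>a al unit unit Y" and g'="idn A \<diamond>\<^sub>a al' unit unit Y"], simp_all add: tA_merge)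
  qed
  have "la (A \<diamond> Z) \<bullet> sw A unit Z \<bullet> (idn A \<diamond>\<^sub>a (idn unit \<diamond>\<^sub>a la Z)) = (idn A \<diamond>\<^sub>a la Z) \<bullet> (idn A \<diamond>\<^sub>a la (unit \<diamond> Z))"
    using *[of Z] by (simp add: sw_nat unit_push)
  also have "\<dots> = (idn A \<diamond>\<^sub>a la Z) \<bullet> (idn A \<diamond>\<^sub>a (idn unit \<diamond>\<^sub>a la Z))"
    by (simp add: tA_merge unit_push)
  finally show ?thesis
    by - (rule iso_cancel_right[where g="idn A \<diamond>\<^sub>a (idn unit \<diamond>\<^sub>a la Z)" and g'="idn A \<diamond>\<^sub>a (idn unit \<diamond>\<^sub>a la' Z)"], simp_all add: tA_merge)
qed

lemma sw_unit_left: "(idn D \<diamond>\<^sub>a la Z) \<bullet> sw unit D Z = la (D \<diamond> Z)"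
proof -
  have *: "(idn D \<diamond>\<^sub>a la (unit \<diamond> Y)) \<bullet> sw unit D (unit \<diamond> Y) = la (D \<diamond> (unit \<diamond> Y))" for Y
  proof -
    have "sw unit D Y \<bullet> la (unit \<diamond> (D \<diamond> Y)) \<bullet> al unit unit (D \<diamond> Y)
      = (idn D \<diamond>\<^sub>a (la unit \<diamond>\<^sub>a idn Y)) \<bullet> sw (unit \<diamond> unit) D Y"
      using sw_nat[of "la unit" "idn D" "idn Y" unit D Y] by (simp add: la_tensor reassoc[OF la_tensor])
    also have "\<dots> = (idn D \<diamond>\<^sub>a la (unit \<diamond> Y)) \<bullet> sw unit D (unit \<diamond> Y) \<bullet> (idn unit \<diamond>\<^sub>a sw unit D Y) \<bullet> al unit unit (D \<diamond> Y)"
      by (simp add: la_tensor[symmetric] whisker sw_hexagon2)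
    finally have "la (D \<diamond> (unit \<diamond> Y)) \<bullet> (idn unit \<diamond>\<^sub>a sw unit D Y) \<bullet> al unit unit (D \<diamond> Y) =
       (idn D \<diamond>\<^sub>a la (unit \<diamond> Y)) \<bullet> sw unit D (unit \<diamond> Y) \<bullet> (idn unit \<diamond>\<^sub>a sw unit D Y) \<bullet> al unit unit (D \<diamond> Y)"
      by (simp add: unit_push)
    then show ?thesis
      by - (rule iso_cancel_right[where g="(idn unit \<diamond>\<^sub>a sw unit D Y) \<bullet> al unit unit (D \<diamond> Y)" and g'="al' unit unit (D \<diamond> Y) \<bullet> (idn unit \<diamond>\<^sub>a sw' unit D Y)"], simp_all add: tA_merge)
  qed
  have "(idn D \<diamond>\<^sub>a la Z) \<bullet> sw unit D Z \<bullet> (idn unit \<diamond>\<^sub>a (idn D \<diamond>\<^sub>a la Z))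
     = (idn D \<diamond>\<^sub>a (la Z \<bullet> (idn unit \<diamond>\<^sub>a la Z))) \<bullet> sw unit D (unit \<diamond> Z)"
    by (simp add: sw_nat whisker)
  also have "\<dots> = (idn D \<diamond>\<^sub>a la Z) \<bullet> la (D \<diamond> (unit \<diamond> Z))"
    by (simp add: unit_push whisker *)
  also have "\<dots> = la (D \<diamond> Z) \<bullet> (idn unit \<diamond>\<^sub>a (idn D \<diamond>\<^sub>a la Z))"
    by (simp add: unit_push)
  finally show ?thesis
    by - (rule iso_cancel_right[where g="idn unit \<diamond>\<^sub>a (idn D \<diamond>\<^sub>a la Z)" and g'="idn unit \<diamond>\<^sub>a (idn D \<diamond>\<^sub>a la' Z)"], simp_all add: tA_merge)
qed

lemma rh_sw: "(idn B \<diamond>\<^sub>a rh A) \<bullet> sw A B unit = ze A B \<bullet> (idn A \<diamond>\<^sub>a rh B)"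
proof -
  have "(idn B \<diamond>\<^sub>a rh A) \<bullet> sw A B unit = rh (B \<diamond> A) \<bullet> (ze A B \<diamond>\<^sub>a idn unit) \<bullet> al' A B unit"
    by (simp add: sw_def reassoc[OF rh_tensor])
  also have "\<dots> = ze A B \<bullet> (idn A \<diamond>\<^sub>a rh B)"
    by (simp add: unit_push rh_al')
  finally show ?thesis .
qed

text \<open>
  Passing \<open>A\<close> across \<open>B \<diamond> D\<close> is natural with respect to the braiding of \<open>B\<close> with \<open>D\<close>, and the first
  hexagon decomposes both occurrences of this passage.
\<close>

lemma yang_baxter: "(idn D \<diamond>\<^sub>a sw A B Z) \<bullet> sw A D (B \<diamond> Z) \<bullet> (idn A \<diamond>\<^sub>a sw B D Z)
    = sw B D (A \<diamond> Z) \<bullet> (idn B \<diamond>\<^sub>a sw A D Z) \<bullet> sw A B (D \<diamond> Z)"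
proof -
  have "((idn D \<diamond>\<^sub>a sw A B Z) \<bullet> sw A D (B \<diamond> Z) \<bullet> (idn A \<diamond>\<^sub>a sw B D Z)) \<bullet> (idn A \<diamond>\<^sub>a al B D Z)
     = al D B (A \<diamond> Z) \<bullet> sw A (D \<diamond> B) Z \<bullet> (idn A \<diamond>\<^sub>a (ze B D \<diamond>\<^sub>a idn Z))"
    by (simp add: reassoc[OF sw_hexagon1] tA_merge) (simp add: sw_def)
  also have "\<dots> = al D B (A \<diamond> Z) \<bullet> (ze B D \<diamond>\<^sub>a idn (A \<diamond> Z)) \<bullet> al' B D (A \<diamond> Z) \<bullet> al B D (A \<diamond> Z) \<bullet> sw A (B \<diamond> D) Z"
    by (simp add: sw_nat)
  also have "\<dots> = (sw B D (A \<diamond> Z) \<bullet> (idn B \<diamond>\<^sub>a sw A D Z) \<bullet> sw A B (D \<diamond> Z)) \<bullet> (idn A \<diamond>\<^sub>a al B D Z)"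
    unfolding sw_hexagon1 by (simp add: sw_def)
  finally show ?thesis
    by - (rule iso_cancel_right[where g="idn A \<diamond>\<^sub>a al B D Z" and g'="idn A \<diamond>\<^sub>a al' B D Z"], simp_all add: tA_merge)
qed

end

section \<open>Actions of braid words on words\<close>

fun swap_at :: "nat \<Rightarrow> 'v list \<Rightarrow> 'v list" where
  "swap_at 0 (a # b # k) = b # a # k"
| "swap_at (Suc i) (a # k) = a # swap_at i k"
| "swap_at _ k = k"

text \<open>
  As in the braid groups, the last letter of a word acts first.
\<close>

primrec word_act :: "(nat \<times> bool) list \<Rightarrow> 'v list \<Rightarrow> 'v list" where
  "word_act [] k = k"
| "word_act (x # w) k = swap_at (fst x) (word_act w k)"

definition shift :: "nat \<Rightarrow> (nat \<times> bool) list \<Rightarrow> (nat \<times> bool) list" where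
  "shift p = map (\<lambda>(i, b). (p + i, b))"

lemma length_swap_at [simp]: "length (swap_at i k) = length k"
  by (induction i k rule: swap_at.induct) auto

lemma length_word_act [simp]: "length (word_act w k) = length k"
  by (induction w) auto

lemma word_act_append: "word_act (v @ w) k = word_act v (word_act w k)"
  by (induction v) auto

lemma swap_at_append: "Suc i < length k \<Longrightarrow> swap_at i (k @ l) = swap_at i k @ l"
  by (induction i k rule: swap_at.induct) auto

lemma swap_at_append2: "swap_at (length k + i) (k @ l) = k @ swap_at i l"
  by (induction k) auto

lemma word_act_shift: "length k = p \<Longrightarrow> word_act (shift p w) (k @ l) = k @ word_act w l"
  by (induction w) (auto simp: shift_def swap_at_append2)

lemma braid_words_Cons: "(x # w) \<in> braid_words n \<longleftrightarrow> Suc (fst x) < n \<and> w \<in> braid_words n"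
  by (cases x) (auto simp: braid_words_def)

lemma braid_words_Nil [simp]: "[] \<in> braid_words n"
  by (auto simp: braid_words_def)

lemma braid_words_append [simp]: "v @ w \<in> braid_words n \<longleftrightarrow> v \<in> braid_words n \<and> w \<in> braid_words n"
  by (auto simp: braid_words_def)

lemma word_act_append2: "w \<in> braid_words (length k) \<Longrightarrow> word_act w (k @ l) = word_act w k @ l"
  by (induction w) (auto simp: braid_words_Cons swap_at_append)

lemma swap_at_cancel: "swap_at i (swap_at i k) = k"
  by (induction i k rule: swap_at.induct) auto

lemma braid_rel_words: "(v, w) \<in> braid_rel n \<Longrightarrow> v \<in> braid_words n \<and> w \<in> braid_words n"
  by (induction rule: braid_rel.induct) (auto simp: braid_words_Cons)

definition block_word :: "nat \<Rightarrow> nat \<Rightarrow> (nat \<times> bool) list" where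
  "block_word p q = concat (map (\<lambda>i. rev (map (\<lambda>k. (k, True)) [i..<i + q])) [0..<p])"

text \<open>
  To pass \<open>p + 1\<close> strings across \<open>q\<close> strings, the last \<open>p\<close> of them pass first, then the first one.
\<close>

lemma block_word_Suc: "block_word (Suc p) q = rev (map (\<lambda>k. (k, True)) [0..<q]) @ shift 1 (block_word p q)"
proof -
  have *: "rev (map (\<lambda>k. (k, True)) [Suc i..<Suc i + q]) = shift 1 (rev (map (\<lambda>k. (k, True)) [i..<i + q]))" for i
    by (simp add: shift_def rev_map map_Suc_upt[symmetric] comp_def del: upt_Suc)
  have "block_word (Suc p) q = rev (map (\<lambda>k. (k, True)) [0..<q])
      @ concat (map (\<lambda>i. rev (map (\<lambda>k. (k, True)) [Suc i..<Suc i + q])) [0..<p])"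
    unfolding block_word_def upt_conv_Cons[OF zero_less_Suc] map_Suc_upt[symmetric] by (simp add: comp_def)
  also have "concat (map (\<lambda>i. rev (map (\<lambda>k. (k, True)) [Suc i..<Suc i + q])) [0..<p]) = shift 1 (block_word p q)"
    unfolding block_word_def * by (simp add: shift_def map_concat comp_def)
  finally show ?thesis .
qed

lemma block_word_words: "block_word p q \<in> braid_words (p + q)"
  by (auto simp: block_word_def braid_words_def)

text \<open>
  The monomials of a product, in the order of the distortion category: the index of the left
  factor varies fastest.
\<close>

primrec word_products :: "'v list list \<Rightarrow> 'v list list \<Rightarrow> 'v list list" where
  "word_products k [] = []"
| "word_products k (w # l) = map (\<lambda>v. v @ w) k @ word_products k l"

text \<open>
  The same order on pairs of tags.
\<close>

definition pairs :: "'t list \<Rightarrow> 'u list \<Rightarrow> ('t \<times> 'u) list" where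
  "pairs ts us = concat (map (\<lambda>u. map (\<lambda>t. (t, u)) ts) us)"

lemma pairs_simps [simp]: "pairs ts [] = []" "pairs ts (u # us) = map (\<lambda>t. (t, u)) ts @ pairs ts us" "pairs [] us = []"
  by (auto simp: pairs_def)
lemma set_pairs [simp]: "set (pairs ts us) = set ts \<times> set us"
  by (auto simp: pairs_def)
lemma mset_pairs_left: "mset ts = mset ts' \<Longrightarrow> mset (pairs ts us) = mset (pairs ts' us)"
  by (induction us) (auto simp: mset_map)
lemma mset_pairs_right: "mset us = mset us' \<Longrightarrow> mset (pairs ts us) = mset (pairs ts us')"
proof -
  have "mset (pairs ts us) = (\<Sum>u\<in>#mset us. mset (map (\<lambda>t. (t, u)) ts))" for us
    by (induction us) auto
  then show "mset us = mset us' \<Longrightarrow> ?thesis" by metis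
qed
lemma word_products_pairs: "word_products (map W ts) (map V us) = map (\<lambda>x. W (fst x) @ V (snd x)) (pairs ts us)"
  by (induction us) auto

abbreviation pair_word where "pair_word W V \<equiv> \<lambda>x. W (fst x) @ V (snd x)"

lemma mset_map_eq: "mset ts = mset us \<Longrightarrow> mset (map f ts) = mset (map f us)"
  by (simp add: mset_map)

lemma mset_pairs_Cons: "mset (pairs (x # ts) us) = mset (pairs [x] us @ pairs ts us)"
  by (induction us) auto

lemma word_products_append: "word_products k (l @ m) = word_products k l @ word_products k m"
  by (induction l) auto
lemma word_products_map_append: "word_products k (map (\<lambda>v. v @ x) l) = map (\<lambda>v. v @ x) (word_products k l)"
  by (induction l) auto
lemma word_products_assoc: "word_products (word_products k l) m = word_products k (word_products l m)"
  by (induction m) (auto simp: word_products_append word_products_map_append)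

lemma word_products_Nil [simp]: "word_products [] l = []"
  by (induction l) auto

lemma map_pairs_single: "map (pair_word W V) (pairs [x] us) = map (\<lambda>w. W x @ w) (map V us)"
  by (induction us) auto

lemma mset_pairs_swap: "mset (pairs ts us) = mset (map prod.swap (pairs us ts))"
proof (induction us)
  case (Cons u us)
  have "mset (map prod.swap (pairs (u # us) ts)) = mset (map prod.swap (pairs [u] ts)) + mset (map prod.swap (pairs us ts))"
    using mset_map_eq[OF mset_pairs_Cons[of u us ts], of prod.swap] by (simp del: pairs_simps)
  moreover have "map prod.swap (pairs [u] ts) = map (\<lambda>t. (t, u)) ts" by (induction ts) auto
  ultimately show ?case using Cons by simp
qed simp

section \<open>Iterated products and braid words\<close>

context total_monoidal
begin

text \<open>
  Iterated products are nested to the right and end in an arbitrary tail \<open>Z\<close>. Concatenation of lists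
  is then composition of the functors \<open>lobj k\<close>, without any associativity.
\<close>

primrec lobj :: "'v list \<Rightarrow> 'v \<Rightarrow> 'v" where
  "lobj [] Z = Z"
| "lobj (A # k) Z = A \<diamond> lobj k Z"

primrec larr :: "'a list \<Rightarrow> 'a \<Rightarrow> 'a" where
  "larr [] g = g"
| "larr (f # fs) g = f \<diamond>\<^sub>a larr fs g"

primrec pack :: "'v list \<Rightarrow> 'v \<Rightarrow> 'a" where
  "pack [] Z = la Z"
| "pack (A # k) Z = (idn A \<diamond>\<^sub>a pack k Z) \<bullet> al A (lobj k unit) Z"

lemma lobj_append [simp]: "lobj (k @ l) Z = lobj k (lobj l Z)"
  by (induction k) auto

lemma larr_append [simp]: "larr (fs @ gs) h = larr fs (larr gs h)"
  by (induction fs) auto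

lemma larr_arr [simp]: "arr (larr fs g) \<longleftrightarrow> (\<forall>f \<in> set fs. arr f) \<and> arr g"
  by (induction fs) auto

lemma larr_src [simp]: "(\<forall>f \<in> set fs. arr f) \<Longrightarrow> arr g \<Longrightarrow> src (larr fs g) = lobj (map src fs) (src g)"
  by (induction fs) auto

lemma larr_tgt [simp]: "(\<forall>f \<in> set fs. arr f) \<Longrightarrow> arr g \<Longrightarrow> tgt (larr fs g) = lobj (map tgt fs) (tgt g)"
  by (induction fs) auto

lemma map_src_idn [simp]: "map (src \<circ> idn) k = k" "map (tgt \<circ> idn) k = k"
  by (induction k) auto

lemma larr_idn' [simp]: "larr (map (\<lambda>x. idn (A x)) ts) (idn Z) = idn (lobj (map A ts) Z)"
  by (induction ts) auto

abbreviation tail :: "'v list \<Rightarrow> 'a \<Rightarrow> 'a" where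
  "tail k f \<equiv> larr (map idn k) f"

lemma larr_cmp: "larr (map G ts) g \<bullet> larr (map F ts) f = larr (map (\<lambda>t. G t \<bullet> F t) ts) (g \<bullet> f)"
  by (induction ts) (auto simp: tA_merge)

lemma tail_cmp: "tail k (g \<bullet> f) = tail k g \<bullet> tail k f"
  by (induction k) (auto simp: tA_merge)

lemma pack_arr [simp]: "arr (pack k Z)" "src (pack k Z) = lobj k unit \<diamond> Z" "tgt (pack k Z) = lobj k Z"
proof -
  have "arr (pack k Z) \<and> src (pack k Z) = lobj k unit \<diamond> Z \<and> tgt (pack k Z) = lobj k Z"
    by (induction k) auto
  then show "arr (pack k Z)" "src (pack k Z) = lobj k unit \<diamond> Z" "tgt (pack k Z) = lobj k Z" by auto
qed

lemma pack_natural: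
  assumes "arr g" "\<forall>f \<in> set fs. arr f"
  shows "pack (map tgt fs) (tgt g) \<bullet> (larr fs (idn unit) \<diamond>\<^sub>a g) = larr fs g \<bullet> pack (map src fs) (src g)"
  using assms(2)
proof (induction fs)
  case Nil
  then show ?case by (simp add: la_nat)
next
  case (Cons f fs)
  have "pack (map tgt (f # fs)) (tgt g) \<bullet> (larr (f # fs) (idn unit) \<diamond>\<^sub>a g)
     = (f \<diamond>\<^sub>a (pack (map tgt fs) (tgt g) \<bullet> (larr fs (idn unit) \<diamond>\<^sub>a g))) \<bullet> al (src f) (lobj (map src fs) unit) (src g)"
    using Cons.prems assms(1) by (simp add: al_push tA_merge)
  also have "\<dots> = larr (f # fs) g \<bullet> pack (map src (f # fs)) (src g)"
    using Cons by (simp add: Cons.IH tA_merge)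
  finally show ?case .
qed

lemma pack_tail: "arr g \<Longrightarrow> tgt g = Z \<Longrightarrow> pack k Z \<bullet> (idn (lobj k unit) \<diamond>\<^sub>a g) = tail k g \<bullet> pack k (src g)"
  using pack_natural[of g "map idn k"] by simp
lemmas pack_push = pack_tail reassoc[OF pack_tail]

text \<open>
  The coherence of associativities that is needed below; the inductive step is one pentagon.
\<close>

lemma pack_append: "pack (k @ l) Z \<bullet> (pack k (lobj l unit) \<diamond>\<^sub>a idn Z)
   = tail k (pack l Z) \<bullet> pack k (lobj l unit \<diamond> Z) \<bullet> al (lobj k unit) (lobj l unit) Z"
proof (induction k)
  case Nil
  then show ?case by (simp add: la_tensor[symmetric] unit_push)
next
  case (Cons A k)
  let ?K = "lobj k unit" and ?L = "lobj l unit"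
  have "pack ((A # k) @ l) Z \<bullet> (pack (A # k) ?L \<diamond>\<^sub>a idn Z)
     = (idn A \<diamond>\<^sub>a (pack (k @ l) Z \<bullet> (pack k ?L \<diamond>\<^sub>a idn Z))) \<bullet> al A (?K \<diamond> ?L) Z \<bullet> (al A ?K ?L \<diamond>\<^sub>a idn Z)"
    by (simp add: whisker al_push)
  also have "\<dots> = (idn A \<diamond>\<^sub>a tail k (pack l Z)) \<bullet> (idn A \<diamond>\<^sub>a pack k (?L \<diamond> Z)) \<bullet> al A ?K (?L \<diamond> Z) \<bullet> al (A \<diamond> ?K) ?L Z"
    unfolding pentagon Cons.IH by (simp add: whisker)
  finally show ?case by (simp add: whisker)
qed

lemma pack_unit: "pack k unit = rh (lobj k unit)"
  by (induction k) (simp_all add: la_unit rh_tensor)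

lemma pack_assoc: "pack (k @ l) Z \<bullet> (pack k (lobj l unit) \<diamond>\<^sub>a idn Z)
   = pack k (lobj l Z) \<bullet> (idn (lobj k unit) \<diamond>\<^sub>a pack l Z) \<bullet> al (lobj k unit) (lobj l unit) Z"
  by (simp add: pack_append pack_push)

end

context total_braided
begin

lemma pent_al': "al' A B (D \<diamond> Z) \<bullet> (idn A \<diamond>\<^sub>a al B D Z)
    = al (A \<diamond> B) D Z \<bullet> (al' A B D \<diamond>\<^sub>a idn Z) \<bullet> al' A (B \<diamond> D) Z"
  by (rule iso_cancel_left[where g="al' (A \<diamond> B) D Z" and g'="al (A \<diamond> B) D Z"])
     (simp_all add: reassoc[OF pentagon'[symmetric]] tA_merge)

lemma sw_tail: "sw A B (K \<diamond> Z) \<bullet> (idn A \<diamond>\<^sub>a al B K Z) \<bullet> al A (B \<diamond> K) Z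
   = (idn B \<diamond>\<^sub>a al A K Z) \<bullet> al B (A \<diamond> K) Z \<bullet> (sw A B K \<diamond>\<^sub>a idn Z)"
proof -
  have "sw A B (K \<diamond> Z) \<bullet> (idn A \<diamond>\<^sub>a al B K Z) \<bullet> al A (B \<diamond> K) Z
     = al B A (K \<diamond> Z) \<bullet> al (B \<diamond> A) K Z \<bullet> ((ze A B \<diamond>\<^sub>a idn K) \<diamond>\<^sub>a idn Z) \<bullet> (al' A B K \<diamond>\<^sub>a idn Z)"
    by (simp add: sw_def reassoc[OF pent_al'] al_push)
  then show ?thesis
    by (simp add: reassoc[OF pentagon] sw_def whisker)
qed

lemma sw'_tail: "sw' A B (K \<diamond> Z) \<bullet> (idn B \<diamond>\<^sub>a al A K Z) \<bullet> al B (A \<diamond> K) Z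
   = (idn A \<diamond>\<^sub>a al B K Z) \<bullet> al A (B \<diamond> K) Z \<bullet> (sw' A B K \<diamond>\<^sub>a idn Z)"
  by (rule iso_cancel_left[where g="sw A B (K \<diamond> Z)" and g'="sw' A B (K \<diamond> Z)"])
    (simp_all add: reassoc3[OF sw_tail] tA_merge)

lemma sw'_nat:
  assumes "arr f" "arr g" "arr h" "tgt f = A" "tgt g = B" "tgt h = D"
  shows "sw' A B D \<bullet> (g \<diamond>\<^sub>a (f \<diamond>\<^sub>a h)) = (f \<diamond>\<^sub>a (g \<diamond>\<^sub>a h)) \<bullet> sw' (src f) (src g) (src h)"
  by (rule iso_cancel_left[where g="sw A B D" and g'="sw' A B D"])
    (use assms in \<open>simp_all add: reassoc[OF sw_nat]\<close>)

primrec pass :: "'v \<Rightarrow> 'v list \<Rightarrow> 'v \<Rightarrow> 'a" where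
  "pass A [] Z = idn (A \<diamond> Z)"
| "pass A (B # k) Z = (idn B \<diamond>\<^sub>a pass A k Z) \<bullet> sw A B (lobj k Z)"

lemma pass_arr [simp]: "arr (pass A k Z)" "src (pass A k Z) = A \<diamond> lobj k Z" "tgt (pass A k Z) = lobj k (A \<diamond> Z)"
proof -
  have "arr (pass A k Z) \<and> src (pass A k Z) = A \<diamond> lobj k Z \<and> tgt (pass A k Z) = lobj k (A \<diamond> Z)"
    by (induction k) auto
  then show "arr (pass A k Z)" "src (pass A k Z) = A \<diamond> lobj k Z" "tgt (pass A k Z) = lobj k (A \<diamond> Z)" by auto
qed

lemma pass_nat: "arr f \<Longrightarrow> tgt f = Z \<Longrightarrow> pass A k Z \<bullet> (idn A \<diamond>\<^sub>a tail k f) = tail k (idn A \<diamond>\<^sub>a f) \<bullet> pass A k (src f)"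
proof (induction k)
  case (Cons B k)
  have "pass A (B # k) Z \<bullet> (idn A \<diamond>\<^sub>a tail (B # k) f)
    = (idn B \<diamond>\<^sub>a (pass A k Z \<bullet> (idn A \<diamond>\<^sub>a tail k f))) \<bullet> sw A B (lobj k (src f))"
    using Cons.prems by (simp add: sw_nat tA_merge)
  then show ?case using Cons by (simp add: whisker)
qed simp

text \<open>
  Passing \<open>A\<close> across the factors of a list one by one is passing it across their product, by
  the first hexagon.
\<close>

lemma pass_pack: "pass A k Z \<bullet> (idn A \<diamond>\<^sub>a pack k Z) = pack k (A \<diamond> Z) \<bullet> sw A (lobj k unit) Z"
proof (induction k)
  case Nil
  then show ?case by (simp add: sw_unit_right)
next
  case (Cons B k)
  have "pass A (B # k) Z \<bullet> (idn A \<diamond>\<^sub>a pack (B # k) Z)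
     = (idn B \<diamond>\<^sub>a (pass A k Z \<bullet> (idn A \<diamond>\<^sub>a pack k Z))) \<bullet> sw A B (lobj k unit \<diamond> Z) \<bullet> (idn A \<diamond>\<^sub>a al B (lobj k unit) Z)"
    by (simp add: whisker reassoc[OF sw_nat])
  then show ?case
    unfolding Cons.IH by (simp add: whisker sw_hexagon1)
qed

primrec block_pass :: "'v list \<Rightarrow> 'v list \<Rightarrow> 'v \<Rightarrow> 'a" where
  "block_pass [] l Z = idn (lobj l Z)"
| "block_pass (A # k) l Z = pass A l (lobj k Z) \<bullet> (idn A \<diamond>\<^sub>a block_pass k l Z)"

lemma block_pass_arr [simp]: "arr (block_pass k l Z)" "src (block_pass k l Z) = lobj k (lobj l Z)" "tgt (block_pass k l Z) = lobj l (lobj k Z)"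
proof -
  have "arr (block_pass k l Z) \<and> src (block_pass k l Z) = lobj k (lobj l Z) \<and> tgt (block_pass k l Z) = lobj l (lobj k Z)"
    by (induction k) auto
  then show "arr (block_pass k l Z)" "src (block_pass k l Z) = lobj k (lobj l Z)" "tgt (block_pass k l Z) = lobj l (lobj k Z)" by auto
qed

text \<open>
  Induction on the block that moves: the second hexagon splits off its first factor, for which
  \<open>pass_pack\<close> applies.
\<close>

lemma block_pass_pack: "block_pass k l Z \<bullet> tail k (pack l Z) \<bullet> pack k (lobj l unit \<diamond> Z)
   = tail l (pack k Z) \<bullet> pack l (lobj k unit \<diamond> Z) \<bullet> sw (lobj k unit) (lobj l unit) Z"
proof (induction k)
  case Nil
  then show ?case
    using reassoc[OF pack_tail[of "la Z" Z l, symmetric]] by (simp add: sw_unit_left pack_tail[symmetric])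
next
  case (Cons A k)
  let ?K = "lobj k unit" and ?L = "lobj l unit"
  have "block_pass (A # k) l Z \<bullet> tail (A # k) (pack l Z) \<bullet> pack (A # k) (?L \<diamond> Z)
    = pass A l (lobj k Z) \<bullet> (idn A \<diamond>\<^sub>a (block_pass k l Z \<bullet> tail k (pack l Z) \<bullet> pack k (?L \<diamond> Z))) \<bullet> al A ?K (?L \<diamond> Z)"
    by (simp add: whisker)
  also have "\<dots> = tail l (idn A \<diamond>\<^sub>a pack k Z) \<bullet> (pass A l (?K \<diamond> Z) \<bullet> (idn A \<diamond>\<^sub>a pack l (?K \<diamond> Z))) \<bullet> (idn A \<diamond>\<^sub>a sw ?K ?L Z) \<bullet> al A ?K (?L \<diamond> Z)"
    unfolding Cons.IH by (simp add: whisker reassoc[OF pass_nat])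
  also have "\<dots> = tail l (idn A \<diamond>\<^sub>a pack k Z) \<bullet> pack l (A \<diamond> (?K \<diamond> Z)) \<bullet> (idn ?L \<diamond>\<^sub>a al A ?K Z) \<bullet> sw (A \<diamond> ?K) ?L Z"
    unfolding pass_pack by (simp add: sw_hexagon2)
  finally show ?case
    by (simp add: pack_push tail_cmp)
qed

text \<open>
  With the unit as tail, the right unit arrow turns \<open>sw\<close> into the braiding itself.
\<close>

lemma block_pass_ze: "block_pass k l unit \<bullet> pack k (lobj l unit) = pack l (lobj k unit) \<bullet> ze (lobj k unit) (lobj l unit)"
proof (rule iso_cancel_right[where g = "idn (lobj k unit) \<diamond>\<^sub>a rh (lobj l unit)" and g' = "idn (lobj k unit) \<diamond>\<^sub>a rh' (lobj l unit)"])
  show "(block_pass k l unit \<bullet> pack k (lobj l unit)) \<bullet> (idn (lobj k unit) \<diamond>\<^sub>a rh (lobj l unit))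
      = (pack l (lobj k unit) \<bullet> ze (lobj k unit) (lobj l unit)) \<bullet> (idn (lobj k unit) \<diamond>\<^sub>a rh (lobj l unit))"
    using block_pass_pack[of k l unit] by (simp add: rh_sw[symmetric] pack_push pack_unit)
qed (simp_all add: tA_merge)

text \<open>
  The sign of a letter selects the braiding or its inverse. A position outside the list gives an identity,
  in agreement with \<open>swap_at\<close>, so that sources and targets need no side conditions.
\<close>

fun letter :: "nat \<Rightarrow> bool \<Rightarrow> 'v list \<Rightarrow> 'v \<Rightarrow> 'a" where
  "letter 0 b (A # B # k) Z = (if b then sw A B (lobj k Z) else sw' B A (lobj k Z))"
| "letter (Suc i) b (A # k) Z = idn A \<diamond>\<^sub>a letter i b k Z"
| "letter _ _ k Z = idn (lobj k Z)"

primrec braid :: "(nat \<times> bool) list \<Rightarrow> 'v list \<Rightarrow> 'v \<Rightarrow> 'a" where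
  "braid [] k Z = idn (lobj k Z)"
| "braid (x # w) k Z = letter (fst x) (snd x) (word_act w k) Z \<bullet> braid w k Z"

lemma letter_arr [simp]: "arr (letter i b k Z)" "src (letter i b k Z) = lobj k Z" "tgt (letter i b k Z) = lobj (swap_at i k) Z"
proof -
  have "arr (letter i b k Z) \<and> src (letter i b k Z) = lobj k Z \<and> tgt (letter i b k Z) = lobj (swap_at i k) Z"
    by (induction i b k Z rule: letter.induct) auto
  then show "arr (letter i b k Z)" "src (letter i b k Z) = lobj k Z" "tgt (letter i b k Z) = lobj (swap_at i k) Z" by auto
qed

lemma braid_arr [simp]: "arr (braid w k Z)" "src (braid w k Z) = lobj k Z" "tgt (braid w k Z) = lobj (word_act w k) Z"
proof -
  have "arr (braid w k Z) \<and> src (braid w k Z) = lobj k Z \<and> tgt (braid w k Z) = lobj (word_act w k) Z"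
    by (induction w) auto
  then show "arr (braid w k Z)" "src (braid w k Z) = lobj k Z" "tgt (braid w k Z) = lobj (word_act w k) Z" by auto
qed

lemma braid_append: "braid (v @ w) k Z = braid v (word_act w k) Z \<bullet> braid w k Z"
  by (induction v) (auto simp: word_act_append)

lemma letter_pack: "letter i b k Z \<bullet> pack k Z = pack (swap_at i k) Z \<bullet> (letter i b k unit \<diamond>\<^sub>a idn Z)"
proof (induction i b k Z rule: letter.induct)
  case (1 b A B k Z)
  then show ?case
    by (simp add: whisker reassoc[OF sw_nat] reassoc[OF sw'_nat] sw_tail sw'_tail)
next
  case (2 i b A k Z)
  have "letter (Suc i) b (A # k) Z \<bullet> pack (A # k) Z = (idn A \<diamond>\<^sub>a (letter i b k Z \<bullet> pack k Z)) \<bullet> al A (lobj k unit) Z"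
    by (simp add: whisker)
  then show ?case unfolding 2 by (simp add: whisker al_push)
qed (simp_all)

lemma braid_pack: "braid w k Z \<bullet> pack k Z = pack (word_act w k) Z \<bullet> (braid w k unit \<diamond>\<^sub>a idn Z)"
  by (induction w) (auto simp: reassoc[OF letter_pack] whisker)

lemma letter_append: "Suc i < length k \<Longrightarrow> letter i b (k @ l) Z = letter i b k (lobj l Z)"
  by (induction i b k Z rule: letter.induct) auto

lemma letter_append2: "letter (length k + i) b (k @ l) Z = tail k (letter i b l Z)"
  by (induction k) auto

lemma braid_append2: "w \<in> braid_words (length k) \<Longrightarrow> braid w (k @ l) Z = braid w k (lobj l Z)"
  by (induction w) (auto simp: braid_words_Cons word_act_append2 letter_append)

lemma braid_shift: "length k = p \<Longrightarrow> braid (shift p w) (k @ l) Z = tail k (braid w l Z)"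
proof (induction w)
  case (Cons x w)
  have "braid (shift p (x # w)) (k @ l) Z = letter (length k + fst x) (snd x) (k @ word_act w l) Z \<bullet> braid (shift p w) (k @ l) Z"
    using Cons.prems word_act_shift[of k p w l] by (cases x) (auto simp: shift_def)
  then show ?case using Cons letter_append2[of k _ _ "word_act w l" Z] by (simp add: tail_cmp)
qed (simp add: shift_def)

lemma braid_juxt_pack:
  assumes "v \<in> braid_words (length k)"
  shows "braid (v @ shift (length k) w) (k @ l) unit \<bullet> pack k (lobj l unit)
     = pack (word_act v k) (lobj (word_act w l) unit) \<bullet> (braid v k unit \<diamond>\<^sub>a braid w l unit)"
  using assms pack_tail[of "braid w l unit" "lobj (word_act w l) unit" k, symmetric]
  by (simp add: braid_append word_act_shift braid_shift braid_append2 reassoc[OF braid_pack] tA_merge)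

lemma letter_cancel: "Suc i < length k \<Longrightarrow> letter i b (swap_at i k) Z \<bullet> letter i (\<not> b) k Z = idn (lobj k Z)"
  by (induction i b k Z rule: letter.induct) (auto simp: tA_merge)

lemma letter_far: "Suc i < j \<Longrightarrow> Suc j < length k \<Longrightarrow> swap_at i (swap_at j k) = swap_at j (swap_at i k) \<and>
    letter i True (swap_at j k) Z \<bullet> letter j True k Z = letter j True (swap_at i k) Z \<bullet> letter i True k Z"
proof (induction i arbitrary: j k)
  case 0
  then obtain j' where "j = Suc (Suc j')" by (metis less_iff_Suc_add add_Suc_right add_Suc)
  moreover obtain A B k' where "k = A # B # k'" using 0 by (metis Suc_lessE length_Suc_conv Suc_length_conv length_greater_0_conv less_Suc_eq_0_disj list.exhaust_sel not_less_zero)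
  ultimately show ?case by (simp add: sw_nat)
next
  case (Suc i)
  then obtain j' A k' where "j = Suc j'" "k = A # k'" by (cases j; cases k) auto
  then show ?case using Suc.IH[of j' k'] Suc.prems by (auto simp: tA_merge)
qed

lemma letter_braid: "Suc (Suc i) < length k \<Longrightarrow>
    swap_at i (swap_at (Suc i) (swap_at i k)) = swap_at (Suc i) (swap_at i (swap_at (Suc i) k)) \<and>
    letter i True (swap_at (Suc i) (swap_at i k)) Z \<bullet> letter (Suc i) True (swap_at i k) Z \<bullet> letter i True k Z
    = letter (Suc i) True (swap_at i (swap_at (Suc i) k)) Z \<bullet> letter i True (swap_at (Suc i) k) Z \<bullet> letter (Suc i) True k Z"
proof (induction i arbitrary: k)
  case 0
  then obtain A k1 where "k = A # k1" by (cases k) auto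
  moreover then obtain B k2 where "k1 = B # k2" using 0 by (cases k1) auto
  moreover then obtain D k3 where "k2 = D # k3" using 0 calculation by (cases k2) auto
  ultimately show ?case by (simp add: yang_baxter)
next
  case (Suc i)
  then obtain A k1 where "k = A # k1" by (cases k) auto
  then show ?case using Suc.IH[of k1] Suc.prems by (simp add: tA_merge)
qed

text \<open>
  Only the defining relations have to be checked: cancellation of inverse letters, commutation of distant letters,
  which is naturality of \<open>sw\<close>, and the braid relation, which is the Yang-Baxter equation.
\<close>

lemma braid_respects: "(v, w) \<in> braid_rel n \<Longrightarrow> length k = n \<Longrightarrow>
    word_act v k = word_act w k \<and> braid v k Z = braid w k Z"
proof (induction arbitrary: k rule: braid_rel.induct)
  case (cong v w x y)
  then show ?case by (simp add: word_act_append braid_append)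
next
  case (cancel i b)
  then show ?case by (simp add: swap_at_cancel letter_cancel)
next
  case (far i j)
  then show ?case using letter_far[of i j k Z] by simp
next
  case (braid i)
  then show ?case using letter_braid[of i k Z] by simp
qed auto

lemma braid_pass: "word_act (rev (map (\<lambda>k. (k, True)) [0..<length l])) (A # l @ k) = l @ A # k \<and>
   braid (rev (map (\<lambda>k. (k, True)) [0..<length l])) (A # l @ k) Z = pass A l (lobj k Z)"
proof (induction l)
  case (Cons B l)
  have *: "rev (map (\<lambda>k. (k, True)) [0..<length (B # l)]) = shift (length [B]) (rev (map (\<lambda>k. (k, True)) [0..<length l])) @ [(0, True)]"
    by (simp add: shift_def rev_map map_Suc_upt[symmetric] upt_conv_Cons comp_def del: upt_Suc)
  show ?case
    using Cons.IH word_act_shift[of "[B]" "length [B]" _ "A # l @ k"] braid_shift[of "[B]" "length [B]" _ "A # l @ k"]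
    unfolding * word_act_append braid_append by simp
qed simp

lemma braid_block: "word_act (block_word (length k) (length l)) (k @ l) = l @ k \<and>
   braid (block_word (length k) (length l)) (k @ l) Z = block_pass k l Z"
proof (induction k)
  case Nil
  then show ?case by (simp add: block_word_def)
next
  case (Cons A k)
  show ?case
    using Cons.IH braid_pass[of l A k Z] word_act_shift[of "[A]" 1 "block_word (length k) (length l)" "k @ l"]
      braid_shift[of "[A]" 1 "block_word (length k) (length l)" "k @ l"]
    by (simp add: block_word_Suc word_act_append braid_append)
qed

end

section \<open>Coherence of permuted sums\<close>

text \<open>
  Any two orderings are connected by transpositions of adjacent entries. Equal adjacent entries may be left out, since
  exchanging them changes nothing.
\<close>

lemma mset_eq_induct [consumes 1, case_names Nil Cons swap trans]:
  assumes "mset ts = mset us"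
    and Nil: "P [] []"
    and Cons: "\<And>x ts us. mset ts = mset us \<Longrightarrow> P ts us \<Longrightarrow> P (x # ts) (x # us)"
    and swap: "\<And>x y ts. x \<noteq> y \<Longrightarrow> P (x # y # ts) (y # x # ts)"
    and trans: "\<And>ts us vs. mset ts = mset us \<Longrightarrow> mset us = mset vs \<Longrightarrow> P ts us \<Longrightarrow> P us vs \<Longrightarrow> P ts vs"
  shows "P ts us"
  using assms(1)
proof (induction ts arbitrary: us)
  case Nil
  then show ?case using assms(2) by simp
next
  case (Cons x ts)
  have refl: "P k k" for k by (induction k) (auto intro: assms)
  have pass: "P (x # as @ bs) (as @ x # bs)" for as bs
  proof (induction as)
    case (Cons a as)
    have "P (x # a # as @ bs) (a # x # as @ bs)"
      using swap[of x a "as @ bs"] refl by (cases "x = a") auto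
    moreover have "P (a # x # as @ bs) (a # as @ x # bs)"
      by (rule assms(3)) (use Cons in auto)
    ultimately show ?case using trans[of "x # a # as @ bs" "a # x # as @ bs" "a # as @ x # bs"] by simp
  qed (simp add: refl)
  from Cons.prems have "x \<in> set us" by (metis list.set_intros(1) set_mset_mset)
  then obtain as bs where us: "us = as @ x # bs" by (meson split_list)
  then have "mset ts = mset (as @ bs)" using Cons.prems by simp
  then have "P (x # ts) (x # as @ bs)" using Cons.IH assms(3) by blast
  then show ?case using pass[of as bs] us Cons.prems trans[of "x # ts" "x # as @ bs" us] by auto
qed

locale total_symmetric = total_braided arr src tgt idn cmp tO tA unit al al' la la' rh rh' ze ze'
  for arr :: "'a \<Rightarrow> bool" and src tgt :: "'a \<Rightarrow> 'v" and idn and cmp (infixr "\<bullet>" 55)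
    and tO (infixr "\<diamond>" 65) and tA (infixr "\<diamond>\<^sub>a" 65) and unit al al' la la' rh rh' ze ze' +
  assumes symmetry: "ze B A \<bullet> ze A B = idn (A \<diamond> B)"
begin

lemma sw_sw [simp]: "sw B A Z \<bullet> sw A B Z = idn (A \<diamond> (B \<diamond> Z))"
  by (simp add: sw_def tA_merge symmetry)
lemmas sw_sw' [simp] = cancel_idn[OF sw_sw]

text \<open>
  The canonical arrow between two orderings of the summands \<open>A t\<close> pulls summands to the front,
  in the order in which the target lists their tags. Tags tell equal summands apart.
\<close>

primrec pull :: "('t \<Rightarrow> 'v) \<Rightarrow> 't list \<Rightarrow> 't \<Rightarrow> 'v \<Rightarrow> 'a" where
  "pull A [] y Z = idn Z"
| "pull A (x # ts) y Z = (if x = y then idn (lobj (map A (x # ts)) Z)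
     else sw (A x) (A y) (lobj (map A (remove1 y ts)) Z) \<bullet> (idn (A x) \<diamond>\<^sub>a pull A ts y Z))"

primrec perm :: "('t \<Rightarrow> 'v) \<Rightarrow> 't list \<Rightarrow> 't list \<Rightarrow> 'v \<Rightarrow> 'a" where
  "perm A ts [] Z = idn (lobj (map A ts) Z)"
| "perm A ts (y # us) Z = (idn (A y) \<diamond>\<^sub>a perm A (remove1 y ts) us Z) \<bullet> pull A ts y Z"

lemma pull_arr [simp]:
  assumes "y \<in> set ts"
  shows "arr (pull A ts y Z)" "src (pull A ts y Z) = lobj (map A ts) Z"
    "tgt (pull A ts y Z) = A y \<diamond> lobj (map A (remove1 y ts)) Z"
proof -
  have "arr (pull A ts y Z) \<and> src (pull A ts y Z) = lobj (map A ts) Z \<and>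
    tgt (pull A ts y Z) = A y \<diamond> lobj (map A (remove1 y ts)) Z"
    using assms by (induction ts) auto
  then show "arr (pull A ts y Z)" "src (pull A ts y Z) = lobj (map A ts) Z"
    "tgt (pull A ts y Z) = A y \<diamond> lobj (map A (remove1 y ts)) Z" by auto
qed

lemma mset_eq_Cons: "mset ts = mset (y # us) \<longleftrightarrow> y \<in> set ts \<and> mset (remove1 y ts) = mset us"
  by (metis add_mset_remove_trivial insert_DiffM mset.simps(2) mset_remove1 set_mset_mset union_single_eq_member)

lemma perm_arr [simp]:
  assumes "mset ts = mset us"
  shows "arr (perm A ts us Z)" "src (perm A ts us Z) = lobj (map A ts) Z"
    "tgt (perm A ts us Z) = lobj (map A us) Z"
proof -
  have "arr (perm A ts us Z) \<and> src (perm A ts us Z) = lobj (map A ts) Z \<and>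
    tgt (perm A ts us Z) = lobj (map A us) Z"
    using assms by (induction us arbitrary: ts) (auto simp: mset_eq_Cons simp del: mset.simps(2))
  then show "arr (perm A ts us Z)" "src (perm A ts us Z) = lobj (map A ts) Z"
    "tgt (perm A ts us Z) = lobj (map A us) Z" by auto
qed

text \<open>
  Two summands may be pulled to the front in either order, up to their exchange. If both of them lie behind the
  head of the list, this is the Yang-Baxter equation and the induction hypothesis.
\<close>

lemma pull_pull:
  assumes "y \<noteq> z" "y \<in> set ts" "z \<in> set ts"
  shows "sw (A y) (A z) (lobj (map A (remove1 z (remove1 y ts))) Z)
      \<bullet> (idn (A y) \<diamond>\<^sub>a pull A (remove1 y ts) z Z) \<bullet> pull A ts y Z
    = (idn (A z) \<diamond>\<^sub>a pull A (remove1 z ts) y Z) \<bullet> pull A ts z Z"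
  using assms(2,3)
proof (induction ts)
  case (Cons x ts)
  show ?case
  proof (cases "x = y \<or> x = z")
    case True
    then show ?thesis using Cons.prems assms(1) by (auto simp: whisker)
  next
    case False
    then have m: "x \<noteq> y" "x \<noteq> z" "y \<noteq> x" "z \<noteq> x" "y \<in> set ts" "z \<in> set ts" "z \<in> set (remove1 y ts)" "y \<in> set (remove1 z ts)"
      using Cons.prems assms(1) by (auto simp: in_set_remove1)
    let ?X = "A x" and ?Y = "A y" and ?Z = "A z" and ?R = "lobj (map A (remove1 z (remove1 y ts))) Z"
    have r: "remove1 y (remove1 z ts) = remove1 z (remove1 y ts)" by (rule remove1_commute)
    have "sw ?Y ?Z (lobj (map A (remove1 z (remove1 y (x # ts)))) Z)
        \<bullet> (idn ?Y \<diamond>\<^sub>a pull A (remove1 y (x # ts)) z Z) \<bullet> pull A (x # ts) y Z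
      = sw ?Y ?Z (?X \<diamond> ?R) \<bullet> (idn ?Y \<diamond>\<^sub>a sw ?X ?Z ?R) \<bullet> sw ?X ?Y (?Z \<diamond> ?R)
          \<bullet> (idn ?X \<diamond>\<^sub>a ((idn ?Y \<diamond>\<^sub>a pull A (remove1 y ts) z Z) \<bullet> pull A ts y Z))"
      using m by (simp add: whisker reassoc[OF sw_nat])
    also have "\<dots> = (idn ?Z \<diamond>\<^sub>a sw ?X ?Y ?R) \<bullet> sw ?X ?Z (?Y \<diamond> ?R)
          \<bullet> (idn ?X \<diamond>\<^sub>a (sw ?Y ?Z ?R \<bullet> (idn ?Y \<diamond>\<^sub>a pull A (remove1 y ts) z Z) \<bullet> pull A ts y Z))"
      by (simp add: whisker reassoc3[OF yang_baxter])
    also have "\<dots> = (idn ?Z \<diamond>\<^sub>a pull A (remove1 z (x # ts)) y Z) \<bullet> pull A (x # ts) z Z"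
      unfolding Cons.IH[OF m(5,6)] using m by (simp add: whisker r reassoc[OF sw_nat])
    finally show ?thesis .
  qed
qed simp

lemma pull_perm:
  assumes "mset ts = mset us" "z \<in> set us"
  shows "pull A us z Z \<bullet> perm A ts us Z = (idn (A z) \<diamond>\<^sub>a perm A (remove1 z ts) (remove1 z us) Z) \<bullet> pull A ts z Z"
  using assms
proof (induction us arbitrary: ts)
  case (Cons y us)
  from Cons.prems have y: "y \<in> set ts" "mset (remove1 y ts) = mset us"
    by (auto simp: mset_eq_Cons simp del: mset.simps(2))
  show ?case
  proof (cases "z = y")
    case True
    then show ?thesis using y by simp
  next
    case False
    then have z: "z \<in> set us" "z \<in> set ts" "z \<in> set (remove1 y ts)" "y \<in> set (remove1 z ts)" "z \<in># mset us"
      using Cons.prems y mset_eq_setD[OF Cons.prems(1)] by (auto simp: in_set_remove1)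
    have m: "mset (remove1 z (remove1 y ts)) = mset (remove1 z us)" using y by simp
    let ?R = "lobj (map A (remove1 z us)) Z"
    have "pull A (y # us) z Z \<bullet> perm A ts (y # us) Z
      = sw (A y) (A z) ?R \<bullet> (idn (A y) \<diamond>\<^sub>a (pull A us z Z \<bullet> perm A (remove1 y ts) us Z)) \<bullet> pull A ts y Z"
      using False by (simp add: whisker)
    also have "\<dots> = (idn (A z) \<diamond>\<^sub>a (idn (A y) \<diamond>\<^sub>a perm A (remove1 z (remove1 y ts)) (remove1 z us) Z))
        \<bullet> sw (A y) (A z) (lobj (map A (remove1 z (remove1 y ts))) Z) \<bullet> (idn (A y) \<diamond>\<^sub>a pull A (remove1 y ts) z Z) \<bullet> pull A ts y Z"
      unfolding Cons.IH[OF y(2) z(1)] using m z by (simp add: whisker reassoc[OF sw_nat])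
    also have "\<dots> = (idn (A z) \<diamond>\<^sub>a perm A (remove1 z ts) (remove1 z (y # us)) Z) \<bullet> pull A ts z Z"
      using False y z pull_pull[of y z ts A Z] by (simp add: whisker remove1_commute)
    finally show ?thesis .
  qed
qed simp

text \<open>
  This is coherence for symmetric monoidal categories. The induction pulls the head of the last ordering to
  the front, which may be done before or after the first reordering by \<open>pull_perm\<close>.
\<close>

lemma perm_trans:
  assumes "mset ts = mset us" "mset us = mset vs"
  shows "perm A us vs Z \<bullet> perm A ts us Z = perm A ts vs Z"
  using assms
proof (induction vs arbitrary: ts us)
  case Nil
  then show ?case by simp
next
  case (Cons z vs)
  from Cons.prems have z: "z \<in> set us" "mset (remove1 z us) = mset vs" "z \<in> set ts" "mset (remove1 z ts) = mset (remove1 z us)"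
    by (auto simp: mset_eq_Cons simp del: mset.simps(2) dest: mset_eq_setD)
  have "perm A us (z # vs) Z \<bullet> perm A ts us Z
    = (idn (A z) \<diamond>\<^sub>a (perm A (remove1 z us) vs Z \<bullet> perm A (remove1 z ts) (remove1 z us) Z)) \<bullet> pull A ts z Z"
    using z Cons.prems by (simp add: pull_perm whisker)
  then show ?case using Cons.IH[of "remove1 z ts" "remove1 z us"] z by simp
qed

lemma perm_Cons [simp]: "mset ts = mset us \<Longrightarrow> perm A (x # ts) (x # us) Z = idn (A x) \<diamond>\<^sub>a perm A ts us Z"
  by simp

lemma perm_refl [simp]: "perm A ts ts Z = idn (lobj (map A ts) Z)"
  by (induction ts) auto

lemma perm_swap: "x \<noteq> y \<Longrightarrow> perm A (x # y # ts) (y # x # ts) Z = sw (A x) (A y) (lobj (map A ts) Z)"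
  by simp

declare perm.simps(2) [simp del]

lemma perm_append_left: "mset ts = mset us \<Longrightarrow> perm A (ks @ ts) (ks @ us) Z = tail (map A ks) (perm A ts us Z)"
  by (induction ks) auto

lemma perm_append_right: "mset ts = mset us \<Longrightarrow> perm A (ts @ vs) (us @ vs) Z = perm A ts us (lobj (map A vs) Z)"
proof (induction rule: mset_eq_induct)
  case (trans ts us ws)
  then show ?case
    by (simp add: perm_trans[of "ts @ vs" "us @ vs" "ws @ vs", symmetric] perm_trans[of ts us ws, symmetric])
qed (simp_all add: perm_swap)

lemma pull_nat:
  assumes "\<And>t. t \<in> set ts \<Longrightarrow> arr (H t)" "arr h" "z \<in> set ts"
  shows "(H z \<diamond>\<^sub>a larr (map H (remove1 z ts)) h) \<bullet> pull (\<lambda>t. src (H t)) ts z (src h)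
    = pull (\<lambda>t. tgt (H t)) ts z (tgt h) \<bullet> larr (map H ts) h"
  using assms
proof (induction ts)
  case (Cons x ts)
  show ?case
  proof (cases "x = z")
    case True
    then show ?thesis using Cons.prems by (simp add: comp_def)
  next
    case False
    then have z: "z \<in> set ts" using Cons.prems by auto
    have s: "\<And>t. t \<in> set (remove1 z ts) \<Longrightarrow> arr (H t)"
      using Cons.prems set_remove1_subset[of z ts] by auto
    have "(H z \<diamond>\<^sub>a (H x \<diamond>\<^sub>a larr (map H (remove1 z ts)) h)) \<bullet> sw (src (H x)) (src (H z)) (lobj (map (\<lambda>t. src (H t)) (remove1 z ts)) (src h))
        = sw (tgt (H x)) (tgt (H z)) (lobj (map (\<lambda>t. tgt (H t)) (remove1 z ts)) (tgt h)) \<bullet> (H x \<diamond>\<^sub>a (H z \<diamond>\<^sub>a larr (map H (remove1 z ts)) h))"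
      using Cons.prems z s by (subst sw_nat) (auto simp: comp_def)
    then show ?thesis
      using False Cons.IH Cons.prems z by (simp add: reassoc tA_merge)
  qed
qed simp

lemma perm_nat:
  assumes "mset ts = mset us" "\<And>t. t \<in> set ts \<Longrightarrow> arr (H t)" "arr h"
  shows "larr (map H us) h \<bullet> perm (\<lambda>t. src (H t)) ts us (src h)
    = perm (\<lambda>t. tgt (H t)) ts us (tgt h) \<bullet> larr (map H ts) h"
  using assms(1,2)
proof (induction us arbitrary: ts)
  case Nil
  then show ?case using assms(3) by simp
next
  case (Cons y us)
  from Cons.prems have y: "y \<in> set ts" "mset (remove1 y ts) = mset us"
    by (auto simp: mset_eq_Cons simp del: mset.simps(2))
  have s: "set (remove1 y ts) \<subseteq> set ts" by (rule set_remove1_subset)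
  have IH: "larr (map H us) h \<bullet> perm (\<lambda>t. src (H t)) (remove1 y ts) us (src h)
    = perm (\<lambda>t. tgt (H t)) (remove1 y ts) us (tgt h) \<bullet> larr (map H (remove1 y ts)) h"
    using Cons.IH[of "remove1 y ts"] y Cons.prems s by blast
  have "larr (map H (y # us)) h \<bullet> perm (\<lambda>t. src (H t)) ts (y # us) (src h)
    = (idn (tgt (H y)) \<diamond>\<^sub>a perm (\<lambda>t. tgt (H t)) (remove1 y ts) us (tgt h)) \<bullet>
      (H y \<diamond>\<^sub>a larr (map H (remove1 y ts)) h) \<bullet> pull (\<lambda>t. src (H t)) ts y (src h)"
    using y Cons.prems by (simp add: perm.simps(2) tA_merge IH)
  then show ?case
    using pull_nat[of ts H h y] Cons.prems assms(3) y by (simp add: perm.simps(2))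
qed

lemma perm_cong: "mset ts = mset us \<Longrightarrow> (\<And>t. t \<in> set ts \<Longrightarrow> A t = B t) \<Longrightarrow> perm A ts us Z = perm B ts us Z"
proof (induction rule: mset_eq_induct)
  case (swap x y ts)
  then show ?case by (simp add: perm_swap cong: map_cong)
next
  case (trans ts us vs)
  then show ?case using perm_trans[of ts us vs A Z] perm_trans[of ts us vs B Z] mset_eq_setD[OF trans(1)] by simp
qed simp_all

lemma perm_pack:
  assumes "mset ts = mset us"
  shows "perm A ts us Z \<bullet> pack (map A ts) Z = pack (map A us) Z \<bullet> (perm A ts us unit \<diamond>\<^sub>a idn Z)"
  using assms
proof (induction rule: mset_eq_induct)
  case (Cons x ts us)
  have "perm A (x # ts) (x # us) Z \<bullet> pack (map A (x # ts)) Z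
    = (idn (A x) \<diamond>\<^sub>a (perm A ts us Z \<bullet> pack (map A ts) Z)) \<bullet> al (A x) (lobj (map A ts) unit) Z"
    using Cons(1) by (simp add: whisker)
  also have "\<dots> = pack (map A (x # us)) Z \<bullet> (perm A (x # ts) (x # us) unit \<diamond>\<^sub>a idn Z)"
    unfolding Cons(2) using Cons(1) by (simp add: whisker al_push)
  finally show ?case .
next
  case (swap x y ts)
  have "perm A (x # y # ts) (y # x # ts) Z = letter 0 True (map A (x # y # ts)) Z" for Z
    using swap by (simp add: perm_swap)
  then show ?case using letter_pack[of 0 True "map A (x # y # ts)" Z] by simp
next
  case (trans ts us vs)
  then show ?case
    by (simp add: perm_trans[of ts us vs, symmetric] whisker trans(3) reassoc[OF trans(4)])
qed simp

lemma perm_sum: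
  assumes "mset ts = mset us" "mset ts' = mset us'"
  shows "perm A (ts @ ts') (us @ us') unit \<bullet> pack (map A ts) (lobj (map A ts') unit)
     = pack (map A us) (lobj (map A us') unit) \<bullet> (perm A ts us unit \<diamond>\<^sub>a perm A ts' us' unit)"
proof -
  have "perm A (ts @ ts') (us @ us') unit = perm A (ts @ us') (us @ us') unit \<bullet> perm A (ts @ ts') (ts @ us') unit"
    using assms by (subst perm_trans) auto
  then show ?thesis
    using assms pack_tail[of "perm A ts' us' unit" "lobj (map A us') unit" "map A ts", symmetric]
    by (simp add: perm_append_left perm_append_right reassoc[OF perm_pack] tA_merge)
qed

lemma perm_pass: "x \<notin> set us \<Longrightarrow> perm A (x # us @ vs) (us @ x # vs) Z = pass (A x) (map A us) (lobj (map A vs) Z)"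
proof (induction us)
  case (Cons y us)
  have "perm A (x # (y # us) @ vs) ((y # us) @ x # vs) Z
    = perm A (y # x # us @ vs) (y # us @ x # vs) Z \<bullet> perm A (x # y # us @ vs) (y # x # us @ vs) Z"
    by (subst perm_trans) auto
  then show ?case using Cons by (simp add: perm_swap)
qed simp

lemma perm_block_pass: "set ts \<inter> set us = {} \<Longrightarrow>
    perm A (ts @ us @ vs) (us @ ts @ vs) Z = block_pass (map A ts) (map A us) (lobj (map A vs) Z)"
proof (induction ts)
  case (Cons x ts)
  have "perm A ((x # ts) @ us @ vs) (us @ (x # ts) @ vs) Z
    = perm A (x # us @ ts @ vs) (us @ x # ts @ vs) Z \<bullet> perm A (x # ts @ us @ vs) (x # us @ ts @ vs) Z"
    by (subst perm_trans) auto
  then show ?case using Cons by (simp add: perm_pass)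
qed simp

lemma perm_map: "mset ts = mset us \<Longrightarrow> inj_on h (set ts) \<Longrightarrow>
   perm A (map h ts) (map h us) Z = perm (\<lambda>t. A (h t)) ts us Z"
proof (induction rule: mset_eq_induct)
  case (swap x y ts)
  then have "h x \<noteq> h y" by (auto dest: inj_onD)
  then show ?case using swap(1) by (simp add: perm_swap comp_def)
next
  case (trans ts us vs)
  then show ?case
    using perm_trans[of "map h ts" "map h us" "map h vs" A Z] perm_trans[of ts us vs "\<lambda>t. A (h t)" Z] mset_eq_setD[OF trans(1)]
    by (simp add: mset_map)
qed simp_all

end

section \<open>Multiplying out sums of monomials\<close>

text \<open>
  The distributivities \<open>dl\<close> and \<open>dr\<close> are arbitrary natural arrows here; monomorphisms enter
  only at the very end.
\<close>

locale total_bimonoidal =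
  plus: total_symmetric arr src tgt idn cmp pO pA zero alP alP' laP laP' rhP rhP' zeP zeP' +
  times: total_braided arr src tgt idn cmp mO mA one alT alT' laT laT' rhT rhT' zeT zeT'
  for arr :: "'a \<Rightarrow> bool" and src tgt :: "'a \<Rightarrow> 'v" and idn and cmp (infixr "\<bullet>" 55)
    and pO (infixr "\<boxplus>" 65) and pA (infixr "\<boxplus>\<^sub>a" 65) and zero alP alP' laP laP' rhP rhP' zeP zeP'
    and mO (infixr "\<boxtimes>" 70) and mA (infixr "\<boxtimes>\<^sub>a" 70) and one alT alT' laT laT' rhT rhT' zeT zeT' +
  fixes lz rz :: "'v \<Rightarrow> 'a" and dl dr :: "'v \<Rightarrow> 'v \<Rightarrow> 'v \<Rightarrow> 'a"
  assumes lz_arr [simp]: "arr (lz A)" "src (lz A) = zero \<boxtimes> A" "tgt (lz A) = zero"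
    and rz_arr [simp]: "arr (rz A)" "src (rz A) = A \<boxtimes> zero" "tgt (rz A) = zero"
    and dl_arr [simp]: "arr (dl A B D)" "src (dl A B D) = A \<boxtimes> (B \<boxplus> D)" "tgt (dl A B D) = A \<boxtimes> B \<boxplus> A \<boxtimes> D"
    and dr_arr [simp]: "arr (dr A B D)" "src (dr A B D) = (A \<boxplus> B) \<boxtimes> D" "tgt (dr A B D) = A \<boxtimes> D \<boxplus> B \<boxtimes> D"
    and lz_nat: "arr f \<Longrightarrow> tgt f = A \<Longrightarrow> lz A \<bullet> (idn zero \<boxtimes>\<^sub>a f) = lz (src f)"
    and rz_nat: "arr f \<Longrightarrow> tgt f = A \<Longrightarrow> rz A \<bullet> (f \<boxtimes>\<^sub>a idn zero) = rz (src f)"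
    and dl_nat: "arr f \<Longrightarrow> arr g \<Longrightarrow> arr h \<Longrightarrow> tgt f = A \<Longrightarrow> tgt g = B \<Longrightarrow> tgt h = D \<Longrightarrow>
       dl A B D \<bullet> (f \<boxtimes>\<^sub>a (g \<boxplus>\<^sub>a h)) = (f \<boxtimes>\<^sub>a g \<boxplus>\<^sub>a f \<boxtimes>\<^sub>a h) \<bullet> dl (src f) (src g) (src h)"
    and dr_nat: "arr f \<Longrightarrow> arr g \<Longrightarrow> arr h \<Longrightarrow> tgt f = A \<Longrightarrow> tgt g = B \<Longrightarrow> tgt h = D \<Longrightarrow>
       dr A B D \<bullet> ((f \<boxplus>\<^sub>a g) \<boxtimes>\<^sub>a h) = (f \<boxtimes>\<^sub>a h \<boxplus>\<^sub>a g \<boxtimes>\<^sub>a h) \<bullet> dr (src f) (src g) (src h)"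
    and dl_ze: "dl A D B \<bullet> (idn A \<boxtimes>\<^sub>a zeP B D) = zeP (A \<boxtimes> B) (A \<boxtimes> D) \<bullet> dl A B D"
    and dr_ze: "dr B A D \<bullet> (zeP A B \<boxtimes>\<^sub>a idn D) = zeP (A \<boxtimes> D) (B \<boxtimes> D) \<bullet> dr A B D"
    and dr_al: "alP (A \<boxtimes> E) (B \<boxtimes> E) (D \<boxtimes> E) \<bullet> (dr A B E \<boxplus>\<^sub>a idn (D \<boxtimes> E)) \<bullet> dr (A \<boxplus> B) D E
        = (idn (A \<boxtimes> E) \<boxplus>\<^sub>a dr B D E) \<bullet> dr A (B \<boxplus> D) E \<bullet> (alP A B D \<boxtimes>\<^sub>a idn E)"
    and dl_al: "alP (A \<boxtimes> B) (A \<boxtimes> D) (A \<boxtimes> E) \<bullet> (dl A B D \<boxplus>\<^sub>a idn (A \<boxtimes> E)) \<bullet> dl A (B \<boxplus> D) E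
        = (idn (A \<boxtimes> B) \<boxplus>\<^sub>a dl A D E) \<bullet> dl A B (D \<boxplus> E) \<bullet> (idn A \<boxtimes>\<^sub>a alP B D E)"
    and dl_alT: "dl A (B \<boxtimes> D) (B \<boxtimes> E) \<bullet> (idn A \<boxtimes>\<^sub>a dl B D E) \<bullet> alT A B (D \<boxplus> E)
        = (alT A B D \<boxplus>\<^sub>a alT A B E) \<bullet> dl (A \<boxtimes> B) D E"
    and dr_alT: "(alT A D E \<boxplus>\<^sub>a alT B D E) \<bullet> dr (A \<boxtimes> D) (B \<boxtimes> D) E \<bullet> (dr A B D \<boxtimes>\<^sub>a idn E)
        = dr A B (D \<boxtimes> E) \<bullet> alT (A \<boxplus> B) D E"
    and dlr_alT: "(alT A B E \<boxplus>\<^sub>a alT A D E) \<bullet> dr (A \<boxtimes> B) (A \<boxtimes> D) E \<bullet> (dl A B D \<boxtimes>\<^sub>a idn E)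
        = dl A (B \<boxtimes> E) (D \<boxtimes> E) \<bullet> (idn A \<boxtimes>\<^sub>a dr B D E) \<bullet> alT A (B \<boxplus> D) E"
    and dlr_swap: "alP' (A \<boxtimes> D) (B \<boxtimes> D) (A \<boxtimes> E \<boxplus> B \<boxtimes> E)
          \<bullet> (idn (A \<boxtimes> D) \<boxplus>\<^sub>a total_braided.sw idn (\<bullet>) (\<boxplus>\<^sub>a) alP alP' zeP (A \<boxtimes> E) (B \<boxtimes> D) (B \<boxtimes> E))
          \<bullet> alP (A \<boxtimes> D) (A \<boxtimes> E) (B \<boxtimes> D \<boxplus> B \<boxtimes> E)
            \<bullet> (dl A D E \<boxplus>\<^sub>a dl B D E) \<bullet> dr A B (D \<boxplus> E)
        = (dr A B D \<boxplus>\<^sub>a dr A B E) \<bullet> dl (A \<boxplus> B) D E"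
    and lz_rz: "lz zero = rz zero"
    and lz_dl: "laP zero \<bullet> (lz A \<boxplus>\<^sub>a lz B) \<bullet> dl zero A B = lz (A \<boxplus> B)"
    and rz_dr: "laP zero \<bullet> (rz A \<boxplus>\<^sub>a rz B) \<bullet> dr A B zero = rz (A \<boxplus> B)"
    and rhT_zero: "rhT zero = lz one"
    and laT_zero: "laT zero = rz one"
    and lz_alT: "lz (A \<boxtimes> B) \<bullet> alT zero A B = lz B \<bullet> (lz A \<boxtimes>\<^sub>a idn B)"
    and rz_lz_alT: "rz A \<bullet> (idn A \<boxtimes>\<^sub>a lz B) \<bullet> alT A zero B = lz B \<bullet> (rz A \<boxtimes>\<^sub>a idn B)"
    and rz_alT: "rz A \<bullet> (idn A \<boxtimes>\<^sub>a rz B) \<bullet> alT A B zero = rz (A \<boxtimes> B)"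
    and laP_dl: "laP (A \<boxtimes> B) \<bullet> (rz A \<boxplus>\<^sub>a idn (A \<boxtimes> B)) \<bullet> dl A zero B = idn A \<boxtimes>\<^sub>a laP B"
    and laP_dr: "laP (B \<boxtimes> A) \<bullet> (lz A \<boxplus>\<^sub>a idn (B \<boxtimes> A)) \<bullet> dr zero B A = laP B \<boxtimes>\<^sub>a idn A"
    and rhP_dl: "rhP (A \<boxtimes> B) \<bullet> (idn (A \<boxtimes> B) \<boxplus>\<^sub>a rz A) \<bullet> dl A B zero = idn A \<boxtimes>\<^sub>a rhP B"
    and rhP_dr: "rhP (A \<boxtimes> B) \<bullet> (idn (A \<boxtimes> B) \<boxplus>\<^sub>a lz B) \<bullet> dr A zero B = rhP A \<boxtimes>\<^sub>a idn B"
    and laT_dl: "(laT A \<boxplus>\<^sub>a laT B) \<bullet> dl one A B = laT (A \<boxplus> B)"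
    and rhT_dr: "(rhT A \<boxplus>\<^sub>a rhT B) \<bullet> dr A B one = rhT (A \<boxplus> B)"
    and dl_zeT: "dl D A B \<bullet> zeT (A \<boxplus> B) D = (zeT A D \<boxplus>\<^sub>a zeT B D) \<bullet> dr A B D"
    and dr_zeT: "dr B D A \<bullet> zeT A (B \<boxplus> D) = (zeT A B \<boxplus>\<^sub>a zeT A D) \<bullet> dl A B D"
    and lz_zeT: "lz A \<bullet> zeT A zero = rz A"
    and rz_zeT: "rz A \<bullet> zeT zero A = lz A"
begin

lemmas reassoc = plus.reassoc and reassoc3 = plus.reassoc3
lemmas merge = plus.tA_merge times.tA_merge

abbreviation Word :: "'v list \<Rightarrow> 'v" where "Word w \<equiv> times.lobj w one"

text \<open>
  A monomial is a list of objects with value \<open>Word w\<close>, a sum of monomials is a list of lists with value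
  \<open>Sum k\<close>. The arrows \<open>word_append\<close> and \<open>sum_append\<close> realize concatenation, \<open>shuffle\<close> reorders
  the tagged monomials \<open>W t\<close>, and \<open>par\<close> is a sum of arrows between monomials.
\<close>

definition Sum :: "'v list list \<Rightarrow> 'v" where "Sum k = plus.lobj (map Word k) zero"
definition sum_append :: "'v list list \<Rightarrow> 'v list list \<Rightarrow> 'a" where "sum_append k l = plus.pack (map Word k) (Sum l)"
definition word_append :: "'v list \<Rightarrow> 'v list \<Rightarrow> 'a" where "word_append v w = times.pack v (Word w)"
definition shuffle :: "('t \<Rightarrow> 'v list) \<Rightarrow> 't list \<Rightarrow> 't list \<Rightarrow> 'a" where
  "shuffle W ts us = plus.perm (\<lambda>t. Word (W t)) ts us zero"
definition par :: "('t \<Rightarrow> 'a) \<Rightarrow> 't list \<Rightarrow> 'a" where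
  "par H ts = plus.larr (map H ts) (idn zero)"

lemma Sum_simps [simp]: "Sum [] = zero" "Sum (v # k) = Word v \<boxplus> Sum k"
  by (simp_all add: Sum_def)

lemma word_append_arr [simp]: "arr (word_append v w)" "src (word_append v w) = Word v \<boxtimes> Word w" "tgt (word_append v w) = Word (v @ w)"
  by (simp_all add: word_append_def)
lemma word_append_assoc: "word_append (u @ v) w \<bullet> (word_append u v \<boxtimes>\<^sub>a idn (Word w)) = word_append u (v @ w) \<bullet> (idn (Word u) \<boxtimes>\<^sub>a word_append v w) \<bullet> alT (Word u) (Word v) (Word w)"
  by (simp add: word_append_def times.pack_assoc)
lemma word_append_Nil: "word_append [] w = laT (Word w)" "word_append v [] = rhT (Word v)"
  by (simp_all add: word_append_def times.pack_unit)

lemma sum_append_arr [simp]: "arr (sum_append k l)" "src (sum_append k l) = Sum k \<boxplus> Sum l" "tgt (sum_append k l) = Sum (k @ l)"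
  by (simp_all add: sum_append_def Sum_def)
lemma sum_append_Nil: "sum_append [] l = laP (Sum l)"
  by (simp add: sum_append_def)
lemma sum_append_Cons: "sum_append (v # k) l = (idn (Word v) \<boxplus>\<^sub>a sum_append k l) \<bullet> alP (Word v) (Sum k) (Sum l)"
  by (simp add: sum_append_def Sum_def)
lemma sum_append_Nil_right: "sum_append k [] = rhP (Sum k)"
  by (simp add: sum_append_def Sum_def plus.pack_unit)
lemma sum_append_assoc: "sum_append (k @ l) m \<bullet> (sum_append k l \<boxplus>\<^sub>a idn (Sum m)) = sum_append k (l @ m) \<bullet> (idn (Sum k) \<boxplus>\<^sub>a sum_append l m) \<bullet> alP (Sum k) (Sum l) (Sum m)"
  using plus.pack_assoc[of "map Word k" "map Word l" "Sum m"] by (simp add: sum_append_def Sum_def)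

lemma shuffle_arr [simp]: "mset ts = mset us \<Longrightarrow> arr (shuffle W ts us)" "mset ts = mset us \<Longrightarrow> src (shuffle W ts us) = Sum (map W ts)"
   "mset ts = mset us \<Longrightarrow> tgt (shuffle W ts us) = Sum (map W us)"
  by (simp_all add: shuffle_def Sum_def comp_def)
lemma shuffle_refl [simp]: "shuffle W ts ts = idn (Sum (map W ts))"
  by (simp add: shuffle_def Sum_def comp_def)
lemma shuffle_trans: "mset ts = mset us \<Longrightarrow> mset us = mset vs \<Longrightarrow> shuffle W us vs \<bullet> shuffle W ts us = shuffle W ts vs"
  by (simp add: shuffle_def plus.perm_trans)
lemma shuffle_inverse: "mset ts = mset us \<Longrightarrow> shuffle W us ts \<bullet> shuffle W ts us = idn (Sum (map W ts))"
  by (simp add: shuffle_trans)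
lemma shuffle_Cons: "mset ts = mset us \<Longrightarrow> shuffle W (x # ts) (x # us) = idn (Word (W x)) \<boxplus>\<^sub>a shuffle W ts us"
  by (simp add: shuffle_def)
lemma shuffle_swap: "x \<noteq> y \<Longrightarrow> shuffle W (x # y # ts) (y # x # ts) = plus.sw (Word (W x)) (Word (W y)) (Sum (map W ts))"
  by (simp add: shuffle_def Sum_def comp_def plus.perm_swap)
lemma shuffle_sum: "mset ts = mset us \<Longrightarrow> mset ts' = mset us' \<Longrightarrow>
   shuffle W (ts @ ts') (us @ us') \<bullet> sum_append (map W ts) (map W ts') = sum_append (map W us) (map W us') \<bullet> (shuffle W ts us \<boxplus>\<^sub>a shuffle W ts' us')"
  using plus.perm_sum[of ts us ts' us' "\<lambda>t. Word (W t)"] by (simp add: shuffle_def sum_append_def Sum_def comp_def)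
lemma shuffle_block_pass: "set ts \<inter> set us = {} \<Longrightarrow>
   shuffle W (ts @ us @ vs) (us @ ts @ vs) \<bullet> sum_append (map W ts) (map W us @ map W vs) \<bullet> (idn (Sum (map W ts)) \<boxplus>\<^sub>a sum_append (map W us) (map W vs))
   = sum_append (map W us) (map W ts @ map W vs) \<bullet> (idn (Sum (map W us)) \<boxplus>\<^sub>a sum_append (map W ts) (map W vs))
     \<bullet> plus.sw (Sum (map W ts)) (Sum (map W us)) (Sum (map W vs))"
  using plus.block_pass_pack[of "map (\<lambda>t. Word (W t)) ts" "map (\<lambda>t. Word (W t)) us" "Sum (map W vs)"]
  by (simp add: shuffle_def sum_append_def Sum_def comp_def plus.perm_block_pass plus.pack_push)
lemma shuffle_ze: "set ts \<inter> set us = {} \<Longrightarrow>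
   shuffle W (ts @ us) (us @ ts) \<bullet> sum_append (map W ts) (map W us) = sum_append (map W us) (map W ts) \<bullet> zeP (Sum (map W ts)) (Sum (map W us))"
  using plus.block_pass_ze[of "map (\<lambda>t. Word (W t)) ts" "map (\<lambda>t. Word (W t)) us"] plus.perm_block_pass[of ts us "\<lambda>t. Word (W t)" "[]" zero]
  by (simp add: shuffle_def sum_append_def Sum_def comp_def)
lemma shuffle_map: "mset ts = mset us \<Longrightarrow> inj_on h (set ts) \<Longrightarrow> shuffle W (map h ts) (map h us) = shuffle (\<lambda>t. W (h t)) ts us"
  by (simp add: shuffle_def plus.perm_map)
lemma shuffle_cong: "mset ts = mset us \<Longrightarrow> (\<And>t. t \<in> set ts \<Longrightarrow> W t = V t) \<Longrightarrow> shuffle W ts us = shuffle V ts us"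
  unfolding shuffle_def by (rule plus.perm_cong) auto

lemma par_simps [simp]: "par H [] = idn zero" "par H (t # ts) = H t \<boxplus>\<^sub>a par H ts"
  by (simp_all add: par_def)
lemma par_arr [simp]: "arr (par H ts) \<longleftrightarrow> (\<forall>t \<in> set ts. arr (H t))"
  by (simp add: par_def)
lemma par_src: "(\<And>t. t \<in> set ts \<Longrightarrow> arr (H t) \<and> src (H t) = Word (W t)) \<Longrightarrow> src (par H ts) = Sum (map W ts)"
  by (induction ts) auto
lemma par_tgt: "(\<And>t. t \<in> set ts \<Longrightarrow> arr (H t) \<and> tgt (H t) = Word (W t)) \<Longrightarrow> tgt (par H ts) = Sum (map W ts)"
  by (induction ts) auto
lemma par_cmp: "par G ts \<bullet> par H ts = par (\<lambda>t. G t \<bullet> H t) ts"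
  by (simp add: par_def plus.larr_cmp)
lemma par_cong: "(\<And>t. t \<in> set ts \<Longrightarrow> G t = H t) \<Longrightarrow> par G ts = par H ts"
  by (induction ts) auto
lemma par_idn: "par (\<lambda>t. idn (Word (W t))) ts = idn (Sum (map W ts))"
  by (induction ts) auto
lemma par_map: "par H (map h ts) = par (\<lambda>t. H (h t)) ts"
  by (simp add: par_def comp_def)

lemma par_shuffle:
  assumes "mset ts = mset us" "\<And>t. t \<in> set ts \<Longrightarrow> arr (H t) \<and> src (H t) = Word (W t) \<and> tgt (H t) = Word (V t)"
  shows "par H us \<bullet> shuffle W ts us = shuffle V ts us \<bullet> par H ts"
proof -
  have "shuffle W ts us = plus.perm (\<lambda>t. src (H t)) ts us zero" "shuffle V ts us = plus.perm (\<lambda>t. tgt (H t)) ts us zero"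
    using assms unfolding shuffle_def by (auto intro!: plus.perm_cong)
  then show ?thesis
    using plus.perm_nat[of ts us H "idn zero"] assms by (simp add: par_def)
qed

lemma par_sum:
  assumes "\<And>t. t \<in> set ts \<union> set us \<Longrightarrow> arr (H t) \<and> src (H t) = Word (W t) \<and> tgt (H t) = Word (V t)"
  shows "par H (ts @ us) \<bullet> sum_append (map W ts) (map W us) = sum_append (map V ts) (map V us) \<bullet> (par H ts \<boxplus>\<^sub>a par H us)"
proof -
  have *: "map Word (map V ts) = map tgt (map H ts)" "map Word (map W ts) = map src (map H ts)"
    "Sum (map V us) = tgt (par H us)" "Sum (map W us) = src (par H us)"
    using assms by (auto simp: par_src[of us H W] par_tgt[of us H V])
  then show ?thesis
    unfolding sum_append_def * using plus.pack_natural[of "par H us" "map H ts"] assms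
    by (simp add: par_def del: map_map)
qed

text \<open>
  The product of two sums is expanded in the right factor first, then each resulting product of a sum and a
  monomial in the left factor; \<open>distr_left\<close> serves the other order of expansion.
\<close>

primrec distr_right :: "'v list list \<Rightarrow> 'v list \<Rightarrow> 'a" where
  "distr_right [] w = lz (Word w)"
| "distr_right (v # k) w = (word_append v w \<boxplus>\<^sub>a distr_right k w) \<bullet> dr (Word v) (Sum k) (Word w)"

primrec distr_left :: "'v list \<Rightarrow> 'v list list \<Rightarrow> 'a" where
  "distr_left v [] = rz (Word v)"
| "distr_left v (w # l) = (word_append v w \<boxplus>\<^sub>a distr_left v l) \<bullet> dl (Word v) (Word w) (Sum l)"

primrec distr :: "'v list list \<Rightarrow> 'v list list \<Rightarrow> 'a" where
  "distr k [] = rz (Sum k)"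
| "distr k (w # l) = sum_append (map (\<lambda>v. v @ w) k) (word_products k l) \<bullet> (distr_right k w \<boxplus>\<^sub>a distr k l) \<bullet> dl (Sum k) (Word w) (Sum l)"

lemma distr_right_arr [simp]: "arr (distr_right k w)" "src (distr_right k w) = Sum k \<boxtimes> Word w" "tgt (distr_right k w) = Sum (map (\<lambda>v. v @ w) k)"
proof -
  have "arr (distr_right k w) \<and> src (distr_right k w) = Sum k \<boxtimes> Word w \<and> tgt (distr_right k w) = Sum (map (\<lambda>v. v @ w) k)"
    by (induction k) auto
  then show "arr (distr_right k w)" "src (distr_right k w) = Sum k \<boxtimes> Word w" "tgt (distr_right k w) = Sum (map (\<lambda>v. v @ w) k)" by auto
qed

lemma distr_left_arr [simp]: "arr (distr_left v l)" "src (distr_left v l) = Word v \<boxtimes> Sum l" "tgt (distr_left v l) = Sum (map (\<lambda>w. v @ w) l)"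
proof -
  have "arr (distr_left v l) \<and> src (distr_left v l) = Word v \<boxtimes> Sum l \<and> tgt (distr_left v l) = Sum (map (\<lambda>w. v @ w) l)"
    by (induction l) auto
  then show "arr (distr_left v l)" "src (distr_left v l) = Word v \<boxtimes> Sum l" "tgt (distr_left v l) = Sum (map (\<lambda>w. v @ w) l)" by auto
qed

lemma distr_arr [simp]: "arr (distr k l)" "src (distr k l) = Sum k \<boxtimes> Sum l" "tgt (distr k l) = Sum (word_products k l)"
proof -
  have "arr (distr k l) \<and> src (distr k l) = Sum k \<boxtimes> Sum l \<and> tgt (distr k l) = Sum (word_products k l)"
    by (induction l) auto
  then show "arr (distr k l)" "src (distr k l) = Sum k \<boxtimes> Sum l" "tgt (distr k l) = Sum (word_products k l)" by auto
qed

lemma dr_al': "(idn (A \<boxtimes> E) \<boxplus>\<^sub>a dr B D E) \<bullet> dr A (B \<boxplus> D) E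
   = alP (A \<boxtimes> E) (B \<boxtimes> E) (D \<boxtimes> E) \<bullet> (dr A B E \<boxplus>\<^sub>a idn (D \<boxtimes> E)) \<bullet> dr (A \<boxplus> B) D E \<bullet> (alP' A B D \<boxtimes>\<^sub>a idn E)"
  by (simp add: reassoc3[OF dr_al] merge)

lemma dl_al': "(idn (A \<boxtimes> B) \<boxplus>\<^sub>a dl A D E) \<bullet> dl A B (D \<boxplus> E)
   = alP (A \<boxtimes> B) (A \<boxtimes> D) (A \<boxtimes> E) \<bullet> (dl A B D \<boxplus>\<^sub>a idn (A \<boxtimes> E)) \<bullet> dl A (B \<boxplus> D) E \<bullet> (idn A \<boxtimes>\<^sub>a alP' B D E)"
  by (simp add: reassoc3[OF dl_al] merge)

lemma al_whisker:
  "arr x \<Longrightarrow> tgt x = ((A \<boxplus> B) \<boxplus> D) \<boxtimes> E \<Longrightarrow> (alP' A B D \<boxtimes>\<^sub>a idn E) \<bullet> (alP A B D \<boxtimes>\<^sub>a idn E) \<bullet> x = x"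
  "arr x \<Longrightarrow> tgt x = E \<boxtimes> ((A \<boxplus> B) \<boxplus> D) \<Longrightarrow> (idn E \<boxtimes>\<^sub>a alP' A B D) \<bullet> (idn E \<boxtimes>\<^sub>a alP A B D) \<bullet> x = x"
  by (simp_all add: times.tA_merge)

text \<open>
  Together with its mirror image \<open>dl_sw\<close> this says that distributivity respects the exchange of adjacent
  summands; it combines the compatibilities with associativity and with the symmetry.
\<close>

lemma dr_sw: "plus.sw (A \<boxtimes> E) (B \<boxtimes> E) (D \<boxtimes> E) \<bullet> (idn (A \<boxtimes> E) \<boxplus>\<^sub>a dr B D E) \<bullet> dr A (B \<boxplus> D) E
   = (idn (B \<boxtimes> E) \<boxplus>\<^sub>a dr A D E) \<bullet> dr B (A \<boxplus> D) E \<bullet> (plus.sw A B D \<boxtimes>\<^sub>a idn E)"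
proof -
  have "plus.sw (A \<boxtimes> E) (B \<boxtimes> E) (D \<boxtimes> E) \<bullet> (idn (A \<boxtimes> E) \<boxplus>\<^sub>a dr B D E) \<bullet> dr A (B \<boxplus> D) E
    = alP (B \<boxtimes> E) (A \<boxtimes> E) (D \<boxtimes> E) \<bullet> ((zeP (A \<boxtimes> E) (B \<boxtimes> E) \<bullet> dr A B E) \<boxplus>\<^sub>a idn (D \<boxtimes> E)) \<bullet> dr (A \<boxplus> B) D E \<bullet> (alP' A B D \<boxtimes>\<^sub>a idn E)"
    unfolding dr_al' plus.sw_def by (simp add: plus.whisker)
  then show ?thesis
    unfolding dr_ze[symmetric]
    by (simp add: plus.whisker plus.sw_def times.whisker reassoc[OF dr_nat] reassoc[OF dr_al'] al_whisker)
qed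

lemma dl_sw: "plus.sw (A \<boxtimes> B) (A \<boxtimes> D) (A \<boxtimes> E) \<bullet> (idn (A \<boxtimes> B) \<boxplus>\<^sub>a dl A D E) \<bullet> dl A B (D \<boxplus> E)
   = (idn (A \<boxtimes> D) \<boxplus>\<^sub>a dl A B E) \<bullet> dl A D (B \<boxplus> E) \<bullet> (idn A \<boxtimes>\<^sub>a plus.sw B D E)"
proof -
  have "plus.sw (A \<boxtimes> B) (A \<boxtimes> D) (A \<boxtimes> E) \<bullet> (idn (A \<boxtimes> B) \<boxplus>\<^sub>a dl A D E) \<bullet> dl A B (D \<boxplus> E)
    = alP (A \<boxtimes> D) (A \<boxtimes> B) (A \<boxtimes> E) \<bullet> ((zeP (A \<boxtimes> B) (A \<boxtimes> D) \<bullet> dl A B D) \<boxplus>\<^sub>a idn (A \<boxtimes> E)) \<bullet> dl A (B \<boxplus> D) E \<bullet> (idn A \<boxtimes>\<^sub>a alP' B D E)"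
    unfolding dl_al' plus.sw_def by (simp add: plus.whisker)
  then show ?thesis
    unfolding dl_ze[symmetric]
    by (simp add: plus.whisker plus.sw_def times.whisker reassoc[OF dl_nat] reassoc[OF dl_al'] al_whisker)
qed

lemma distr_right_nat:
  assumes "\<And>t. t \<in> set ts \<Longrightarrow> arr (H t) \<and> src (H t) = Word (W t) \<and> tgt (H t) = Word (W' t)"
    and "arr g" "src g = Word v" "tgt g = Word v'"
    and "\<And>t. t \<in> set ts \<Longrightarrow> arr (J t) \<and> src (J t) = Word (W t @ v) \<and> tgt (J t) = Word (W' t @ v')"
    and "\<And>t. t \<in> set ts \<Longrightarrow> J t \<bullet> word_append (W t) v = word_append (W' t) v' \<bullet> (H t \<boxtimes>\<^sub>a g)"
  shows "par J ts \<bullet> distr_right (map W ts) v = distr_right (map W' ts) v' \<bullet> (par H ts \<boxtimes>\<^sub>a g)"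
  using assms
proof (induction ts)
  case Nil
  then show ?case by (simp add: lz_nat)
next
  case (Cons t ts)
  have IH: "par J ts \<bullet> distr_right (map W ts) v = distr_right (map W' ts) v' \<bullet> (par H ts \<boxtimes>\<^sub>a g)"
    using Cons.IH Cons.prems by auto
  have "src (par H ts) = Sum (map W ts)" "tgt (par H ts) = Sum (map W' ts)"
    using par_src[of ts H W] par_tgt[of ts H W'] Cons.prems(1) by auto
  then have "distr_right (map W' (t # ts)) v' \<bullet> (par H (t # ts) \<boxtimes>\<^sub>a g)
    = ((word_append (W' t) v' \<bullet> (H t \<boxtimes>\<^sub>a g)) \<boxplus>\<^sub>a (distr_right (map W' ts) v' \<bullet> (par H ts \<boxtimes>\<^sub>a g))) \<bullet> dr (Word (W t)) (Sum (map W ts)) (Word v)"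
    using Cons.prems by (simp add: dr_nat plus.tA_merge)
  also have "\<dots> = par J (t # ts) \<bullet> distr_right (map W (t # ts)) v"
    unfolding IH[symmetric] using Cons.prems(6)[of t, symmetric] by (simp add: plus.tA_merge)
  finally show ?case ..
qed

lemma distr_nat:
  assumes "\<And>t. t \<in> set ts \<Longrightarrow> arr (H t) \<and> src (H t) = Word (W t) \<and> tgt (H t) = Word (W' t)"
    and "\<And>u. u \<in> set us \<Longrightarrow> arr (G u) \<and> src (G u) = Word (V u) \<and> tgt (G u) = Word (V' u)"
    and "\<And>t u. t \<in> set ts \<Longrightarrow> u \<in> set us \<Longrightarrow> arr (J (t, u)) \<and> src (J (t, u)) = Word (W t @ V u) \<and> tgt (J (t, u)) = Word (W' t @ V' u)"
    and "\<And>t u. t \<in> set ts \<Longrightarrow> u \<in> set us \<Longrightarrow> J (t, u) \<bullet> word_append (W t) (V u) = word_append (W' t) (V' u) \<bullet> (H t \<boxtimes>\<^sub>a G u)"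
  shows "par J (pairs ts us) \<bullet> distr (map W ts) (map V us) = distr (map W' ts) (map V' us) \<bullet> (par H ts \<boxtimes>\<^sub>a par G us)"
  using assms(2-4)
proof (induction us)
  case Nil
  then show ?case using par_src[of ts H W] par_tgt[of ts H W'] assms(1) by (simp add: rz_nat)
next
  case (Cons u us)
  have H: "src (par H ts) = Sum (map W ts)" "tgt (par H ts) = Sum (map W' ts)"
    using par_src[of ts H W] par_tgt[of ts H W'] assms(1) by auto
  have G: "src (par G us) = Sum (map V us)" "tgt (par G us) = Sum (map V' us)"
    using par_src[of us G V] par_tgt[of us G V'] Cons.prems(1) by auto
  have IH: "par J (pairs ts us) \<bullet> distr (map W ts) (map V us) = distr (map W' ts) (map V' us) \<bullet> (par H ts \<boxtimes>\<^sub>a par G us)"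
    using Cons.IH Cons.prems by auto
  have R: "par (\<lambda>t. J (t, u)) ts \<bullet> distr_right (map W ts) (V u) = distr_right (map W' ts) (V' u) \<bullet> (par H ts \<boxtimes>\<^sub>a G u)"
    by (rule distr_right_nat) (use assms(1) Cons.prems in auto)
  have "par J (map (\<lambda>t. (t, u)) ts @ pairs ts us)
      \<bullet> sum_append (map (\<lambda>x. W (fst x) @ V (snd x)) (map (\<lambda>t. (t, u)) ts)) (map (\<lambda>x. W (fst x) @ V (snd x)) (pairs ts us))
    = sum_append (map (\<lambda>x. W' (fst x) @ V' (snd x)) (map (\<lambda>t. (t, u)) ts)) (map (\<lambda>x. W' (fst x) @ V' (snd x)) (pairs ts us))
      \<bullet> (par J (map (\<lambda>t. (t, u)) ts) \<boxplus>\<^sub>a par J (pairs ts us))"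
    by (rule par_sum) (use Cons.prems in auto)
  then have S: "par J (pairs ts (u # us)) \<bullet> sum_append (map (\<lambda>t. W t @ V u) ts) (word_products (map W ts) (map V us))
    = sum_append (map (\<lambda>t. W' t @ V' u) ts) (word_products (map W' ts) (map V' us)) \<bullet> (par (\<lambda>t. J (t, u)) ts \<boxplus>\<^sub>a par J (pairs ts us))"
    by (simp add: word_products_pairs comp_def par_map)
  have "distr (map W' ts) (map V' (u # us)) \<bullet> (par H ts \<boxtimes>\<^sub>a par G (u # us))
     = sum_append (map (\<lambda>t. W' t @ V' u) ts) (word_products (map W' ts) (map V' us))
      \<bullet> ((distr_right (map W' ts) (V' u) \<bullet> (par H ts \<boxtimes>\<^sub>a G u)) \<boxplus>\<^sub>a (distr (map W' ts) (map V' us) \<bullet> (par H ts \<boxtimes>\<^sub>a par G us)))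
      \<bullet> dl (Sum (map W ts)) (Word (V u)) (Sum (map V us))"
    using Cons.prems assms(1) H G by (simp add: dl_nat plus.tA_merge comp_def)
  also have "\<dots> = par J (pairs ts (u # us)) \<bullet> distr (map W ts) (map V (u # us))"
    unfolding IH[symmetric] R[symmetric]
    by (simp only: distr.simps list.map map_map comp_def reassoc[OF S] plus.cmp_assoc plus.tA_merge)
  finally show ?case ..
qed

lemma distr_right_append: "distr_right (k @ l) w \<bullet> (sum_append k l \<boxtimes>\<^sub>a idn (Word w))
   = sum_append (map (\<lambda>v. v @ w) k) (map (\<lambda>v. v @ w) l) \<bullet> (distr_right k w \<boxplus>\<^sub>a distr_right l w) \<bullet> dr (Sum k) (Sum l) (Word w)"
proof (induction k)
  case Nil
  have "laP (Sum (map (\<lambda>v. v @ w) l)) \<bullet> (lz (Word w) \<boxplus>\<^sub>a distr_right l w) \<bullet> dr zero (Sum l) (Word w)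
     = laP (Sum (map (\<lambda>v. v @ w) l)) \<bullet> (idn zero \<boxplus>\<^sub>a distr_right l w) \<bullet> (lz (Word w) \<boxplus>\<^sub>a idn (Sum l \<boxtimes> Word w)) \<bullet> dr zero (Sum l) (Word w)"
    by (simp add: plus.tA_merge)
  also have "\<dots> = distr_right l w \<bullet> (laP (Sum l) \<boxtimes>\<^sub>a idn (Word w))"
    by (simp add: plus.unit_push laP_dr)
  finally show ?case by (simp add: sum_append_Nil)
next
  case (Cons v k)
  let ?k = "map (\<lambda>v. v @ w) k" and ?l = "map (\<lambda>v. v @ w) l" and ?w = "Word w"
  have "distr_right ((v # k) @ l) w \<bullet> (sum_append (v # k) l \<boxtimes>\<^sub>a idn (Word w))
    = (word_append v w \<boxplus>\<^sub>a (distr_right (k @ l) w \<bullet> (sum_append k l \<boxtimes>\<^sub>a idn ?w))) \<bullet> dr (Word v) (Sum k \<boxplus> Sum l) ?w \<bullet> (alP (Word v) (Sum k) (Sum l) \<boxtimes>\<^sub>a idn ?w)"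
    by (simp add: sum_append_Cons times.whisker reassoc[OF dr_nat] plus.tA_merge)
  also have "\<dots> = (idn (Word (v @ w)) \<boxplus>\<^sub>a sum_append ?k ?l) \<bullet> (word_append v w \<boxplus>\<^sub>a (distr_right k w \<boxplus>\<^sub>a distr_right l w))
       \<bullet> (idn (Word v \<boxtimes> ?w) \<boxplus>\<^sub>a dr (Sum k) (Sum l) ?w) \<bullet> dr (Word v) (Sum k \<boxplus> Sum l) ?w \<bullet> (alP (Word v) (Sum k) (Sum l) \<boxtimes>\<^sub>a idn ?w)"
    unfolding Cons.IH by (simp add: plus.tA_merge)
  also have "\<dots> = sum_append (map (\<lambda>v. v @ w) (v # k)) ?l \<bullet> (distr_right (v # k) w \<boxplus>\<^sub>a distr_right l w) \<bullet> dr (Sum (v # k)) (Sum l) ?w"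
    by (simp add: dr_al[symmetric] sum_append_Cons plus.tensor_split plus.al_push)
  finally show ?case .
qed

lemma distr_append: "distr k (l @ l') \<bullet> (idn (Sum k) \<boxtimes>\<^sub>a sum_append l l')
   = sum_append (word_products k l) (word_products k l') \<bullet> (distr k l \<boxplus>\<^sub>a distr k l') \<bullet> dl (Sum k) (Sum l) (Sum l')" (is "?P l")
proof (induction l)
  case Nil
  have "laP (Sum (word_products k l')) \<bullet> (rz (Sum k) \<boxplus>\<^sub>a distr k l') \<bullet> dl (Sum k) zero (Sum l')
     = laP (Sum (word_products k l')) \<bullet> (idn zero \<boxplus>\<^sub>a distr k l') \<bullet> (rz (Sum k) \<boxplus>\<^sub>a idn (Sum k \<boxtimes> Sum l')) \<bullet> dl (Sum k) zero (Sum l')"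
    by (simp add: plus.tA_merge)
  also have "\<dots> = distr k l' \<bullet> (idn (Sum k) \<boxtimes>\<^sub>a laP (Sum l'))"
    by (simp add: plus.unit_push laP_dl)
  finally show ?case by (simp add: sum_append_Nil)
next
  case (Cons w l)
  let ?k = "map (\<lambda>v. v @ w) k" and ?K = "Sum k" and ?w = "Word w"
  have word_products: "word_products k (l @ l') = word_products k l @ word_products k l'" for l by (induction l) auto
  have "distr k ((w # l) @ l') \<bullet> (idn ?K \<boxtimes>\<^sub>a sum_append (w # l) l')
    = sum_append ?k (word_products k (l @ l')) \<bullet> (distr_right k w \<boxplus>\<^sub>a (distr k (l @ l') \<bullet> (idn ?K \<boxtimes>\<^sub>a sum_append l l')))
      \<bullet> dl ?K ?w (Sum l \<boxplus> Sum l') \<bullet> (idn ?K \<boxtimes>\<^sub>a alP ?w (Sum l) (Sum l'))"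
    by (simp add: sum_append_Cons times.whisker reassoc[OF dl_nat] plus.tA_merge)
  also have "\<dots> = sum_append ?k (word_products k (l @ l')) \<bullet> (idn (Sum ?k) \<boxplus>\<^sub>a sum_append (word_products k l) (word_products k l')) \<bullet> (distr_right k w \<boxplus>\<^sub>a (distr k l \<boxplus>\<^sub>a distr k l'))
      \<bullet> (idn (?K \<boxtimes> ?w) \<boxplus>\<^sub>a dl ?K (Sum l) (Sum l')) \<bullet> dl ?K ?w (Sum l \<boxplus> Sum l') \<bullet> (idn ?K \<boxtimes>\<^sub>a alP ?w (Sum l) (Sum l'))"
    unfolding Cons.IH by (simp add: plus.tA_merge)
  also have "\<dots> = sum_append ?k (word_products k l @ word_products k l') \<bullet> (idn (Sum ?k) \<boxplus>\<^sub>a sum_append (word_products k l) (word_products k l')) \<bullet> alP (Sum ?k) (Sum (word_products k l)) (Sum (word_products k l'))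
     \<bullet> ((distr_right k w \<boxplus>\<^sub>a distr k l) \<boxplus>\<^sub>a distr k l') \<bullet> (dl ?K ?w (Sum l) \<boxplus>\<^sub>a idn (?K \<boxtimes> Sum l')) \<bullet> dl ?K (?w \<boxplus> Sum l) (Sum l')"
    by (simp add: dl_al[symmetric] word_products plus.al_push)
  also have "\<dots> = sum_append (word_products k (w # l)) (word_products k l') \<bullet> (distr k (w # l) \<boxplus>\<^sub>a distr k l') \<bullet> dl ?K (Sum (w # l)) (Sum l')"
    by (simp add: reassoc3[OF sum_append_assoc[symmetric]]) (simp add: plus.tA_merge)
  finally show ?case .
qed

lemma distr_Nil [simp]: "distr [] l = lz (Sum l)"
proof (induction l)
  case Nil
  then show ?case by (simp add: lz_rz)
next
  case (Cons w l)
  have "word_products [] l = []" for l by (induction l) auto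
  then show ?case using lz_dl[of "Word w" "Sum l"] Cons by (simp add: sum_append_Nil)
qed

lemma distr_right_shuffle:
  assumes "mset ts = mset us"
  shows "shuffle (\<lambda>t. W t @ w) ts us \<bullet> distr_right (map W ts) w = distr_right (map W us) w \<bullet> (shuffle W ts us \<boxtimes>\<^sub>a idn (Word w))"
  using assms
proof (induction rule: mset_eq_induct)
  case Nil
  then show ?case by simp
next
  case (Cons x ts us)
  have "distr_right (map W (x # us)) w \<bullet> (shuffle W (x # ts) (x # us) \<boxtimes>\<^sub>a idn (Word w))
    = (word_append (W x) w \<boxplus>\<^sub>a (distr_right (map W us) w \<bullet> (shuffle W ts us \<boxtimes>\<^sub>a idn (Word w)))) \<bullet> dr (Word (W x)) (Sum (map W ts)) (Word w)"
    using Cons(1) by (simp add: shuffle_Cons dr_nat plus.tA_merge)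
  then show ?case
    unfolding Cons(2)[symmetric] using Cons(1) by (simp add: shuffle_Cons plus.tA_merge comp_def)
next
  case (swap x y ts)
  let ?R = "distr_right (map W ts) w" and ?x = "Word (W x)" and ?y = "Word (W y)" and ?w = "Word w" and ?K = "Sum (map W ts)"
  have "shuffle (\<lambda>t. W t @ w) (x # y # ts) (y # x # ts) \<bullet> distr_right (map W (x # y # ts)) w
     = plus.sw (Word (W x @ w)) (Word (W y @ w)) (Sum (map (\<lambda>t. W t @ w) ts)) \<bullet> (word_append (W x) w \<boxplus>\<^sub>a (word_append (W y) w \<boxplus>\<^sub>a ?R))
      \<bullet> (idn (?x \<boxtimes> ?w) \<boxplus>\<^sub>a dr ?y ?K ?w) \<bullet> dr ?x (?y \<boxplus> ?K) ?w"
    using swap by (simp add: shuffle_swap plus.tA_merge comp_def)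
  also have "\<dots> = (word_append (W y) w \<boxplus>\<^sub>a (word_append (W x) w \<boxplus>\<^sub>a ?R)) \<bullet> plus.sw (?x \<boxtimes> ?w) (?y \<boxtimes> ?w) (?K \<boxtimes> ?w)
      \<bullet> (idn (?x \<boxtimes> ?w) \<boxplus>\<^sub>a dr ?y ?K ?w) \<bullet> dr ?x (?y \<boxplus> ?K) ?w"
    by (simp add: reassoc[OF plus.sw_nat] comp_def)
  also have "\<dots> = distr_right (map W (y # x # ts)) w \<bullet> (shuffle W (x # y # ts) (y # x # ts) \<boxtimes>\<^sub>a idn (Word w))"
    unfolding dr_sw using swap by (simp add: shuffle_swap plus.tA_merge reassoc[OF plus.tA_cmp])
  finally show ?case .
next
  case (trans ts us vs)
  then show ?case
    by (simp add: shuffle_trans[of ts us vs, symmetric] times.whisker trans(3) reassoc[OF trans(4)])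
qed

lemma shuffle_sum': "mset ts = mset us \<Longrightarrow> mset ts' = mset us' \<Longrightarrow>
   k = map W ts \<Longrightarrow> k' = map W ts' \<Longrightarrow> l = map W us \<Longrightarrow> l' = map W us' \<Longrightarrow>
   shuffle W (ts @ ts') (us @ us') \<bullet> sum_append k k' = sum_append l l' \<bullet> (shuffle W ts us \<boxplus>\<^sub>a shuffle W ts' us')"
  using shuffle_sum by blast

text \<open>
  By induction on the right factor; \<open>distr_right_shuffle\<close> reorders the products with one of its
  monomials.
\<close>

lemma distr_shuffle_left:
  assumes "mset ts = mset ts'"
  shows "shuffle (pair_word W V) (pairs ts us) (pairs ts' us) \<bullet> distr (map W ts) (map V us)
    = distr (map W ts') (map V us) \<bullet> (shuffle W ts ts' \<boxtimes>\<^sub>a idn (Sum (map V us)))"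
proof (induction us)
  case Nil
  then show ?case using assms by (simp add: rz_nat)
next
  case (Cons u us)
  let ?t = "map (\<lambda>t. (t, u))"
  have P: "shuffle (pair_word W V) (?t ts) (?t ts') = shuffle (\<lambda>t. W t @ V u) ts ts'"
    using assms by (simp add: shuffle_map inj_on_def)
  have S: "shuffle (pair_word W V) (pairs ts (u # us)) (pairs ts' (u # us)) \<bullet> sum_append (map (\<lambda>t. W t @ V u) ts) (word_products (map W ts) (map V us))
    = sum_append (map (\<lambda>t. W t @ V u) ts') (word_products (map W ts') (map V us))
      \<bullet> (shuffle (\<lambda>t. W t @ V u) ts ts' \<boxplus>\<^sub>a shuffle (pair_word W V) (pairs ts us) (pairs ts' us))"
    unfolding P[symmetric] pairs_simps
    by (rule shuffle_sum'[OF mset_map_eq[OF assms] mset_pairs_left[OF assms]]) (simp_all add: word_products_pairs)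
  have D: "dl (Sum (map W ts')) (Word (V u)) (Sum (map V us)) \<bullet> (shuffle W ts ts' \<boxtimes>\<^sub>a idn (Sum (map V (u # us))))
     = ((shuffle W ts ts' \<boxtimes>\<^sub>a idn (Word (V u))) \<boxplus>\<^sub>a (shuffle W ts ts' \<boxtimes>\<^sub>a idn (Sum (map V us)))) \<bullet> dl (Sum (map W ts)) (Word (V u)) (Sum (map V us))"
    using dl_nat[of "shuffle W ts ts'" "idn (Word (V u))" "idn (Sum (map V us))"] assms by simp
  have "shuffle (pair_word W V) (pairs ts (u # us)) (pairs ts' (u # us)) \<bullet> distr (map W ts) (map V (u # us))
    = sum_append (map (\<lambda>t. W t @ V u) ts') (word_products (map W ts') (map V us))
     \<bullet> ((shuffle (\<lambda>t. W t @ V u) ts ts' \<bullet> distr_right (map W ts) (V u)) \<boxplus>\<^sub>a (shuffle (pair_word W V) (pairs ts us) (pairs ts' us) \<bullet> distr (map W ts) (map V us)))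
     \<bullet> dl (Sum (map W ts)) (Word (V u)) (Sum (map V us))"
    by (simp only: distr.simps list.map map_map comp_def reassoc[OF S] plus.tA_merge plus.cmp_assoc)
  also have "\<dots> = distr (map W ts') (map V (u # us)) \<bullet> (shuffle W ts ts' \<boxtimes>\<^sub>a idn (Sum (map V (u # us))))"
    unfolding Cons.IH distr_right_shuffle[OF assms]
    by (simp only: distr.simps list.map(2) map_map comp_def D[unfolded list.map(2)] plus.tA_merge plus.cmp_assoc)
  finally show ?case .
qed

text \<open>
  Exchanging two adjacent monomials of the right factor exchanges two blocks of products, which is where
  \<open>shuffle_block_pass\<close> is needed.
\<close>

lemma distr_shuffle_right:
  assumes "mset us = mset us'"
  shows "shuffle (pair_word W V) (pairs ts us) (pairs ts us') \<bullet> distr (map W ts) (map V us)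
    = distr (map W ts) (map V us') \<bullet> (idn (Sum (map W ts)) \<boxtimes>\<^sub>a shuffle V us us')"
  using assms
proof (induction rule: mset_eq_induct)
  case Nil
  then show ?case by simp
next
  case (Cons u us us')
  let ?u = "map (\<lambda>t. (t, u)) ts" and ?K = "Sum (map W ts)"
  have S: "shuffle (pair_word W V) (pairs ts (u # us)) (pairs ts (u # us')) \<bullet> sum_append (map (\<lambda>t. W t @ V u) ts) (word_products (map W ts) (map V us))
    = sum_append (map (\<lambda>t. W t @ V u) ts) (word_products (map W ts) (map V us'))
      \<bullet> (shuffle (pair_word W V) ?u ?u \<boxplus>\<^sub>a shuffle (pair_word W V) (pairs ts us) (pairs ts us'))"
    unfolding pairs_simps
    by (rule shuffle_sum'[OF HOL.refl mset_pairs_right[OF Cons(1)]]) (simp_all add: word_products_pairs)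
  have u: "shuffle (pair_word W V) ?u ?u \<bullet> distr_right (map W ts) (V u) = distr_right (map W ts) (V u)"
    by (simp add: comp_def)
  have "shuffle (pair_word W V) (pairs ts (u # us)) (pairs ts (u # us')) \<bullet> distr (map W ts) (map V (u # us))
    = sum_append (map (\<lambda>t. W t @ V u) ts) (word_products (map W ts) (map V us'))
     \<bullet> (distr_right (map W ts) (V u) \<boxplus>\<^sub>a (shuffle (pair_word W V) (pairs ts us) (pairs ts us') \<bullet> distr (map W ts) (map V us)))
     \<bullet> dl ?K (Word (V u)) (Sum (map V us))"
    by (simp only: distr.simps list.map map_map comp_def reassoc[OF S] plus.tA_merge plus.cmp_assoc u)
  also have "\<dots> = distr (map W ts) (map V (u # us')) \<bullet> (idn ?K \<boxtimes>\<^sub>a shuffle V (u # us) (u # us'))"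
    unfolding Cons(2) using Cons(1) by (simp add: shuffle_Cons dl_nat plus.tA_merge comp_def)
  finally show ?case .
next
  case (swap u v us)
  let ?u = "map (\<lambda>t. (t, u)) ts" and ?v = "map (\<lambda>t. (t, v)) ts" and ?K = "Sum (map W ts)"
  let ?ku = "map (\<lambda>t. W t @ V u) ts" and ?kv = "map (\<lambda>t. W t @ V v) ts" and ?r = "word_products (map W ts) (map V us)"
  let ?U = "Word (V u)" and ?V = "Word (V v)" and ?L = "Sum (map V us)"
  let ?RU = "distr_right (map W ts) (V u)" and ?RV = "distr_right (map W ts) (V v)" and ?M = "distr (map W ts) (map V us)"
  have d: "set ?u \<inter> set ?v = {}" using swap by auto
  have M: "distr (map W ts) (map V (a # b # us)) = sum_append (map (\<lambda>t. W t @ V a) ts) (map (\<lambda>t. W t @ V b) ts @ ?r)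
      \<bullet> (idn (Sum (map (\<lambda>t. W t @ V a) ts)) \<boxplus>\<^sub>a sum_append (map (\<lambda>t. W t @ V b) ts) ?r)
      \<bullet> (distr_right (map W ts) (V a) \<boxplus>\<^sub>a (distr_right (map W ts) (V b) \<boxplus>\<^sub>a ?M)) \<bullet> (idn (?K \<boxtimes> Word (V a)) \<boxplus>\<^sub>a dl ?K (Word (V b)) ?L)
      \<bullet> dl ?K (Word (V a)) (Word (V b) \<boxplus> ?L)" for a b
    by (simp add: plus.tA_merge comp_def)
  have "shuffle (pair_word W V) (pairs ts (u # v # us)) (pairs ts (v # u # us)) \<bullet> distr (map W ts) (map V (u # v # us))
    = sum_append ?kv (?ku @ ?r) \<bullet> (idn (Sum ?kv) \<boxplus>\<^sub>a sum_append ?ku ?r) \<bullet> plus.sw (Sum ?ku) (Sum ?kv) (Sum ?r) \<bullet> (?RU \<boxplus>\<^sub>a (?RV \<boxplus>\<^sub>a ?M))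
       \<bullet> (idn (?K \<boxtimes> Word (V u)) \<boxplus>\<^sub>a dl ?K (Word (V v)) ?L) \<bullet> dl ?K (Word (V u)) (Word (V v) \<boxplus> ?L)"
    unfolding M using reassoc3[OF shuffle_block_pass[OF d, of "pair_word W V" "pairs ts us"]] by (simp add: word_products_pairs comp_def)
  also have "\<dots> = sum_append ?kv (?ku @ ?r) \<bullet> (idn (Sum ?kv) \<boxplus>\<^sub>a sum_append ?ku ?r) \<bullet> (?RV \<boxplus>\<^sub>a (?RU \<boxplus>\<^sub>a ?M)) \<bullet> plus.sw (?K \<boxtimes> ?U) (?K \<boxtimes> ?V) (?K \<boxtimes> ?L)
       \<bullet> (idn (?K \<boxtimes> Word (V u)) \<boxplus>\<^sub>a dl ?K (Word (V v)) ?L) \<bullet> dl ?K (Word (V u)) (Word (V v) \<boxplus> ?L)"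
    by (simp add: reassoc[OF plus.sw_nat] comp_def)
  also have "\<dots> = distr (map W ts) (map V (v # u # us)) \<bullet> (idn (Sum (map W ts)) \<boxtimes>\<^sub>a shuffle V (u # v # us) (v # u # us))"
    unfolding M dl_sw using swap by (simp add: shuffle_swap)
  finally show ?case .
next
  case (trans us us' vs)
  show ?case
    by (simp add: shuffle_trans[OF mset_pairs_right mset_pairs_right, OF trans(1,2), symmetric] shuffle_trans[OF trans(1,2), symmetric]
       times.whisker trans(3) reassoc[OF trans(4)])
qed

text \<open>
  The axiom with the middle swap, with arrows attached to its four summands and without the inverse
  associativity.
\<close>

lemma distribute_both:
  assumes "arr f" "src f = X \<boxtimes> U" "tgt f = a" "arr g" "src g = K \<boxtimes> U" "tgt g = b"
    "arr h" "src h = X \<boxtimes> L" "tgt h = c" "arr k" "src k = K \<boxtimes> L" "tgt k = d"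
  shows "(idn a \<boxplus>\<^sub>a plus.sw b c d) \<bullet> alP a b (c \<boxplus> d) \<bullet> (((f \<boxplus>\<^sub>a g) \<bullet> dr X K U) \<boxplus>\<^sub>a ((h \<boxplus>\<^sub>a k) \<bullet> dr X K L)) \<bullet> dl (X \<boxplus> K) U L
     = alP a c (b \<boxplus> d) \<bullet> (((f \<boxplus>\<^sub>a h) \<bullet> dl X U L) \<boxplus>\<^sub>a ((g \<boxplus>\<^sub>a k) \<bullet> dl K U L)) \<bullet> dr X K (U \<boxplus> L)"
proof -
  let ?D = "(dl X U L \<boxplus>\<^sub>a dl K U L) \<bullet> dr X K (U \<boxplus> L)"
  have "(idn a \<boxplus>\<^sub>a plus.sw b c d) \<bullet> alP a b (c \<boxplus> d) \<bullet> (((f \<boxplus>\<^sub>a g) \<bullet> dr X K U) \<boxplus>\<^sub>a ((h \<boxplus>\<^sub>a k) \<bullet> dr X K L)) \<bullet> dl (X \<boxplus> K) U L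
     = (idn a \<boxplus>\<^sub>a plus.sw b c d) \<bullet> alP a b (c \<boxplus> d) \<bullet> ((f \<boxplus>\<^sub>a g) \<boxplus>\<^sub>a (h \<boxplus>\<^sub>a k)) \<bullet> (dr X K U \<boxplus>\<^sub>a dr X K L) \<bullet> dl (X \<boxplus> K) U L"
    by (simp add: plus.tA_merge)
  also have "\<dots> = (idn a \<boxplus>\<^sub>a plus.sw b c d) \<bullet> (f \<boxplus>\<^sub>a (g \<boxplus>\<^sub>a (h \<boxplus>\<^sub>a k))) \<bullet> (idn (X \<boxtimes> U) \<boxplus>\<^sub>a plus.sw (X \<boxtimes> L) (K \<boxtimes> U) (K \<boxtimes> L))
      \<bullet> alP (X \<boxtimes> U) (X \<boxtimes> L) (K \<boxtimes> U \<boxplus> K \<boxtimes> L) \<bullet> ?D"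
    unfolding dlr_swap[symmetric] using assms by (simp add: plus.al_push)
  also have "\<dots> = (f \<boxplus>\<^sub>a (h \<boxplus>\<^sub>a (g \<boxplus>\<^sub>a k))) \<bullet> alP (X \<boxtimes> U) (X \<boxtimes> L) (K \<boxtimes> U \<boxplus> K \<boxtimes> L) \<bullet> ?D"
    using assms by (simp add: plus.tA_merge plus.sw_nat reassoc[OF plus.sw_nat])
  also have "\<dots> = alP a c (b \<boxplus> d) \<bullet> ((f \<boxplus>\<^sub>a h) \<boxplus>\<^sub>a (g \<boxplus>\<^sub>a k)) \<bullet> ?D"
    using assms by (simp add: plus.al_push)
  finally show ?thesis by (simp add: plus.tA_merge)
qed

text \<open>
  The arrow \<open>distr\<close> splits the right factor. This lemma splits the left factor instead, at the price of
  reordering the products; each step of the induction is one use of \<open>distribute_both\<close>.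
\<close>

lemma distr_Cons:
  assumes "x \<notin> set ts"
  shows "shuffle (pair_word W V) (pairs (x # ts) us) (pairs [x] us @ pairs ts us) \<bullet> distr (map W (x # ts)) (map V us)
    = sum_append (map (\<lambda>w. W x @ w) (map V us)) (word_products (map W ts) (map V us)) \<bullet> (distr_left (W x) (map V us) \<boxplus>\<^sub>a distr (map W ts) (map V us))
      \<bullet> dr (Word (W x)) (Sum (map W ts)) (Sum (map V us))"
proof (induction us)
  case Nil
  then show ?case using rz_dr[of "Word (W x)" "Sum (map W ts)"] by (simp add: sum_append_Nil)
next
  case (Cons u us)
  let ?P = "pair_word W V" and ?u = "map (\<lambda>t. (t, u)) ts" and ?x = "pairs [x] us" and ?r = "pairs ts us"
  define KU KL XL ku kl xl where
    "KU = map (\<lambda>t. W t @ V u) ts" and "KL = word_products (map W ts) (map V us)" and "XL = map (\<lambda>w. W x @ w) (map V us)"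
    and "ku = distr_right (map W ts) (V u)" and "kl = distr (map W ts) (map V us)" and "xl = distr_left (W x) (map V us)"
  note defs = this
  let ?K = "Sum (map W ts)" and ?X = "Word (W x)" and ?U = "Word (V u)" and ?L = "Sum (map V us)"
  let ?xu = "W x @ V u" and ?M = "distr (map W (x # ts)) (map V us)" and ?R = "word_products (map W (x # ts)) (map V us)"
  let ?p = "shuffle ?P (pairs (x # ts) us) (?x @ ?r)" and ?b = "shuffle ?P (?u @ ?x @ ?r) (?x @ ?u @ ?r)"
  have ar: "arr ku" "src ku = ?K \<boxtimes> ?U" "tgt ku = Sum KU" "arr kl" "src kl = ?K \<boxtimes> ?L" "tgt kl = Sum KL"
    "arr xl" "src xl = ?X \<boxtimes> ?L" "tgt xl = Sum XL"
    by (simp_all add: defs comp_def)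
  have lists: "map ?P ?u = KU" "map ?P ?r = KL" "map ?P ?x = XL" "map ?P (pairs (x # ts) us) = ?R"
  proof -
    show "map ?P ?x = XL" unfolding defs by (induction us) auto
  qed (simp_all add: defs word_products_pairs word_products_pairs[of W "x # ts", simplified])
  have d: "set ?u \<inter> set ?x = {}" using assms by auto
  have m: "mset (pairs (x # ts) us) = mset (?x @ ?r)" by (rule mset_pairs_Cons)
  have p_ar: "arr ?p" "src ?p = Sum ?R" "tgt ?p = Sum (XL @ KL)"
    using m lists by simp_all
  have split: "shuffle ?P (pairs (x # ts) (u # us)) (pairs [x] (u # us) @ pairs ts (u # us))
      = (idn (Word ?xu) \<boxplus>\<^sub>a ?b) \<bullet> (idn (Word ?xu) \<boxplus>\<^sub>a shuffle ?P (?u @ pairs (x # ts) us) (?u @ ?x @ ?r))"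
    using shuffle_Cons[of "?u @ ?x @ ?r" "?x @ ?u @ ?r" ?P "(x, u)"] shuffle_Cons[of "?u @ pairs (x # ts) us" "?u @ ?x @ ?r" ?P "(x, u)"]
      shuffle_trans[of "(x, u) # ?u @ pairs (x # ts) us" "(x, u) # ?u @ ?x @ ?r" "(x, u) # ?x @ ?u @ ?r" ?P] m by simp
  have S: "shuffle ?P (?u @ pairs (x # ts) us) (?u @ ?x @ ?r) \<bullet> sum_append KU ?R = sum_append KU (XL @ KL) \<bullet> (idn (Sum KU) \<boxplus>\<^sub>a ?p)"
    using shuffle_sum[of ?u ?u "pairs (x # ts) us" "?x @ ?r" ?P, OF HOL.refl m] unfolding lists map_append shuffle_refl .
  have B: "?b \<bullet> sum_append KU (XL @ KL) \<bullet> (idn (Sum KU) \<boxplus>\<^sub>a sum_append XL KL)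
    = sum_append XL (KU @ KL) \<bullet> (idn (Sum XL) \<boxplus>\<^sub>a sum_append KU KL) \<bullet> plus.sw (Sum KU) (Sum XL) (Sum KL)"
    using shuffle_block_pass[OF d, of ?P ?r] unfolding lists map_append .
  have M: "distr (map W (x # ts)) (map V (u # us)) = (idn (Word ?xu) \<boxplus>\<^sub>a sum_append KU ?R) \<bullet> alP (Word ?xu) (Sum KU) (Sum ?R)
      \<bullet> (((word_append (W x) (V u) \<boxplus>\<^sub>a ku) \<bullet> dr ?X ?K ?U) \<boxplus>\<^sub>a ?M) \<bullet> dl (?X \<boxplus> ?K) ?U ?L"
    by (simp add: sum_append_Cons comp_def defs)
  have "shuffle ?P (pairs (x # ts) (u # us)) (pairs [x] (u # us) @ pairs ts (u # us)) \<bullet> distr (map W (x # ts)) (map V (u # us))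
     = (idn (Word ?xu) \<boxplus>\<^sub>a (?b \<bullet> sum_append KU (XL @ KL))) \<bullet> (idn (Word ?xu) \<boxplus>\<^sub>a (idn (Sum KU) \<boxplus>\<^sub>a ?p)) \<bullet> alP (Word ?xu) (Sum KU) (Sum ?R)
      \<bullet> (((word_append (W x) (V u) \<boxplus>\<^sub>a ku) \<bullet> dr ?X ?K ?U) \<boxplus>\<^sub>a ?M) \<bullet> dl (?X \<boxplus> ?K) ?U ?L"
    unfolding split M by (simp only: plus.cmp_assoc reassoc[OF plus.whisker_left[symmetric]] S)
  also have "(idn (Word ?xu) \<boxplus>\<^sub>a (idn (Sum KU) \<boxplus>\<^sub>a ?p)) \<bullet> alP (Word ?xu) (Sum KU) (Sum ?R)
      \<bullet> (((word_append (W x) (V u) \<boxplus>\<^sub>a ku) \<bullet> dr ?X ?K ?U) \<boxplus>\<^sub>a ?M) \<bullet> dl (?X \<boxplus> ?K) ?U ?L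
     = alP (Word ?xu) (Sum KU) (Sum (XL @ KL)) \<bullet> (((word_append (W x) (V u) \<boxplus>\<^sub>a ku) \<bullet> dr ?X ?K ?U) \<boxplus>\<^sub>a (?p \<bullet> ?M)) \<bullet> dl (?X \<boxplus> ?K) ?U ?L"
    using plus.al_nat3[of ?p "Sum (XL @ KL)" "Word ?xu" "Sum KU", symmetric, THEN reassoc] p_ar ar
    by (simp only: p_ar plus.tA_merge plus.cmp_assoc) (simp add: plus.tA_merge)
  also have "?p \<bullet> ?M = sum_append XL KL \<bullet> (xl \<boxplus>\<^sub>a kl) \<bullet> dr ?X ?K ?L"
    using Cons.IH unfolding defs .
  also have "alP (Word ?xu) (Sum KU) (Sum (XL @ KL)) \<bullet> (((word_append (W x) (V u) \<boxplus>\<^sub>a ku) \<bullet> dr ?X ?K ?U) \<boxplus>\<^sub>a (sum_append XL KL \<bullet> (xl \<boxplus>\<^sub>a kl) \<bullet> dr ?X ?K ?L))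
       \<bullet> dl (?X \<boxplus> ?K) ?U ?L
    = (idn (Word ?xu) \<boxplus>\<^sub>a (idn (Sum KU) \<boxplus>\<^sub>a sum_append XL KL)) \<bullet> alP (Word ?xu) (Sum KU) (Sum XL \<boxplus> Sum KL)
       \<bullet> (((word_append (W x) (V u) \<boxplus>\<^sub>a ku) \<bullet> dr ?X ?K ?U) \<boxplus>\<^sub>a ((xl \<boxplus>\<^sub>a kl) \<bullet> dr ?X ?K ?L)) \<bullet> dl (?X \<boxplus> ?K) ?U ?L"
    using plus.al_nat3[of "sum_append XL KL" "Sum (XL @ KL)" "Word ?xu" "Sum KU", THEN reassoc, symmetric] ar by (simp add: plus.tA_merge)
  also have "(idn (Word ?xu) \<boxplus>\<^sub>a (?b \<bullet> sum_append KU (XL @ KL))) \<bullet> (idn (Word ?xu) \<boxplus>\<^sub>a (idn (Sum KU) \<boxplus>\<^sub>a sum_append XL KL)) \<bullet> alP (Word ?xu) (Sum KU) (Sum XL \<boxplus> Sum KL)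
       \<bullet> (((word_append (W x) (V u) \<boxplus>\<^sub>a ku) \<bullet> dr ?X ?K ?U) \<boxplus>\<^sub>a ((xl \<boxplus>\<^sub>a kl) \<bullet> dr ?X ?K ?L)) \<bullet> dl (?X \<boxplus> ?K) ?U ?L
    = (idn (Word ?xu) \<boxplus>\<^sub>a sum_append XL (KU @ KL)) \<bullet> (idn (Word ?xu) \<boxplus>\<^sub>a (idn (Sum XL) \<boxplus>\<^sub>a sum_append KU KL)) \<bullet> (idn (Word ?xu) \<boxplus>\<^sub>a plus.sw (Sum KU) (Sum XL) (Sum KL))
        \<bullet> alP (Word ?xu) (Sum KU) (Sum XL \<boxplus> Sum KL)
       \<bullet> (((word_append (W x) (V u) \<boxplus>\<^sub>a ku) \<bullet> dr ?X ?K ?U) \<boxplus>\<^sub>a ((xl \<boxplus>\<^sub>a kl) \<bullet> dr ?X ?K ?L)) \<bullet> dl (?X \<boxplus> ?K) ?U ?L"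
    by (simp only: reassoc[OF plus.whisker_left[symmetric]] B plus.cmp_assoc)
  also have "\<dots> = (idn (Word ?xu) \<boxplus>\<^sub>a sum_append XL (KU @ KL)) \<bullet> (idn (Word ?xu) \<boxplus>\<^sub>a (idn (Sum XL) \<boxplus>\<^sub>a sum_append KU KL))
      \<bullet> alP (Word ?xu) (Sum XL) (Sum KU \<boxplus> Sum KL) \<bullet> (((word_append (W x) (V u) \<boxplus>\<^sub>a xl) \<bullet> dl ?X ?U ?L) \<boxplus>\<^sub>a ((ku \<boxplus>\<^sub>a kl) \<bullet> dl ?K ?U ?L)) \<bullet> dr ?X ?K (?U \<boxplus> ?L)"
    by (subst distribute_both) (use ar in simp_all)
  also have "\<dots> = (idn (Word ?xu) \<boxplus>\<^sub>a sum_append XL (KU @ KL)) \<bullet> alP (Word ?xu) (Sum XL) (Sum (KU @ KL))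
     \<bullet> (((word_append (W x) (V u) \<boxplus>\<^sub>a xl) \<bullet> dl ?X ?U ?L) \<boxplus>\<^sub>a (sum_append KU KL \<bullet> (ku \<boxplus>\<^sub>a kl) \<bullet> dl ?K ?U ?L)) \<bullet> dr ?X ?K (?U \<boxplus> ?L)"
    using plus.al_nat3[of "sum_append KU KL" "Sum (KU @ KL)" "Word ?xu" "Sum XL", THEN reassoc, symmetric] ar by (simp add: plus.tA_merge)
  also have "\<dots> = sum_append (map (\<lambda>w. W x @ w) (map V (u # us))) (word_products (map W ts) (map V (u # us)))
     \<bullet> (distr_left (W x) (map V (u # us)) \<boxplus>\<^sub>a distr (map W ts) (map V (u # us)))
      \<bullet> dr (Word (W x)) (Sum (map W ts)) (Sum (map V (u # us)))"
    by (simp add: sum_append_Cons defs comp_def)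
  finally show ?case .
qed

text \<open>
  Associativity of multiplying out is proved for one, two and three sums in turn; each step uses
  one of the three compatibilities of the distributivities with associativity of the product.
\<close>

lemma distr_right_assoc: "distr_right (map (\<lambda>v. v @ w) k) x \<bullet> (distr_right k w \<boxtimes>\<^sub>a idn (Word x)) = distr_right k (w @ x) \<bullet> (idn (Sum k) \<boxtimes>\<^sub>a word_append w x) \<bullet> alT (Sum k) (Word w) (Word x)"
proof (induction k)
  case Nil
  then show ?case by (simp add: lz_alT[symmetric] reassoc[OF lz_nat])
next
  case (Cons v k)
  let ?w = "Word w" and ?x = "Word x" and ?v = "Word v" and ?K = "Sum k"
  have "distr_right (map (\<lambda>v. v @ w) (v # k)) x \<bullet> (distr_right (v # k) w \<boxtimes>\<^sub>a idn ?x)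
    = ((word_append (v @ w) x \<bullet> (word_append v w \<boxtimes>\<^sub>a idn ?x)) \<boxplus>\<^sub>a (distr_right (map (\<lambda>v. v @ w) k) x \<bullet> (distr_right k w \<boxtimes>\<^sub>a idn ?x)))
     \<bullet> dr (?v \<boxtimes> ?w) (?K \<boxtimes> ?w) ?x \<bullet> (dr ?v ?K ?w \<boxtimes>\<^sub>a idn ?x)"
    by (simp add: times.whisker reassoc[OF dr_nat] plus.tA_merge)
  also have "\<dots> = (word_append v (w @ x) \<boxplus>\<^sub>a distr_right k (w @ x)) \<bullet> ((idn ?v \<boxtimes>\<^sub>a word_append w x) \<boxplus>\<^sub>a (idn ?K \<boxtimes>\<^sub>a word_append w x))
     \<bullet> (alT ?v ?w ?x \<boxplus>\<^sub>a alT ?K ?w ?x) \<bullet> dr (?v \<boxtimes> ?w) (?K \<boxtimes> ?w) ?x \<bullet> (dr ?v ?K ?w \<boxtimes>\<^sub>a idn ?x)"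
    unfolding Cons.IH word_append_assoc by (simp add: plus.tA_merge)
  also have "\<dots> = distr_right (v # k) (w @ x) \<bullet> (idn (Sum (v # k)) \<boxtimes>\<^sub>a word_append w x) \<bullet> alT (Sum (v # k)) ?w ?x"
    unfolding dr_alT using reassoc[OF dr_nat[of "idn ?v" "idn ?K" "word_append w x" ?v ?K "Word (w @ x)"]] by simp
  finally show ?case .
qed

lemma distr_right_distr_assoc: "distr_right (word_products k l) x \<bullet> (distr k l \<boxtimes>\<^sub>a idn (Word x))
   = distr k (map (\<lambda>v. v @ x) l) \<bullet> (idn (Sum k) \<boxtimes>\<^sub>a distr_right l x) \<bullet> alT (Sum k) (Sum l) (Word x)"
proof (induction l)
  case Nil
  then show ?case by (simp add: rz_lz_alT)
next
  case (Cons w l)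
  let ?w = "Word w" and ?x = "Word x" and ?L = "Sum l" and ?K = "Sum k" and ?k = "map (\<lambda>v. v @ w) k"
  have "distr_right (word_products k (w # l)) x \<bullet> (distr k (w # l) \<boxtimes>\<^sub>a idn ?x)
    = sum_append (map (\<lambda>v. v @ x) ?k) (map (\<lambda>v. v @ x) (word_products k l))
       \<bullet> ((distr_right ?k x \<bullet> (distr_right k w \<boxtimes>\<^sub>a idn ?x)) \<boxplus>\<^sub>a (distr_right (word_products k l) x \<bullet> (distr k l \<boxtimes>\<^sub>a idn ?x)))
       \<bullet> dr (?K \<boxtimes> ?w) (?K \<boxtimes> ?L) ?x \<bullet> (dl ?K ?w ?L \<boxtimes>\<^sub>a idn ?x)"
    by (simp add: times.whisker reassoc[OF distr_right_append] reassoc[OF dr_nat] plus.tA_merge del: map_map)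
  also have "\<dots> = sum_append (map (\<lambda>v. v @ w @ x) k) (word_products k (map (\<lambda>v. v @ x) l))
       \<bullet> (distr_right k (w @ x) \<boxplus>\<^sub>a distr k (map (\<lambda>v. v @ x) l)) \<bullet> ((idn ?K \<boxtimes>\<^sub>a word_append w x) \<boxplus>\<^sub>a (idn ?K \<boxtimes>\<^sub>a distr_right l x))
       \<bullet> (alT ?K ?w ?x \<boxplus>\<^sub>a alT ?K ?L ?x) \<bullet> dr (?K \<boxtimes> ?w) (?K \<boxtimes> ?L) ?x \<bullet> (dl ?K ?w ?L \<boxtimes>\<^sub>a idn ?x)"
    unfolding Cons.IH distr_right_assoc by (simp add: plus.tA_merge word_products_map_append comp_def)
  also have "\<dots> = distr k (map (\<lambda>v. v @ x) (w # l)) \<bullet> (idn ?K \<boxtimes>\<^sub>a distr_right (w # l) x) \<bullet> alT ?K (Sum (w # l)) ?x"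
    unfolding dlr_alT by (simp add: times.whisker reassoc[OF dl_nat])
  finally show ?case .
qed

lemma distr_assoc: "distr (word_products k l) m \<bullet> (distr k l \<boxtimes>\<^sub>a idn (Sum m))
   = distr k (word_products l m) \<bullet> (idn (Sum k) \<boxtimes>\<^sub>a distr l m) \<bullet> alT (Sum k) (Sum l) (Sum m)"
proof (induction m)
  case Nil
  then show ?case by (simp add: rz_nat rz_alT)
next
  case (Cons x m)
  let ?x = "Word x" and ?L = "Sum l" and ?K = "Sum k" and ?M = "Sum m" and ?l = "map (\<lambda>v. v @ x) l"
  have "distr (word_products k l) (x # m) \<bullet> (distr k l \<boxtimes>\<^sub>a idn (Sum (x # m)))
    = sum_append (map (\<lambda>v. v @ x) (word_products k l)) (word_products (word_products k l) m)
      \<bullet> ((distr_right (word_products k l) x \<bullet> (distr k l \<boxtimes>\<^sub>a idn ?x)) \<boxplus>\<^sub>a (distr (word_products k l) m \<bullet> (distr k l \<boxtimes>\<^sub>a idn ?M))) \<bullet> dl (?K \<boxtimes> ?L) ?x ?M"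
    using dl_nat[of "distr k l" "idn ?x" "idn ?M" "Sum (word_products k l)" ?x ?M] by (simp add: plus.tA_merge)
  also have "\<dots> = sum_append (word_products k ?l) (word_products k (word_products l m)) \<bullet> (distr k ?l \<boxplus>\<^sub>a distr k (word_products l m)) \<bullet> ((idn ?K \<boxtimes>\<^sub>a distr_right l x) \<boxplus>\<^sub>a (idn ?K \<boxtimes>\<^sub>a distr l m))
      \<bullet> (alT ?K ?L ?x \<boxplus>\<^sub>a alT ?K ?L ?M) \<bullet> dl (?K \<boxtimes> ?L) ?x ?M"
    unfolding Cons.IH distr_right_distr_assoc by (simp add: plus.tA_merge word_products_map_append word_products_assoc)
  also have "\<dots> = sum_append (word_products k ?l) (word_products k (word_products l m)) \<bullet> (distr k ?l \<boxplus>\<^sub>a distr k (word_products l m)) \<bullet> dl ?K (Sum ?l) (Sum (word_products l m))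
      \<bullet> (idn ?K \<boxtimes>\<^sub>a (distr_right l x \<boxplus>\<^sub>a distr l m)) \<bullet> (idn ?K \<boxtimes>\<^sub>a dl ?L ?x ?M) \<bullet> alT ?K ?L (?x \<boxplus> ?M)"
    unfolding dl_alT[symmetric] by (simp add: reassoc[OF dl_nat])
  also have "\<dots> = distr k (word_products l (x # m)) \<bullet> (idn ?K \<boxtimes>\<^sub>a distr l (x # m)) \<bullet> alT ?K ?L (Sum (x # m))"
    by (simp add: times.whisker reassoc[OF distr_append])
  finally show ?case .
qed

lemma distr_left_one: "distr_left [] l = laT (Sum l)"
  by (induction l) (simp_all add: laT_zero word_append_Nil laT_dl)
lemma distr_right_one: "distr_right k [] = rhT (Sum k)"
  by (induction k) (simp_all add: rhT_zero word_append_Nil rhT_dr)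

lemma distr_right: "distr k [w] \<bullet> (idn (Sum k) \<boxtimes>\<^sub>a rhP' (Word w)) = distr_right k w"
proof -
  have "distr k [w] = rhP (Sum (map (\<lambda>v. v @ w) k)) \<bullet> (distr_right k w \<boxplus>\<^sub>a idn zero) \<bullet> (idn (Sum k \<boxtimes> Word w) \<boxplus>\<^sub>a rz (Sum k)) \<bullet> dl (Sum k) (Word w) zero"
    by (simp add: sum_append_Nil_right plus.tA_merge)
  also have "\<dots> = distr_right k w \<bullet> (idn (Sum k) \<boxtimes>\<^sub>a rhP (Word w))"
    by (simp add: plus.unit_push rhP_dl)
  finally show ?thesis by (simp add: times.tA_merge)
qed

lemma distr_left: "distr [v] l \<bullet> (rhP' (Word v) \<boxtimes>\<^sub>a idn (Sum l)) = distr_left v l"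
proof -
  have 1: "pairs [()] l = map (Pair ()) l" "word_products [v] l = map (\<lambda>w. v @ w) l" "word_products [] l = []" for l
    by (induction l) auto
  have "distr [v] l = sum_append (map (\<lambda>w. v @ w) l) [] \<bullet> (distr_left v l \<boxplus>\<^sub>a lz (Sum l)) \<bullet> dr (Word v) zero (Sum l)"
    using distr_Cons[of "()" "[]" "\<lambda>_. v" id l] 1 by (simp add: comp_def)
  also have "\<dots> = rhP (Sum (map (\<lambda>w. v @ w) l)) \<bullet> (distr_left v l \<boxplus>\<^sub>a idn zero) \<bullet> (idn (Word v \<boxtimes> Sum l) \<boxplus>\<^sub>a lz (Sum l)) \<bullet> dr (Word v) zero (Sum l)"
    by (simp add: sum_append_Nil_right plus.tA_merge)
  also have "\<dots> = distr_left v l \<bullet> (rhP (Word v) \<boxtimes>\<^sub>a idn (Sum l))"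
    by (simp add: plus.unit_push rhP_dr)
  finally show ?thesis by (simp add: times.tA_merge)
qed

text \<open>
  By induction on the first summand, split off with \<open>distr_Cons\<close>. Both sides are compared after
  a further reordering, which can be cancelled because reorderings are invertible.
\<close>

lemma distr_append_left:
  assumes "distinct ts" "set ts \<inter> set ts' = {}"
  shows "shuffle (pair_word W V) (pairs (ts @ ts') us) (pairs ts us @ pairs ts' us) \<bullet> distr (map W (ts @ ts')) (map V us)
       \<bullet> (sum_append (map W ts) (map W ts') \<boxtimes>\<^sub>a idn (Sum (map V us)))
    = sum_append (word_products (map W ts) (map V us)) (word_products (map W ts') (map V us)) \<bullet> (distr (map W ts) (map V us) \<boxplus>\<^sub>a distr (map W ts') (map V us))
      \<bullet> dr (Sum (map W ts)) (Sum (map W ts')) (Sum (map V us))"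
  using assms
proof (induction ts)
  case Nil
  let ?M = "distr (map W ts') (map V us)" and ?L = "Sum (map V us)" and ?K = "Sum (map W ts')"
  have "laP (Sum (word_products (map W ts') (map V us))) \<bullet> (lz ?L \<boxplus>\<^sub>a ?M) \<bullet> dr zero ?K ?L
     = laP (Sum (word_products (map W ts') (map V us))) \<bullet> (idn zero \<boxplus>\<^sub>a ?M) \<bullet> (lz ?L \<boxplus>\<^sub>a idn (?K \<boxtimes> ?L)) \<bullet> dr zero ?K ?L"
    by (simp add: plus.tA_merge)
  also have "\<dots> = ?M \<bullet> (laP ?K \<boxtimes>\<^sub>a idn ?L)"
    by (simp add: plus.unit_push laP_dr)
  finally show ?case by (simp add: sum_append_Nil word_products_pairs[symmetric])
next
  case (Cons x ts)
  let ?P = "pair_word W V" and ?L = "Sum (map V us)" and ?X = "Word (W x)"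
  define k k' kl kl' xl where "k = map W ts" and "k' = map W ts'" and "kl = word_products k (map V us)" and "kl' = word_products k' (map V us)"
    and "xl = map (\<lambda>w. W x @ w) (map V us)"
  note defs = this
  let ?a = "pairs (x # ts @ ts') us" and ?b = "pairs (x # ts) us @ pairs ts' us"
    and ?c = "pairs [x] us @ pairs (ts @ ts') us" and ?d = "pairs [x] us @ pairs ts us @ pairs ts' us"
  let ?M = "distr (k @ k') (map V us)" and ?q = "shuffle ?P (pairs (ts @ ts') us) (pairs ts us @ pairs ts' us)"
  have mset_append: "mset (pairs (ts @ ts') us) = mset (pairs ts us @ pairs ts' us)" for ts ts' :: "'b list" and us :: "'c list"
    by (induction us) auto
  have m: "mset ?a = mset ?b" "mset ?a = mset ?c" "mset ?c = mset ?d" "mset ?b = mset ?d"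
    "mset (pairs (ts @ ts') us) = mset (pairs ts us @ pairs ts' us)"
    using mset_append[of ts ts' us] mset_append[of "x # ts" ts' us] mset_pairs_Cons[of x ts us] mset_pairs_Cons[of x "ts @ ts'" us]
    by (simp_all del: pairs_simps)
  have lists: "map ?P (pairs [x] us) = xl" "map ?P (pairs ts us) = kl" "map ?P (pairs ts' us) = kl'"
     "map ?P (pairs (ts @ ts') us) = word_products (k @ k') (map V us)" "map ?P (pairs (x # ts) us) = word_products (W x # k) (map V us)"
    using word_products_pairs[of W "ts @ ts'" V us] word_products_pairs[of W "x # ts" V us] by (simp_all add: defs word_products_pairs map_pairs_single)
  have x: "x \<notin> set ts" "x \<notin> set (ts @ ts')" using Cons.prems by auto
  have IH: "?q \<bullet> ?M \<bullet> (sum_append k k' \<boxtimes>\<^sub>a idn ?L)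
     = sum_append kl kl' \<bullet> (distr k (map V us) \<boxplus>\<^sub>a distr k' (map V us)) \<bullet> dr (Sum k) (Sum k') ?L"
    using Cons.IH Cons.prems by (simp add: defs)
  have 1: "shuffle ?P ?a ?c \<bullet> distr (W x # k @ k') (map V us) = sum_append xl (word_products (k @ k') (map V us)) \<bullet> (distr_left (W x) (map V us) \<boxplus>\<^sub>a ?M)
     \<bullet> dr ?X (Sum (k @ k')) ?L"
    using distr_Cons[OF x(2), of W V us] by (simp add: defs)
  have 2: "shuffle ?P ?c ?d \<bullet> sum_append xl (word_products (k @ k') (map V us)) = sum_append xl (kl @ kl') \<bullet> (idn (Sum xl) \<boxplus>\<^sub>a ?q)"
    using shuffle_sum[OF HOL.refl m(5), of ?P "pairs [x] us"] unfolding lists map_append shuffle_refl .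
  have 3: "shuffle ?P (pairs (x # ts) us) (pairs [x] us @ pairs ts us) \<bullet> distr (W x # k) (map V us) = sum_append xl kl \<bullet> (distr_left (W x) (map V us) \<boxplus>\<^sub>a distr k (map V us))
     \<bullet> dr ?X (Sum k) ?L"
    using distr_Cons[OF x(1), of W V us] by (simp add: defs)
  have 4: "shuffle ?P ?b ?d \<bullet> sum_append (word_products (W x # k) (map V us)) kl'
      = sum_append (xl @ kl) kl' \<bullet> (shuffle ?P (pairs (x # ts) us) (pairs [x] us @ pairs ts us) \<boxplus>\<^sub>a idn (Sum kl'))"
    using shuffle_sum[OF mset_pairs_Cons[of x ts us] HOL.refl, of ?P "pairs ts' us"] unfolding lists map_append shuffle_refl append_assoc .
  have "shuffle ?P ?c ?d \<bullet> shuffle ?P ?a ?c \<bullet> distr (W x # k @ k') (map V us) \<bullet> (sum_append (W x # k) k' \<boxtimes>\<^sub>a idn ?L)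
     = sum_append xl (kl @ kl') \<bullet> (idn (Sum xl) \<boxplus>\<^sub>a ?q) \<bullet> (distr_left (W x) (map V us) \<boxplus>\<^sub>a ?M)
     \<bullet> dr ?X (Sum (k @ k')) ?L \<bullet> ((idn ?X \<boxplus>\<^sub>a sum_append k k') \<boxtimes>\<^sub>a idn ?L) \<bullet> (alP ?X (Sum k) (Sum k') \<boxtimes>\<^sub>a idn ?L)"
    by (simp only: reassoc[OF 1] reassoc[OF 2] sum_append_Cons times.whisker plus.cmp_assoc)
  also have "\<dots> = sum_append xl (kl @ kl') \<bullet> (distr_left (W x) (map V us) \<boxplus>\<^sub>a (?q \<bullet> ?M \<bullet> (sum_append k k' \<boxtimes>\<^sub>a idn ?L)))
     \<bullet> dr ?X (Sum k \<boxplus> Sum k') ?L \<bullet> (alP ?X (Sum k) (Sum k') \<boxtimes>\<^sub>a idn ?L)"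
    by (simp add: reassoc[OF dr_nat] plus.tA_merge defs)
  also have "\<dots> = sum_append xl (kl @ kl') \<bullet> (idn (Sum xl) \<boxplus>\<^sub>a sum_append kl kl') \<bullet> (distr_left (W x) (map V us) \<boxplus>\<^sub>a (distr k (map V us) \<boxplus>\<^sub>a distr k' (map V us)))
     \<bullet> (idn (?X \<boxtimes> ?L) \<boxplus>\<^sub>a dr (Sum k) (Sum k') ?L) \<bullet> dr ?X (Sum k \<boxplus> Sum k') ?L \<bullet> (alP ?X (Sum k) (Sum k') \<boxtimes>\<^sub>a idn ?L)"
    unfolding IH by (simp add: plus.tA_merge defs)
  also have "\<dots> = sum_append xl (kl @ kl') \<bullet> (idn (Sum xl) \<boxplus>\<^sub>a sum_append kl kl') \<bullet> alP (Sum xl) (Sum kl) (Sum kl')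
     \<bullet> ((distr_left (W x) (map V us) \<boxplus>\<^sub>a distr k (map V us)) \<boxplus>\<^sub>a distr k' (map V us))
     \<bullet> (dr ?X (Sum k) ?L \<boxplus>\<^sub>a idn (Sum k' \<boxtimes> ?L)) \<bullet> dr (?X \<boxplus> Sum k) (Sum k') ?L"
    by (simp add: dr_al[symmetric] plus.al_push defs)
  also have "\<dots> = sum_append (xl @ kl) kl' \<bullet> ((sum_append xl kl \<bullet> (distr_left (W x) (map V us) \<boxplus>\<^sub>a distr k (map V us)) \<bullet> dr ?X (Sum k) ?L) \<boxplus>\<^sub>a distr k' (map V us))
      \<bullet> dr (?X \<boxplus> Sum k) (Sum k') ?L"
    by (simp add: reassoc3[OF sum_append_assoc[symmetric]]) (simp add: plus.tA_merge defs)
  also have "\<dots> = shuffle ?P ?b ?d \<bullet> sum_append (word_products (W x # k) (map V us)) kl' \<bullet> (distr (W x # k) (map V us) \<boxplus>\<^sub>a distr k' (map V us)) \<bullet> dr (?X \<boxplus> Sum k) (Sum k') ?L"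
    unfolding 3[symmetric] reassoc[OF 4] by (simp add: plus.tA_merge defs)
  finally have E: "shuffle ?P ?b ?d \<bullet> shuffle ?P ?a ?b \<bullet> distr (W x # k @ k') (map V us) \<bullet> (sum_append (W x # k) k' \<boxtimes>\<^sub>a idn ?L)
     = shuffle ?P ?b ?d \<bullet> sum_append (word_products (W x # k) (map V us)) kl' \<bullet> (distr (W x # k) (map V us) \<boxplus>\<^sub>a distr k' (map V us)) \<bullet> dr (?X \<boxplus> Sum k) (Sum k') ?L"
    using reassoc[OF shuffle_trans[OF m(1,4), of ?P]] reassoc[OF shuffle_trans[OF m(2,3), of ?P]] by simp
  have "shuffle ?P ?a ?b \<bullet> distr (W x # k @ k') (map V us) \<bullet> (sum_append (W x # k) k' \<boxtimes>\<^sub>a idn ?L)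
     = sum_append (word_products (W x # k) (map V us)) kl' \<bullet> (distr (W x # k) (map V us) \<boxplus>\<^sub>a distr k' (map V us)) \<bullet> dr (?X \<boxplus> Sum k) (Sum k') ?L"
    by (rule plus.iso_cancel_left[OF E shuffle_inverse[OF m(4)]])
      (use word_products_pairs[of W "x # ts @ ts'" V us] m(1) in \<open>simp_all add: lists[unfolded defs] defs del: pairs_simps\<close>)
  then show ?case by (simp add: defs)
qed

lemma distr_right_ze:
  assumes "\<And>t. t \<in> set ts \<Longrightarrow> arr (J t) \<and> src (J t) = Word (W t @ v) \<and> tgt (J t) = Word (v @ W t)"
    and "\<And>t. t \<in> set ts \<Longrightarrow> J t \<bullet> word_append (W t) v = word_append v (W t) \<bullet> zeT (Word (W t)) (Word v)"
  shows "par J ts \<bullet> distr_right (map W ts) v = distr_left v (map W ts) \<bullet> zeT (Sum (map W ts)) (Word v)"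
  using assms
proof (induction ts)
  case Nil
  then show ?case by (simp add: rz_zeT)
next
  case (Cons t ts)
  have IH: "par J ts \<bullet> distr_right (map W ts) v = distr_left v (map W ts) \<bullet> zeT (Sum (map W ts)) (Word v)"
    using Cons by auto
  have "par J (t # ts) \<bullet> distr_right (map W (t # ts)) v
     = ((J t \<bullet> word_append (W t) v) \<boxplus>\<^sub>a (par J ts \<bullet> distr_right (map W ts) v)) \<bullet> dr (Word (W t)) (Sum (map W ts)) (Word v)"
    by (simp add: plus.tA_merge)
  also have "\<dots> = (word_append v (W t) \<boxplus>\<^sub>a distr_left v (map W ts)) \<bullet> (zeT (Word (W t)) (Word v) \<boxplus>\<^sub>a zeT (Sum (map W ts)) (Word v)) \<bullet> dr (Word (W t)) (Sum (map W ts)) (Word v)"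
    using IH Cons.prems(2)[of t] by (simp add: plus.tA_merge)
  finally show ?case by (simp add: dl_zeT)
qed

text \<open>
  The braiding exchanges the factor that is expanded first. So \<open>distr\<close> on one side is compared with
  \<open>distr_Cons\<close> on the other, and \<open>J\<close> supplies the braidings of the individual monomials.
\<close>

lemma distr_ze:
  assumes "distinct us"
    and "\<And>t u. t \<in> set ts \<Longrightarrow> u \<in> set us \<Longrightarrow> arr (J (t, u)) \<and> src (J (t, u)) = Word (W t @ V u) \<and> tgt (J (t, u)) = Word (V u @ W t)"
    and "\<And>t u. t \<in> set ts \<Longrightarrow> u \<in> set us \<Longrightarrow> J (t, u) \<bullet> word_append (W t) (V u) = word_append (V u) (W t) \<bullet> zeT (Word (W t)) (Word (V u))"
  shows "shuffle (\<lambda>x. V (snd x) @ W (fst x)) (pairs ts us) (map prod.swap (pairs us ts)) \<bullet> par J (pairs ts us) \<bullet> distr (map W ts) (map V us)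
    = distr (map V us) (map W ts) \<bullet> zeT (Sum (map W ts)) (Sum (map V us))"
  using assms
proof (induction us)
  case Nil
  then show ?case by (simp add: lz_zeT)
next
  case (Cons u us)
  let ?P = "\<lambda>x. V (snd x) @ W (fst x)" and ?s = "map prod.swap" and ?u = "map (\<lambda>t. (t, u)) ts"
  let ?K = "Sum (map W ts)" and ?L = "Sum (map V us)" and ?U = "Word (V u)"
  let ?M = "distr (map W ts) (map V us)" and ?M' = "distr (map V us) (map W ts)"
  have IH: "shuffle ?P (pairs ts us) (?s (pairs us ts)) \<bullet> par J (pairs ts us) \<bullet> ?M = ?M' \<bullet> zeT ?K ?L"
    using Cons by auto
  define uk kl lk where "uk = map (\<lambda>w. V u @ w) (map W ts)" and "kl = word_products (map W ts) (map V us)" and "lk = word_products (map V us) (map W ts)"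
  note defs = this
  have su: "?s (pairs [u] ts) = ?u" by (induction ts) auto
  have m: "mset (pairs (u # us) ts) = mset (pairs [u] ts @ pairs us ts)" by (rule mset_pairs_Cons)
  have lists: "map ?P ?u = uk" "map ?P (?s (pairs us ts)) = lk"
    by (simp_all add: defs word_products_pairs)
  have C: "shuffle ?P (?s (pairs (u # us) ts)) (?u @ ?s (pairs us ts)) \<bullet> distr (map V (u # us)) (map W ts)
     = sum_append uk lk \<bullet> (distr_left (V u) (map W ts) \<boxplus>\<^sub>a ?M') \<bullet> dr ?U ?L ?K"
    using distr_Cons[of u us V W ts] shuffle_map[OF m, of prod.swap ?P] Cons.prems(1) su unfolding defs
    by (simp del: pairs_simps)
  have ms: "mset (?s (pairs (u # us) ts)) = mset (?u @ ?s (pairs us ts))"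
    using mset_map_eq[OF m, of prod.swap] su by (simp del: pairs_simps)
  have R: "par (\<lambda>t. J (t, u)) ts \<bullet> distr_right (map W ts) (V u) = distr_left (V u) (map W ts) \<bullet> zeT ?K ?U"
    by (rule distr_right_ze) (use Cons.prems in auto)
  have L: "par J (?u @ pairs ts us) \<bullet> sum_append (map (\<lambda>t. W t @ V u) ts) kl
     = sum_append uk (map ?P (pairs ts us)) \<bullet> (par (\<lambda>t. J (t, u)) ts \<boxplus>\<^sub>a par J (pairs ts us))"
  proof -
    have "\<And>x. x \<in> set ?u \<union> set (pairs ts us) \<Longrightarrow> arr (J x) \<and> src (J x) = Word (pair_word W V x) \<and> tgt (J x) = Word (?P x)"
      using Cons.prems by auto
    from par_sum[of ?u "pairs ts us" J "pair_word W V" ?P, OF this] show ?thesis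
      unfolding lists by (simp add: defs word_products_pairs comp_def par_map)
  qed
  have S: "shuffle ?P (?u @ pairs ts us) (?u @ ?s (pairs us ts)) \<bullet> sum_append uk (map ?P (pairs ts us))
     = sum_append uk lk \<bullet> (idn (Sum uk) \<boxplus>\<^sub>a shuffle ?P (pairs ts us) (?s (pairs us ts)))"
    using shuffle_sum[OF HOL.refl mset_pairs_swap[of ts us], of ?P ?u] unfolding lists shuffle_refl .
  have j: "arr (par (\<lambda>t. J (t, u)) ts)" "tgt (par (\<lambda>t. J (t, u)) ts) = Sum uk"
    "src (par (\<lambda>t. J (t, u)) ts) = Sum (map (\<lambda>t. W t @ V u) ts)"
    using par_src[of ts "\<lambda>t. J (t, u)" "\<lambda>t. W t @ V u"] par_tgt[of ts "\<lambda>t. J (t, u)" "\<lambda>t. V u @ W t"] Cons.prems by (auto simp: defs comp_def)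
  have "shuffle ?P (?u @ pairs ts us) (?u @ ?s (pairs us ts)) \<bullet> par J (pairs ts (u # us)) \<bullet> distr (map W ts) (map V (u # us))
     = sum_append uk lk \<bullet> (idn (Sum uk) \<boxplus>\<^sub>a shuffle ?P (pairs ts us) (?s (pairs us ts))) \<bullet> (par (\<lambda>t. J (t, u)) ts \<boxplus>\<^sub>a par J (pairs ts us))
       \<bullet> (distr_right (map W ts) (V u) \<boxplus>\<^sub>a ?M) \<bullet> dl ?K ?U ?L"
    using reassoc[OF S] reassoc[OF L] by (simp add: comp_def defs)
  also have "\<dots> = sum_append uk lk \<bullet> ((par (\<lambda>t. J (t, u)) ts \<bullet> distr_right (map W ts) (V u)) \<boxplus>\<^sub>a (shuffle ?P (pairs ts us) (?s (pairs us ts)) \<bullet> par J (pairs ts us) \<bullet> ?M)) \<bullet> dl ?K ?U ?L"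
    using j by (simp add: plus.tA_merge comp_def)
  also have "\<dots> = sum_append uk lk \<bullet> (distr_left (V u) (map W ts) \<boxplus>\<^sub>a ?M') \<bullet> dr ?U ?L ?K \<bullet> zeT ?K (?U \<boxplus> ?L)"
    unfolding R IH dr_zeT by (simp add: plus.tA_merge)
  also have "\<dots> = shuffle ?P (?s (pairs (u # us) ts)) (?u @ ?s (pairs us ts)) \<bullet> distr (map V (u # us)) (map W ts) \<bullet> zeT ?K (Sum (map V (u # us)))"
    by (simp add: reassoc[OF C, simplified])
  finally have E: "shuffle ?P (?s (pairs (u # us) ts)) (?u @ ?s (pairs us ts)) \<bullet> shuffle ?P (pairs ts (u # us)) (?s (pairs (u # us) ts))
        \<bullet> par J (pairs ts (u # us)) \<bullet> distr (map W ts) (map V (u # us))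
     = shuffle ?P (?s (pairs (u # us) ts)) (?u @ ?s (pairs us ts)) \<bullet> distr (map V (u # us)) (map W ts) \<bullet> zeT ?K (Sum (map V (u # us)))"
    using reassoc[OF shuffle_trans[OF mset_pairs_swap[of ts "u # us"] ms, of ?P]] by simp
  have t: "src (par J (pairs ts (u # us))) = Sum (word_products (map W ts) (map V (u # us)))"
    "tgt (par J (pairs ts (u # us))) = Sum (map ?P (pairs ts (u # us)))" "arr (par J (pairs ts (u # us)))"
    using par_src[of "pairs ts (u # us)" J "pair_word W V"] par_tgt[of "pairs ts (u # us)" J ?P] Cons.prems
    unfolding word_products_pairs by (auto simp del: pairs_simps)
  have g: "word_products (map V (u # us)) (map W ts) = map ?P (?s (pairs (u # us) ts))"
    by (simp add: word_products_pairs del: pairs_simps list.map)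
  show ?case
    by (rule plus.iso_cancel_left[OF E shuffle_inverse[OF ms]])
      (use t g mset_pairs_swap[of ts "u # us"] in \<open>simp_all del: pairs_simps list.map word_products.simps distr.simps par_simps\<close>)
qed

end

section \<open>Braid classes and matched positions\<close>

abbreviation braid_class :: "nat \<Rightarrow> (nat \<times> bool) list \<Rightarrow> braid" where
  "braid_class n w \<equiv> braid_rel n `` {w}"

lemma braid_class_eq_iff: "v \<in> braid_words n \<Longrightarrow> w \<in> braid_words n \<Longrightarrow> braid_class n v = braid_class n w \<longleftrightarrow> (v, w) \<in> braid_rel n"
  by (auto intro: braid_rel.intros)

lemma braid_rel_cong2: "(v, v') \<in> braid_rel n \<Longrightarrow> (w, w') \<in> braid_rel n \<Longrightarrow> (v @ w, v' @ w') \<in> braid_rel n"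
  using braid_rel.cong[of v v' n "[]" w] braid_rel.cong[of w w' n v' "[]"]
  by (auto intro: braid_rel.trans dest!: braid_rel_words)

lemma braid_class_mult: "v \<in> braid_words n \<Longrightarrow> w \<in> braid_words n \<Longrightarrow>
    braid_class n v \<otimes>\<^bsub>braid_group n\<^esub> braid_class n w = braid_class n (v @ w)"
  unfolding braid_group_def
  by (auto intro: braid_rel.refl braid_rel.trans braid_rel_cong2 braid_rel.sym)

lemma braid_class_one: "one (braid_group n) = braid_class n []"
  by (simp add: braid_group_def)

lemma braid_class_carrier: "\<beta> \<in> carrier (braid_group n) \<longleftrightarrow> (\<exists>w \<in> braid_words n. \<beta> = braid_class n w)"
  by (auto simp: braid_group_def quotient_def)

definition inverse_word :: "(nat \<times> bool) list \<Rightarrow> (nat \<times> bool) list" where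
  "inverse_word w = rev (map (\<lambda>(i, b). (i, \<not> b)) w)"

lemma inverse_word_words [simp]: "inverse_word w \<in> braid_words n \<longleftrightarrow> w \<in> braid_words n"
  by (induction w) (auto simp: inverse_word_def braid_words_Cons)

lemma inverse_word_left: "w \<in> braid_words n \<Longrightarrow> (inverse_word w @ w, []) \<in> braid_rel n"
proof (induction w)
  case (Cons x w)
  obtain i b where x: "x = (i, b)" by fastforce
  have "(inverse_word w @ [(i, \<not> b), (i, b)] @ w, inverse_word w @ [] @ w) \<in> braid_rel n"
    using Cons.prems x braid_rel.cancel[of i n "\<not> b"] by (intro braid_rel.cong) (auto simp: braid_words_Cons)
  moreover have "inverse_word (x # w) @ x # w = inverse_word w @ [(i, \<not> b), (i, b)] @ w" by (simp add: inverse_word_def x)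
  ultimately show ?case using Cons by (auto simp: braid_words_Cons intro: braid_rel.trans)
qed (simp add: inverse_word_def braid_rel.refl)

lemma inverse_word_inverse_word [simp]: "inverse_word (inverse_word w) = w"
  by (simp add: inverse_word_def rev_map comp_def case_prod_beta)

lemma inverse_word_right: "w \<in> braid_words n \<Longrightarrow> (w @ inverse_word w, []) \<in> braid_rel n"
  using inverse_word_left[of "inverse_word w" n] by simp

lemma words_mono: "w \<in> braid_words p \<Longrightarrow> w \<in> braid_words (p + q)"
  by (induction w) (auto simp: braid_words_Cons)

lemma braid_rel_mono: "(v, w) \<in> braid_rel p \<Longrightarrow> (v, w) \<in> braid_rel (p + q)"
proof (induction rule: braid_rel.induct)
  case (trans v w x)
  show ?case by (rule braid_rel.trans[OF trans(3,4)])
next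
  case (cong v w x y)
  then show ?case by (intro braid_rel.cong words_mono)
qed (auto intro: braid_rel.intros words_mono)

lemma shift_append: "shift p (v @ w) = shift p v @ shift p w"
  by (simp add: shift_def)
lemma shift_words: "w \<in> braid_words q \<Longrightarrow> shift p w \<in> braid_words (p + q)"
  by (induction w) (auto simp: braid_words_Cons shift_def)

lemma braid_rel_shift: "(v, w) \<in> braid_rel q \<Longrightarrow> (shift p v, shift p w) \<in> braid_rel (p + q)"
proof (induction rule: braid_rel.induct)
  case (cong v w x y)
  then show ?case by (simp add: shift_append shift_words braid_rel.cong)
next
  case (cancel i b)
  then show ?case using braid_rel.cancel[of "p + i" "p + q" b] by (simp add: shift_def)
next
  case (far i j)
  then show ?case using braid_rel.far[of "p + i" "p + j" "p + q"] by (simp add: shift_def)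
next
  case (braid i)
  then show ?case using braid_rel.braid[of "p + i" "p + q"] by (simp add: shift_def)
qed (auto intro: braid_rel.intros shift_words)

lemma braid_juxt_braid_class:
  assumes "v \<in> braid_words p" "w \<in> braid_words q"
  shows "braid_juxt p q (braid_class p v) (braid_class q w) = braid_class (p + q) (v @ shift p w)"
proof -
  have *: "(v @ shift p w, v' @ shift p w') \<in> braid_rel (p + q)" if "(v, v') \<in> braid_rel p" "(w, w') \<in> braid_rel q" for v' w'
    by (rule braid_rel_cong2[OF braid_rel_mono[OF that(1)] braid_rel_shift[OF that(2)]])
  have r: "(v, v) \<in> braid_rel p" "(w, w) \<in> braid_rel q" using assms by (auto intro: braid_rel.refl)
  show ?thesis
    unfolding braid_juxt_def shift_def[symmetric] using * r by (auto intro: braid_rel.trans)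
qed

text \<open>
  \<open>\<sigma>\<close> sends the position of each tag in \<open>ts\<close> to its position in \<open>us\<close>. This links the permutations
  of the distortion category to pairs of orderings.
\<close>

definition match :: "(nat \<Rightarrow> nat) \<Rightarrow> 't list \<Rightarrow> 't list \<Rightarrow> bool" where
  "match \<sigma> ts us \<longleftrightarrow> distinct ts \<and> mset ts = mset us \<and> (\<forall>i < length ts. \<sigma> i < length ts \<and> us ! \<sigma> i = ts ! i) \<and> (\<forall>i \<ge> length ts. \<sigma> i = i)"

lemma match_length: "match \<sigma> ts us \<Longrightarrow> length us = length ts"
  by (metis match_def size_mset)

lemma match_distinct: "match \<sigma> ts us \<Longrightarrow> distinct us"
  by (metis match_def mset_eq_imp_distinct_iff)

lemma match_permutes:
  assumes "match \<sigma> ts us"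
  shows "\<sigma> permutes {..<length ts}"
proof -
  have "inj_on \<sigma> {..<length ts}"
    using assms unfolding match_def inj_on_def by (metis lessThan_iff nth_eq_iff_index_eq)
  moreover have "\<sigma> ` {..<length ts} \<subseteq> {..<length ts}" using assms by (auto simp: match_def)
  ultimately have "bij_betw \<sigma> {..<length ts} {..<length ts}"
    by (simp add: bij_betw_def endo_inj_surj)
  then show ?thesis using assms by (intro bij_imp_permutes) (auto simp: match_def)
qed

lemma match_comp:
  assumes "match \<sigma> ts us" "match \<tau> us vs"
  shows "match (\<tau> \<circ> \<sigma>) ts vs"
  using assms match_length[OF assms(1)] by (auto simp: match_def)

lemma match_map:
  assumes "match \<sigma> ts us" "inj_on h (set ts)"
  shows "match \<sigma> (map h ts) (map h us)"
  using assms match_length[OF assms(1)] by (auto simp: match_def distinct_map)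

lemma match_relabel:
  assumes "match \<sigma> ts us" "match \<sigma> ts' us'" "length ts = length ts'"
  obtains h where "ts' = map h ts" "us' = map h us" "inj_on h (set ts)"
proof -
  have d: "distinct ts" "distinct ts'" using assms by (auto simp: match_def)
  define h where "h = (\<lambda>t. the (map_of (zip ts ts') t))"
  have h: "ts' = map h ts"
    by (rule nth_equalityI) (use assms d in \<open>auto simp: h_def map_of_zip_nth\<close>)
  have inj: "inj_on h (set ts)" using d unfolding h by (simp add: distinct_map)
  have "us' ! j = h (us ! j)" if "j < length ts" for j
  proof -
    have "j \<in> \<sigma> ` {..<length ts}"
      using that by (simp add: permutes_image[OF match_permutes[OF assms(1)]])
    then obtain i where i: "i < length ts" "j = \<sigma> i" by auto
    have "us' ! j = ts' ! i" "us ! j = ts ! i"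
      using assms i by (auto simp: match_def)
    moreover have "ts' ! i = h (ts ! i)" unfolding h using i by simp
    ultimately show ?thesis by simp
  qed
  then have "us' = map h us"
    using match_length[OF assms(1)] match_length[OF assms(2)] assms(3) by (intro nth_equalityI) auto
  then show ?thesis using that h inj by blast
qed

lemma match_exists:
  assumes "match \<sigma> ts us" "distinct ts'" "length ts' = length ts"
  obtains h where "ts' = map h ts" "inj_on h (set ts)"
proof -
  have d: "distinct ts" using assms by (auto simp: match_def)
  define h where "h = (\<lambda>t. the (map_of (zip ts ts') t))"
  have h: "ts' = map h ts"
    by (rule nth_equalityI) (use assms d in \<open>auto simp: h_def map_of_zip_nth\<close>)
  then show ?thesis using that d assms by (auto simp: distinct_map)
qed

lemma match_inverse:
  assumes "match \<sigma> ts us"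
  shows "match (inv_into UNIV \<sigma>) us ts"
proof -
  have p: "\<sigma> permutes {..<length ts}" by (rule match_permutes[OF assms])
  have l: "length us = length ts" by (rule match_length[OF assms])
  have "inv_into UNIV \<sigma> i < length ts \<and> ts ! inv_into UNIV \<sigma> i = us ! i" if "i < length ts" for i
  proof -
    have "inv_into UNIV \<sigma> i < length ts" using permutes_in_image[OF permutes_inv[OF p]] that by blast
    then show ?thesis using assms permutes_inverses[OF p] by (metis match_def)
  qed
  moreover have "inv_into UNIV \<sigma> i = i" if "i \<ge> length ts" for i
    using permutes_not_in[OF permutes_inv[OF p]] that by auto
  ultimately show ?thesis using assms l match_distinct[OF assms] by (auto simp: match_def)
qed

lemma pairs_conv: "pairs ts us = map (\<lambda>k. (ts ! (k mod length ts), us ! (k div length ts))) [0..<length ts * length us]"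
proof (induction us)
  case (Cons u us)
  let ?m = "length ts"
  have "[0..<?m * length (u # us)] = [0..<?m] @ map (\<lambda>k. k + ?m) [0..<?m * length us]"
    using map_add_upt[of ?m "?m * length us"] upt_add_eq_append[of 0 ?m "?m * length us"] by (simp add: add.commute)
  moreover have "map (\<lambda>k. (ts ! (k mod ?m), (u # us) ! (k div ?m))) [0..<?m] = map (\<lambda>t. (t, u)) ts"
    by (rule nth_equalityI) auto
  moreover have "map (\<lambda>k. (ts ! (k mod ?m), (u # us) ! (k div ?m))) (map (\<lambda>k. k + ?m) [0..<?m * length us]) = pairs ts us"
    unfolding Cons by (cases "ts = []") (auto simp: div_add_self2)
  ultimately show ?case by simp
qed simp

lemma length_pairs [simp]: "length (pairs ts us) = length ts * length us"
  by (simp add: pairs_conv)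

lemma nth_pairs: "k < length ts * length us \<Longrightarrow> pairs ts us ! k = (ts ! (k mod length ts), us ! (k div length ts))"
  by (simp add: pairs_conv)

lemma index_bounds: "k < m * n \<Longrightarrow> k mod m < (m::nat)" "k < m * n \<Longrightarrow> k div m < (n::nat)"
  by (auto simp: less_mult_imp_div_less mult.commute) (metis gr_zeroI mod_less_divisor mult_0 not_less0)

lemma index_pair: "i < (m::nat) \<Longrightarrow> j < n \<Longrightarrow> i + j * m < m * n" "i < m \<Longrightarrow> (i + j * m) mod m = i" "i < m \<Longrightarrow> (i + j * m) div m = j"
proof -
  assume "i < m" "j < n"
  then have "i + j * m < (j + 1) * m" by simp
  also have "\<dots> \<le> n * m" using \<open>j < n\<close> by (intro mult_right_mono) auto
  finally show "i + j * m < m * n" by (simp add: mult.commute)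
qed simp_all

lemma distinct_pairs: "distinct ts \<Longrightarrow> distinct us \<Longrightarrow> distinct (pairs ts us)"
  by (induction us) (auto simp: distinct_map inj_on_def)

lemma match_prod:
  assumes "match \<sigma> ts ts'" "match \<tau> us us'"
  shows "match (\<lambda>k. if k < length ts * length us then \<sigma> (k mod length ts) + \<tau> (k div length ts) * length ts else k)
     (pairs ts us) (pairs ts' us')"
proof -
  have l: "length ts' = length ts" "length us' = length us" using assms match_length by blast+
  have "mset (pairs ts us) = mset (pairs ts' us')"
    using mset_pairs_left[of ts ts' us] mset_pairs_right[of us us' ts'] assms by (simp add: match_def)
  moreover have "\<sigma> (k mod length ts) + \<tau> (k div length ts) * length ts < length ts * length us
     \<and> pairs ts' us' ! (\<sigma> (k mod length ts) + \<tau> (k div length ts) * length ts) = pairs ts us ! k"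
    if k: "k < length ts * length us" for k
  proof -
    note b = index_bounds[OF k]
    have s: "\<sigma> (k mod length ts) < length ts" "\<tau> (k div length ts) < length us"
      using assms b by (auto simp: match_def)
    show ?thesis
      using assms b l index_pair(1)[OF s] index_pair(2,3)[OF s(1)] s k by (simp add: nth_pairs index_pair match_def)
  qed
  ultimately show ?thesis
    using assms by (auto simp: match_def distinct_pairs)
qed

context total_bimonoidal
begin

section \<open>Arrows realizing distortion morphisms\<close>

text \<open>
  Here \<open>ts\<close> and \<open>us\<close> list the tags in the order of the source and of the target, \<open>W t\<close> is the monomial with
  tag \<open>t\<close> and \<open>G t\<close> is a word for the braid that acts on it.
\<close>

definition represents :: "dist_mor \<Rightarrow> 't list \<Rightarrow> 't list \<Rightarrow> ('t \<Rightarrow> 'v list) \<Rightarrow> ('t \<Rightarrow> (nat \<times> bool) list) \<Rightarrow> bool" where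
  "represents f ts us W G \<longleftrightarrow> match (dperm f) ts us \<and> (\<forall>t \<in> set ts. G t \<in> braid_words (length (W t))) \<and>
     dsrc f = map (\<lambda>t. length (W t)) ts \<and> dtgt f = map (\<lambda>t. length (W t)) us \<and>
     dbraids f = map (\<lambda>t. braid_class (length (W t)) (G t)) ts"

abbreviation act where "act W G t \<equiv> word_act (G t) (W t)"

definition realize :: "'t list \<Rightarrow> 't list \<Rightarrow> ('t \<Rightarrow> 'v list) \<Rightarrow> ('t \<Rightarrow> (nat \<times> bool) list) \<Rightarrow> 'a" where
  "realize ts us W G = shuffle (act W G) ts us \<bullet> par (\<lambda>t. times.braid (G t) (W t) one) ts"

text \<open>
  \<open>\<phi>\<close> is the arrow by which the distortion morphism \<open>f\<close> acts on the sum of the monomials \<open>k\<close>. The type of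
  tags has to be fixed here; \<open>TrackI\<close> accepts tags of any type.
\<close>

definition Track :: "dist_mor \<Rightarrow> 'v list list \<Rightarrow> 'v list list \<Rightarrow> 'a \<Rightarrow> bool" where
  "Track f k k' \<phi> \<longleftrightarrow> (\<exists>(ts :: nat list) us W G. represents f ts us W G \<and> k = map W ts \<and> k' = map (act W G) us \<and> \<phi> = realize ts us W G)"

lemma par_braid_src: "src (par (\<lambda>t. times.braid (G t) (W t) one) ts) = Sum (map W ts)"
  and par_braid_tgt: "tgt (par (\<lambda>t. times.braid (G t) (W t) one) ts) = Sum (map (act W G) ts)"
  using par_src[of ts "\<lambda>t. times.braid (G t) (W t) one" W] par_tgt[of ts "\<lambda>t. times.braid (G t) (W t) one" "act W G"] by auto

lemma realize_arr:
  assumes "mset ts = mset us"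
  shows "arr (realize ts us W G)" "src (realize ts us W G) = Sum (map W ts)" "tgt (realize ts us W G) = Sum (map (act W G) us)"
  using assms by (simp_all add: realize_def par_braid_src par_braid_tgt)

text \<open>
  Independence of the tags is invariance of \<open>shuffle\<close> under renaming, independence of the words that
  stand for the braids is \<open>braid_respects\<close>.
\<close>

lemma represents_relabel:
  assumes "represents f ts us W G" "represents f ts' us' W' G'" "map W ts = map W' ts'"
  shows "map (act W G) us = map (act W' G') us'" "realize ts us W G = realize ts' us' W' G'"
proof -
  have "length ts = length ts'" using assms(3) map_eq_imp_length_eq by blast
  then obtain h where h: "ts' = map h ts" "us' = map h us" "inj_on h (set ts)"
    using match_relabel assms(1,2) unfolding represents_def by metis
  have W: "W t = W' (h t)" if "t \<in> set ts" for t using assms(3) that by (simp add: h)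
  have "map (\<lambda>t. braid_class (length (W t)) (G t)) ts = map (\<lambda>t. braid_class (length (W' t)) (G' t)) ts'"
    using assms(1,2) unfolding represents_def by metis
  then have "braid_class (length (W t)) (G t) = braid_class (length (W t)) (G' (h t))" if "t \<in> set ts" for t
    using that W by (simp add: h)
  moreover have "G t \<in> braid_words (length (W t))" "G' (h t) \<in> braid_words (length (W t))" if "t \<in> set ts" for t
    using assms(1,2) that W by (auto simp: represents_def h)
  ultimately have "(G t, G' (h t)) \<in> braid_rel (length (W t))" if "t \<in> set ts" for t
    using that braid_class_eq_iff by blast
  then have G: "act W G t = act W' G' (h t)" "times.braid (G t) (W t) one = times.braid (G' (h t)) (W' (h t)) one" if "t \<in> set ts" for t
    using that times.braid_respects W by fastforce+
  have m: "mset ts = mset us" using assms(1) by (simp add: represents_def match_def)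
  then have s: "set us = set ts" by (metis mset_eq_setD)
  show "map (act W G) us = map (act W' G') us'" using G s by (simp add: h)
  show "realize ts us W G = realize ts' us' W' G'"
    unfolding realize_def h par_map shuffle_map[OF m h(3)]
    using shuffle_cong[OF m, of "act W G" "\<lambda>t. act W' G' (h t)"] G by (auto cong: par_cong)
qed

lemma represents_exists:
  assumes "represents f ts us W G" "distinct ts'" "length ts' = length ts"
  obtains us' W' G' where "represents f ts' us' W' G'" "map W' ts' = map W ts"
proof -
  obtain h where h: "ts' = map h ts" "inj_on h (set ts)"
    using match_exists assms unfolding represents_def by metis
  let ?g = "inv_into (set ts) h"
  have g: "?g (h t) = t" if "t \<in> set ts" for t using h that by (simp add: inv_into_f_f)
  have m: "match (dperm f) ts us" using assms(1) by (simp add: represents_def)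
  then have s: "set us = set ts" by (metis match_def mset_eq_setD)
  have "represents f ts' (map h us) (\<lambda>t. W (?g t)) (\<lambda>t. G (?g t))"
    unfolding represents_def h using assms(1) g s match_map[OF m h(2)] by (auto simp: represents_def)
  moreover have "map (\<lambda>t. W (?g t)) ts' = map W ts" using g by (simp add: h)
  ultimately show ?thesis using that by blast
qed

lemma TrackI:
  assumes "represents f ts us W G" "k = map W ts" "k' = map (act W G) us"
  shows "Track f k k' (realize ts us W G)"
proof -
  obtain us' W' G' where r: "represents f [0..<length ts] us' W' G'" "map W' [0..<length ts] = map W ts"
    using represents_exists[OF assms(1), of "[0..<length ts]"] by auto
  show ?thesis
    unfolding Track_def using r represents_relabel[OF assms(1) r(1)] assms by metis
qed

lemma TrackE:
  assumes "Track f k k' \<phi>" "distinct (ts :: nat list)" "length ts = length k"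
  obtains us W G where "represents f ts us W G" "k = map W ts" "k' = map (act W G) us" "\<phi> = realize ts us W G"
proof -
  obtain ts' us' W' G' where r: "represents f (ts' :: nat list) us' W' G'" "k = map W' ts'" "k' = map (act W' G') us'" "\<phi> = realize ts' us' W' G'"
    using assms(1) unfolding Track_def by blast
  then obtain us W G where "represents f ts us W G" "map W ts = map W' ts'"
    using represents_exists[OF r(1) assms(2)] assms(3) by auto
  then show ?thesis using that r represents_relabel[OF r(1)] by metis
qed

lemma TrackE':
  assumes "Track f k k' \<phi>"
  obtains ts us :: "nat list" and W G where "represents f ts us W G" "k = map W ts" "k' = map (act W G) us" "\<phi> = realize ts us W G"
  using assms unfolding Track_def by blast

lemma Track_unique:
  assumes "Track f k k' \<phi>" "Track f k k'' \<psi>"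
  shows "\<phi> = \<psi>"
proof -
  obtain ts us W G where "represents f (ts :: nat list) us W G" "k = map W ts" "\<phi> = realize ts us W G"
    using assms(1) unfolding Track_def by blast
  moreover obtain ts' us' W' G' where "represents f (ts' :: nat list) us' W' G'" "k = map W' ts'" "\<psi> = realize ts' us' W' G'"
    using assms(2) unfolding Track_def by blast
  ultimately show ?thesis using represents_relabel(2) by metis
qed

lemma Track_arr:
  assumes "Track f k k' \<phi>"
  shows "arr \<phi>" "src \<phi> = Sum k" "tgt \<phi> = Sum k'" "dsrc f = map length k" "dtgt f = map length k'"
  using assms by (auto simp: Track_def represents_def match_def realize_arr)

end

lemma match_refl: "distinct ts \<Longrightarrow> match id ts ts"
  by (auto simp: match_def)

lemma match_sum:
  assumes "match \<sigma> ts ts'" "match \<tau> us us'" "set ts \<inter> set us = {}"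
  shows "match (\<lambda>k. if k < length ts then \<sigma> k else if k < length ts + length us then length ts + \<tau> (k - length ts) else k)
     (ts @ us) (ts' @ us')"
  using assms match_length[OF assms(1)] match_length[OF assms(2)] by (auto simp: match_def nth_append)

lemma match_swap:
  assumes "distinct ts" "distinct us" "set ts \<inter> set us = {}"
  shows "match (\<lambda>k. if k < length ts then length us + k else if k < length ts + length us then k - length ts else k) (ts @ us) (us @ ts)"
  using assms by (auto simp: match_def nth_append)

lemma match_braiding:
  assumes "distinct ts" "distinct us"
  shows "match (\<lambda>k. if k < length ts * length us then k div length ts + (k mod length ts) * length us else k)
     (pairs ts us) (map prod.swap (pairs us ts))"
proof -
  have "k div length ts + (k mod length ts) * length us < length ts * length us
     \<and> map prod.swap (pairs us ts) ! (k div length ts + (k mod length ts) * length us) = pairs ts us ! k"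
    if k: "k < length ts * length us" for k
  proof -
    note b = index_bounds[OF k]
    have l: "k div length ts + (k mod length ts) * length us < length us * length ts"
      using index_pair(1)[OF b(2) b(1)] .
    then have "k div length ts + (k mod length ts) * length us < length ts * length us"
      by (simp only: mult.commute[of "length us"])
    moreover have "map prod.swap (pairs us ts) ! (k div length ts + (k mod length ts) * length us) = pairs ts us ! k"
      using l k index_pair(2,3)[OF b(2), of "k mod length ts"] by (simp add: nth_pairs)
    ultimately show ?thesis ..
  qed
  then show ?thesis
    unfolding match_def using assms mset_pairs_swap[of ts us] by (simp add: distinct_pairs)
qed

lemma match_deltaR:
  assumes "distinct (ts @ ts')" "distinct us"
  shows "match (\<lambda>k. if k < (length ts + length ts') * length us
            then let i = k mod (length ts + length ts'); j = k div (length ts + length ts')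
                 in if i < length ts then i + j * length ts else length ts * length us + ((i - length ts) + j * length ts')
            else k)
     (pairs (ts @ ts') us) (pairs ts us @ pairs ts' us)" (is "match ?f _ _")
proof -
  let ?m = "length ts" and ?n = "length ts'" and ?p = "length us"
  have m: "mset (pairs (ts @ ts') us) = mset (pairs ts us @ pairs ts' us)"
    by (induction us) auto
  have "?f k < (?m + ?n) * ?p \<and> (pairs ts us @ pairs ts' us) ! ?f k = pairs (ts @ ts') us ! k" if k: "k < (?m + ?n) * ?p" for k
  proof -
    define i j where "i = k mod (?m + ?n)" and "j = k div (?m + ?n)"
    have b: "i < ?m + ?n" "j < ?p" using index_bounds[OF k] by (auto simp: i_def j_def)
    have n: "pairs (ts @ ts') us ! k = ((ts @ ts') ! i, us ! j)"
      using k by (simp add: nth_pairs i_def j_def)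
    show ?thesis
    proof (cases "i < ?m")
      case True
      then have "?f k = i + j * ?m" using k by (simp add: i_def j_def)
      moreover have "i + j * ?m < ?m * ?p" using index_pair(1)[OF True b(2)] .
      ultimately show ?thesis
        unfolding n using True index_pair(2,3)[OF True] by (simp add: nth_append nth_pairs add_mult_distrib trans_less_add1)
    next
      case False
      then obtain q where q: "i = ?m + q" by (metis linorder_not_less le_Suc_ex)
      then have "?f k = ?m * ?p + (q + j * ?n)" using k by (simp add: i_def[symmetric] j_def[symmetric])
      moreover have i: "q < ?n" using b q by auto
      moreover have "q + j * ?n < ?n * ?p" using index_pair(1)[OF i b(2)] .
      ultimately show ?thesis
        unfolding n using index_pair(2,3)[OF i] by (simp add: q nth_append nth_pairs add_mult_distrib)
    qed
  qed
  then show ?thesis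
    unfolding match_def using assms m by (auto simp: distinct_pairs simp del: mset_append)
qed

lemma dist_prod_obj_pairs:
  "dist_prod_obj (map f ts) (map g us) = map (\<lambda>x. f (fst x) + g (snd x)) (pairs ts us)"
  unfolding dist_prod_obj_def pairs_conv
  by (auto simp: Let_def index_bounds)

context total_bimonoidal
begin

lemma represents_reorder:
  assumes "match \<sigma> ts us"
  shows "represents (dist_reorder (map (\<lambda>t. length (W t)) ts) (map (\<lambda>t. length (W t)) us) \<sigma>) ts us W (\<lambda>_. [])"
  using assms by (simp add: represents_def dist_reorder_def braid_class_one)

lemma realize_Nil: "mset ts = mset us \<Longrightarrow> realize ts us W (\<lambda>_. []) = shuffle W ts us"
  by (simp add: realize_def par_idn)

lemma realize_cong:
  assumes "mset ts = mset us" "\<And>t. t \<in> set ts \<Longrightarrow> V t = W t" "\<And>t. t \<in> set ts \<Longrightarrow> H t = G t"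
  shows "realize ts us V H = realize ts us W G"
proof -
  have "shuffle (act V H) ts us = shuffle (act W G) ts us"
    by (rule shuffle_cong[OF assms(1)]) (simp add: assms)
  moreover have "par (\<lambda>t. times.braid (H t) (V t) one) ts = par (\<lambda>t. times.braid (G t) (W t) one) ts"
    by (rule par_cong) (simp add: assms)
  ultimately show ?thesis by (simp add: realize_def)
qed

lemma Track_reorder:
  assumes "match \<sigma> ts us"
  shows "Track (dist_reorder (map (\<lambda>t. length (W t)) ts) (map (\<lambda>t. length (W t)) us) \<sigma>) (map W ts) (map W us) (shuffle W ts us)"
proof -
  have "mset ts = mset us" using assms by (simp add: match_def)
  then show ?thesis
    using TrackI[OF represents_reorder[OF assms, of W]] realize_Nil[of ts us W] by simp
qed

lemma Track_id: "Track (dist_id (map length k)) k k (idn (Sum k))"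
proof -
  let ?t = "[0..<length k]"
  have 1: "map (\<lambda>t. length (k ! t)) ?t = map length k" by (rule nth_equalityI) auto
  have "Track (dist_reorder (map (\<lambda>t. length (k ! t)) ?t) (map (\<lambda>t. length (k ! t)) ?t) id) (map ((!) k) ?t) (map ((!) k) ?t) (shuffle ((!) k) ?t ?t)"
    by (rule Track_reorder[OF match_refl]) simp
  then show ?thesis by (simp only: 1 map_nth shuffle_refl dist_id_def)
qed

lemma Track_comp:
  assumes "Track f k k' \<phi>" "Track g k' k'' \<psi>"
  shows "Track (dist_comp g f) k k'' (\<psi> \<bullet> \<phi>)"
proof -
  obtain ts us W G where f: "represents f (ts :: nat list) us W G" "k = map W ts" "k' = map (act W G) us" "\<phi> = realize ts us W G"
    by (rule TrackE'[OF assms(1)])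
  have mf: "match (dperm f) ts us" "distinct us" "length us = length ts" "mset ts = mset us"
    using f(1) match_distinct[of "dperm f" ts us] match_length[of "dperm f" ts us] by (simp_all add: represents_def match_def)
  obtain vs V H where g: "represents g us vs V H" "k' = map V us" "k'' = map (act V H) vs" "\<psi> = realize us vs V H"
    by (rule TrackE[OF assms(2) mf(2)]) (simp add: f(3))
  have mg: "match (dperm g) us vs" "mset us = mset vs" using g(1) by (auto simp: represents_def match_def)
  have s: "set us = set ts" "set vs = set ts" using mf(4) mg(2) mset_eq_setD by blast+
  have V: "V t = act W G t" if "t \<in> set ts" for t
    using map_eq_conv[of V us "act W G"] HOL.trans[OF g(2)[symmetric] f(3)] s(1) that by blast
  let ?J = "\<lambda>t. H t @ G t"
  have "dbraids g ! dperm f i \<otimes>\<^bsub>braid_group (dsrc f ! i)\<^esub> dbraids f ! i = braid_class (length (W (ts ! i))) (?J (ts ! i))"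
    if "i < length ts" for i
  proof -
    have p: "dperm f i < length ts" "us ! dperm f i = ts ! i" using mf(1) that by (auto simp: match_def)
    have t: "ts ! i \<in> set ts" using that by simp
    have "dbraids g ! dperm f i = braid_class (length (W (ts ! i))) (H (ts ! i))"
      using g(1) p mf(3) V[OF t] by (simp add: represents_def)
    moreover have "dbraids f ! i = braid_class (length (W (ts ! i))) (G (ts ! i))" "dsrc f ! i = length (W (ts ! i))"
      using f(1) that by (simp_all add: represents_def)
    moreover have "G (ts ! i) \<in> braid_words (length (W (ts ! i)))" "H (ts ! i) \<in> braid_words (length (W (ts ! i)))"
      using f(1) g(1) t s V[OF t] by (auto simp: represents_def)
    ultimately show ?thesis by (simp add: braid_class_mult)
  qed
  then have b: "dbraids (dist_comp g f) = map (\<lambda>t. braid_class (length (W t)) (?J t)) ts"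
    using f(1) by (intro nth_equalityI) (simp_all add: represents_def dist_comp_def)
  have r: "represents (dist_comp g f) ts vs W ?J"
    unfolding represents_def
  proof (intro conjI)
    show "match (dperm (dist_comp g f)) ts vs" using match_comp[OF mf(1) mg(1)] by (simp add: dist_comp_def)
    show "\<forall>t\<in>set ts. ?J t \<in> braid_words (length (W t))" using f(1) g(1) V s by (auto simp: represents_def)
    show "dsrc (dist_comp g f) = map (\<lambda>t. length (W t)) ts" using f(1) by (simp add: represents_def dist_comp_def)
    show "dtgt (dist_comp g f) = map (\<lambda>t. length (W t)) vs" using g(1) V s by (simp add: represents_def dist_comp_def)
  qed (rule b)
  have "k'' = map (act W ?J) vs" using g(3) V s by (auto simp: word_act_append)
  moreover have "realize ts vs W ?J = \<psi> \<bullet> \<phi>"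
  proof -
    let ?b = "\<lambda>W G t. times.braid (G t) (W t) one"
    have n: "par (?b V H) us \<bullet> shuffle (act W G) ts us = shuffle (act V H) ts us \<bullet> par (?b V H) ts"
      using V s by (intro par_shuffle[OF mf(4)]) auto
    have l: "par (?b V H) ts \<bullet> par (?b W G) ts = par (?b W ?J) ts"
      unfolding par_cmp using V by (intro par_cong) (simp add: times.braid_append)
    have c: "shuffle (act W ?J) ts vs = shuffle (act V H) ts vs"
      using V mf(4) mg(2) by (intro shuffle_cong) (auto simp: word_act_append)
    show ?thesis
      unfolding f(4) g(4) realize_def c l[symmetric] using shuffle_trans[OF mf(4) mg(2), of "act V H", symmetric]
      by (simp add: plus.cmp_assoc reassoc[OF n])
  qed
  ultimately show ?thesis using TrackI[OF r f(2)] by simp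
qed

lemma Track_sum:
  assumes "Track f k k' \<phi>" "Track g l l' \<psi>"
  shows "\<exists>\<chi>. Track (dist_sum f g) (k @ l) (k' @ l') \<chi> \<and> \<chi> \<bullet> sum_append k l = sum_append k' l' \<bullet> (\<phi> \<boxplus>\<^sub>a \<psi>)"
proof -
  let ?ts = "[0..<length k]" and ?ts' = "map (\<lambda>i. length k + i) [0..<length l]"
  obtain us W G where f: "represents f ?ts us W G" "k = map W ?ts" "k' = map (act W G) us" "\<phi> = realize ?ts us W G"
    by (rule TrackE[OF assms(1), of ?ts]) auto
  obtain us' W' G' where g: "represents g ?ts' us' W' G'" "l = map W' ?ts'" "l' = map (act W' G') us'" "\<psi> = realize ?ts' us' W' G'"
    by (rule TrackE[OF assms(2), of ?ts']) (auto simp: distinct_map)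
  have mf: "match (dperm f) ?ts us" "mset ?ts = mset us" and mg: "match (dperm g) ?ts' us'" "mset ?ts' = mset us'"
    using f(1) g(1) by (auto simp: represents_def match_def)
  have s: "set us = set ?ts" "set us' = set ?ts'" using mf(2) mg(2) mset_eq_setD by metis+
  define V where "V = (\<lambda>t. if t < length k then W t else W' t)"
  define H where "H = (\<lambda>t. if t < length k then G t else G' t)"
  have V: "V t = W t" "H t = G t" if "t \<in> set ?ts" for t using that by (auto simp: V_def H_def)
  have V': "V t = W' t" "H t = G' t" if "t \<in> set ?ts'" for t using that by (auto simp: V_def H_def)
  have eqs: "map V ?ts = k" "map V ?ts' = l" "map (act V H) us = k'" "map (act V H) us' = l'"
  proof -
    have "map V ?ts = map W ?ts" "map V ?ts' = map W' ?ts'" "map (act V H) us = map (act W G) us" "map (act V H) us' = map (act W' G') us'"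
      unfolding map_eq_conv s using V V' by auto
    then show "map V ?ts = k" "map V ?ts' = l" "map (act V H) us = k'" "map (act V H) us' = l'"
      using f(2,3) g(2,3) by metis+
  qed
  have r: "represents (dist_sum f g) (?ts @ ?ts') (us @ us') V H"
    unfolding represents_def
  proof (intro conjI)
    have "length (dsrc f) = length ?ts" "length (dsrc g) = length ?ts'" using f(1) g(1) by (simp_all add: represents_def)
    then show "match (dperm (dist_sum f g)) (?ts @ ?ts') (us @ us')"
      using match_sum[OF mf(1) mg(1)] by (auto simp: dist_sum_def Let_def cong: if_cong)
  qed (use f(1) g(1) V V' s in \<open>auto simp: represents_def dist_sum_def Let_def\<close>)
  have a1: "realize ?ts us V H = \<phi>" unfolding f(4) by (rule realize_cong[OF mf(2)]) (simp_all add: V)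
  have a2: "realize ?ts' us' V H = \<psi>" unfolding g(4) by (rule realize_cong[OF mg(2)]) (simp_all add: V')
  have "realize (?ts @ ?ts') (us @ us') V H \<bullet> sum_append k l = sum_append k' l' \<bullet> (\<phi> \<boxplus>\<^sub>a \<psi>)"
  proof -
    let ?b = "\<lambda>t. times.braid (H t) (V t) one"
    have "par ?b (?ts @ ?ts') \<bullet> sum_append (map V ?ts) (map V ?ts') = sum_append (map (act V H) ?ts) (map (act V H) ?ts') \<bullet> (par ?b ?ts \<boxplus>\<^sub>a par ?b ?ts')"
      by (rule par_sum) simp
    then show ?thesis
      unfolding a1[symmetric] a2[symmetric] using reassoc[OF shuffle_sum[OF mf(2) mg(2), of "act V H"]]
      by (simp add: realize_def eqs plus.cmp_assoc plus.tA_merge del: map_map)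
  qed
  moreover have "Track (dist_sum f g) (k @ l) (k' @ l') (realize (?ts @ ?ts') (us @ us') V H)"
    by (rule TrackI[OF r]) (simp_all only: map_append eqs)
  ultimately show ?thesis by blast
qed

text \<open>
  The tags of a product are the pairs of tags. Their reordering is split into a reordering of the left
  and a reordering of the right components.
\<close>

lemma Track_prod:
  assumes "Track f k k' \<phi>" "Track g l l' \<psi>"
  shows "\<exists>\<chi>. Track (dist_prod f g) (word_products k l) (word_products k' l') \<chi> \<and> \<chi> \<bullet> distr k l = distr k' l' \<bullet> (\<phi> \<boxtimes>\<^sub>a \<psi>)"
proof -
  obtain ts ts' W G where f: "represents f (ts :: nat list) ts' W G" "k = map W ts" "k' = map (act W G) ts'" "\<phi> = realize ts ts' W G"
    by (rule TrackE'[OF assms(1)])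
  obtain us us' V H where g: "represents g (us :: nat list) us' V H" "l = map V us" "l' = map (act V H) us'" "\<psi> = realize us us' V H"
    by (rule TrackE'[OF assms(2)])
  have mf: "match (dperm f) ts ts'" "mset ts = mset ts'" and mg: "match (dperm g) us us'" "mset us = mset us'"
    using f(1) g(1) by (auto simp: represents_def match_def)
  have s: "set ts' = set ts" "set us' = set us" using mf(2) mg(2) mset_eq_setD by metis+
  define J where "J = (\<lambda>(t, u). G t @ shift (length (W t)) (H u))"
  let ?W = "pair_word W V"
  have w: "G t \<in> braid_words (length (W t))" "H u \<in> braid_words (length (V u))" if "t \<in> set ts" "u \<in> set us" for t u
    using f(1) g(1) that by (auto simp: represents_def)
  have a: "act ?W J (t, u) = act W G t @ act V H u" if "t \<in> set ts" "u \<in> set us" for t u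
    using w[OF that] by (simp add: J_def word_act_append word_act_shift word_act_append2)
  have r: "represents (dist_prod f g) (pairs ts us) (pairs ts' us') ?W J"
    unfolding represents_def
  proof (intro conjI)
    have l: "length (dsrc f) = length ts" "length (dsrc g) = length us" using f(1) g(1) by (simp_all add: represents_def)
    then show "match (dperm (dist_prod f g)) (pairs ts us) (pairs ts' us')"
      using match_prod[OF mf(1) mg(1)] by (simp add: dist_prod_def Let_def)
    show "\<forall>x\<in>set (pairs ts us). J x \<in> braid_words (length (?W x))"
      using w by (auto simp: J_def words_mono shift_words)
    show "dsrc (dist_prod f g) = map (\<lambda>x. length (?W x)) (pairs ts us)"
      "dtgt (dist_prod f g) = map (\<lambda>x. length (?W x)) (pairs ts' us')"
      using f(1) g(1) dist_prod_obj_pairs[of "\<lambda>t. length (W t)" _ "\<lambda>u. length (V u)"] by (simp_all add: dist_prod_def Let_def represents_def)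
    show "dbraids (dist_prod f g) = map (\<lambda>x. braid_class (length (?W x)) (J x)) (pairs ts us)"
      using f(1) g(1) w unfolding pairs_conv by (auto simp: dist_prod_def Let_def represents_def J_def index_bounds braid_juxt_braid_class)
  qed
  have "realize (pairs ts us) (pairs ts' us') ?W J \<bullet> distr k l = distr k' l' \<bullet> (\<phi> \<boxtimes>\<^sub>a \<psi>)"
  proof -
    let ?b = "\<lambda>W G t. times.braid (G t) (W t) one"
    have 1: "par (?b ?W J) (pairs ts us) \<bullet> distr (map W ts) (map V us)
       = distr (map (act W G) ts) (map (act V H) us) \<bullet> (par (?b W G) ts \<boxtimes>\<^sub>a par (?b V H) us)"
    proof (rule distr_nat)
      fix t u assume tu: "t \<in> set ts" "u \<in> set us"
      show "arr (?b ?W J (t, u)) \<and> src (?b ?W J (t, u)) = Word (W t @ V u) \<and> tgt (?b ?W J (t, u)) = Word (act W G t @ act V H u)"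
        using a[OF tu] by simp
      show "?b ?W J (t, u) \<bullet> word_append (W t) (V u) = word_append (act W G t) (act V H u) \<bullet> (?b W G t \<boxtimes>\<^sub>a ?b V H u)"
        using times.braid_juxt_pack[OF w(1)[OF tu], of "H u" "V u"] by (simp add: J_def word_append_def)
    qed auto
    have m: "mset (pairs ts us) = mset (pairs ts' us)" "mset (pairs ts' us) = mset (pairs ts' us')"
      using mset_pairs_left[OF mf(2)] mset_pairs_right[OF mg(2)] by auto
    have "shuffle (act ?W J) (pairs ts us) (pairs ts' us') = shuffle (pair_word (act W G) (act V H)) (pairs ts us) (pairs ts' us')"
      using m a by (intro shuffle_cong) auto
    also have "\<dots> = shuffle (pair_word (act W G) (act V H)) (pairs ts' us) (pairs ts' us') \<bullet> shuffle (pair_word (act W G) (act V H)) (pairs ts us) (pairs ts' us)"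
      using shuffle_trans[OF m] by simp
    finally show ?thesis
      unfolding realize_def f(2-4) g(2-4) plus.cmp_assoc 1
      using reassoc[OF distr_shuffle_left[OF mf(2), of "act W G" "act V H" us]] reassoc[OF distr_shuffle_right[OF mg(2), of "act W G" "act V H" ts']] mf(2) mg(2)
      by (simp add: times.tA_merge par_braid_tgt)
  qed
  moreover have "map ?W (pairs ts us) = word_products k l" "map (act ?W J) (pairs ts' us') = word_products k' l'"
    unfolding f(2,3) g(2,3) word_products_pairs using a s by auto
  ultimately show ?thesis using TrackI[OF r] by metis
qed

lemma Track_swap: "\<exists>\<chi>. Track (dist_swap (map length k) (map length l)) (k @ l) (l @ k) \<chi> \<and> \<chi> \<bullet> sum_append k l = sum_append l k \<bullet> zeP (Sum k) (Sum l)"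
proof -
  let ?ts = "[0..<length k]" and ?us = "map (\<lambda>i. length k + i) [0..<length l]"
  define W where "W = (!) (k @ l)"
  have W: "map W ?ts = k" "map W ?us = l" by (auto simp: W_def nth_append intro!: nth_equalityI)
  have l: "map (\<lambda>t. length (W t)) ts = map length (map W ts)" for ts by simp
  have d: "set ?ts \<inter> set ?us = {}" by auto
  have "match (\<lambda>i. if i < length k then length l + i else if i < length k + length l then i - length k else i) (?ts @ ?us) (?us @ ?ts)"
    using match_swap[of ?ts ?us] by (simp add: distinct_map d cong: if_cong)
  from Track_reorder[OF this, of W] have "Track (dist_swap (map length k) (map length l)) (k @ l) (l @ k) (shuffle W (?ts @ ?us) (?us @ ?ts))"
    unfolding l map_append W by (simp add: dist_swap_def Let_def)
  then show ?thesis using shuffle_ze[OF d, of W] unfolding W by blast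
qed

lemma Track_deltaR: "\<exists>\<chi>. Track (dist_deltaR (map length k) (map length k') (map length l)) (word_products (k @ k') l) (word_products k l @ word_products k' l) \<chi>
   \<and> \<chi> \<bullet> distr (k @ k') l \<bullet> (sum_append k k' \<boxtimes>\<^sub>a idn (Sum l)) = sum_append (word_products k l) (word_products k' l) \<bullet> (distr k l \<boxplus>\<^sub>a distr k' l) \<bullet> dr (Sum k) (Sum k') (Sum l)"
proof -
  let ?ts = "[0..<length k]" and ?ts' = "map (\<lambda>i. length k + i) [0..<length k']" and ?us = "[0..<length l]"
  define W V where "W = (!) (k @ k')" and "V = (!) l"
  have W: "map W ?ts = k" "map W ?ts' = k'" "map V ?us = l" by (auto simp: W_def V_def nth_append intro!: nth_equalityI)
  have l: "map (\<lambda>t. length (pair_word W V t)) ts = map length (map (pair_word W V) ts)" for ts by simp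
  have p: "map (pair_word W V) (pairs (?ts @ ?ts') ?us) = word_products (k @ k') l" "map (pair_word W V) (pairs ?ts ?us) = word_products k l" "map (pair_word W V) (pairs ?ts' ?us) = word_products k' l"
    unfolding word_products_pairs[symmetric] map_append W by simp_all
  have lw: "map length (word_products k l) = dist_prod_obj (map length k) (map length l)" for k l :: "'v list list"
    using dist_prod_obj_pairs[of length k length l] word_products_pairs[of id k id l] by simp
  have d: "distinct (?ts @ ?ts')" "distinct ?us" by (auto simp: distinct_map)
  from Track_reorder[OF match_deltaR[OF d], of "pair_word W V"]
  have "Track (dist_deltaR (map length k) (map length k') (map length l)) (word_products (k @ k') l) (word_products k l @ word_products k' l)
     (shuffle (pair_word W V) (pairs (?ts @ ?ts') ?us) (pairs ?ts ?us @ pairs ?ts' ?us))"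
    unfolding l map_append p lw by (simp add: dist_deltaR_def Let_def cong: if_cong)
  moreover have "shuffle (pair_word W V) (pairs (?ts @ ?ts') ?us) (pairs ?ts ?us @ pairs ?ts' ?us) \<bullet> distr (k @ k') l \<bullet> (sum_append k k' \<boxtimes>\<^sub>a idn (Sum l))
     = sum_append (word_products k l) (word_products k' l) \<bullet> (distr k l \<boxplus>\<^sub>a distr k' l) \<bullet> dr (Sum k) (Sum k') (Sum l)"
    using distr_append_left[of ?ts ?ts' W V ?us] unfolding map_append W by auto
  ultimately show ?thesis by blast
qed

lemma Track_braiding: "\<exists>\<chi>. Track (dist_braiding (map length k) (map length l)) (word_products k l) (word_products l k) \<chi> \<and> \<chi> \<bullet> distr k l = distr l k \<bullet> zeT (Sum k) (Sum l)"
proof -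
  let ?ts = "[0..<length k]" and ?us = "[0..<length l]"
  define W V where "W = (!) k" and "V = (!) l"
  have W: "map W ?ts = k" "map V ?us = l" by (auto simp: W_def V_def intro!: nth_equalityI)
  define G where "G = (\<lambda>(t, u). block_word (length (W t)) (length (V u)))"
  have a: "act (pair_word W V) G x = V (snd x) @ W (fst x)" for x
    using times.braid_block[of "W (fst x)" "V (snd x)"] by (simp add: G_def case_prod_beta)
  have r: "represents (dist_braiding (map length k) (map length l)) (pairs ?ts ?us) (map prod.swap (pairs ?us ?ts)) (pair_word W V) G"
    unfolding represents_def
  proof (intro conjI)
    show "match (dperm (dist_braiding (map length k) (map length l))) (pairs ?ts ?us) (map prod.swap (pairs ?us ?ts))"
      using match_braiding[of ?ts ?us] by (simp add: dist_braiding_def Let_def cong: if_cong)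
    show "\<forall>t\<in>set (pairs ?ts ?us). G t \<in> braid_words (length (pair_word W V t))"
      using block_word_words by (auto simp: G_def)
    have wl: "map (\<lambda>t. length (W t)) ?ts = map length k" "map (\<lambda>t. length (V t)) ?us = map length l"
      by (auto simp: W_def V_def intro!: nth_equalityI)
    have o: "dist_prod_obj (map length k) (map length l) = map (\<lambda>x. length (W (fst x)) + length (V (snd x))) (pairs ?ts ?us)"
      "dist_prod_obj (map length l) (map length k) = map (\<lambda>x. length (V (fst x)) + length (W (snd x))) (pairs ?us ?ts)"
      using dist_prod_obj_pairs[of "\<lambda>t. length (W t)" ?ts "\<lambda>t. length (V t)" ?us]
        dist_prod_obj_pairs[of "\<lambda>t. length (V t)" ?us "\<lambda>t. length (W t)" ?ts] unfolding wl .
    show "dsrc (dist_braiding (map length k) (map length l)) = map (\<lambda>t. length (pair_word W V t)) (pairs ?ts ?us)"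
      "dtgt (dist_braiding (map length k) (map length l)) = map (\<lambda>t. length (pair_word W V t)) (map prod.swap (pairs ?us ?ts))"
      using o by (simp_all add: dist_braiding_def Let_def add.commute)
    show "dbraids (dist_braiding (map length k) (map length l)) = map (\<lambda>t. braid_class (length (pair_word W V t)) (G t)) (pairs ?ts ?us)"
      by (rule nth_equalityI)
        (simp_all add: dist_braiding_def Let_def nth_pairs index_bounds G_def block_braid_def block_word_def W_def V_def)
  qed
  have "realize (pairs ?ts ?us) (map prod.swap (pairs ?us ?ts)) (pair_word W V) G \<bullet> distr k l = distr l k \<bullet> zeT (Sum k) (Sum l)"
  proof -
    let ?J = "\<lambda>x. times.braid (G x) (pair_word W V x) one"
    have "shuffle (\<lambda>x. V (snd x) @ W (fst x)) (pairs ?ts ?us) (map prod.swap (pairs ?us ?ts)) \<bullet> par ?J (pairs ?ts ?us) \<bullet> distr (map W ?ts) (map V ?us)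
       = distr (map V ?us) (map W ?ts) \<bullet> zeT (Sum (map W ?ts)) (Sum (map V ?us))"
    proof (rule distr_ze[where J = ?J])
      fix t u
      show "arr (?J (t, u)) \<and> src (?J (t, u)) = Word (W t @ V u) \<and> tgt (?J (t, u)) = Word (V u @ W t)"
        using a[of "(t, u)"] by simp
      show "?J (t, u) \<bullet> word_append (W t) (V u) = word_append (V u) (W t) \<bullet> zeT (Word (W t)) (Word (V u))"
        using times.braid_block[of "W t" "V u" one] times.block_pass_ze[of "W t" "V u"] by (simp add: G_def word_append_def)
    qed simp
    then show ?thesis unfolding W realize_def a by (simp only: plus.cmp_assoc)
  qed
  moreover have "Track (dist_braiding (map length k) (map length l)) (word_products k l) (word_products l k)
     (realize (pairs ?ts ?us) (map prod.swap (pairs ?us ?ts)) (pair_word W V) G)"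
  proof (rule TrackI[OF r])
    show "word_products k l = map (pair_word W V) (pairs ?ts ?us)" using word_products_pairs[of W ?ts V ?us] unfolding W .
    have "map (act (pair_word W V) G) (map prod.swap (pairs ?us ?ts)) = map (pair_word V W) (pairs ?us ?ts)"
      unfolding a map_map comp_def fst_swap snd_swap by (rule HOL.refl)
    also have "\<dots> = word_products l k" using word_products_pairs[of V ?us W ?ts, symmetric] unfolding W .
    finally show "word_products l k = map (act (pair_word W V) G) (map prod.swap (pairs ?us ?ts))" ..
  qed
  ultimately show ?thesis by blast
qed

text \<open>
  Value of \<open>inv_arr\<close> at \<open>f\<close>, see \<open>represents_inverse_unique\<close>; the braids are listed in the order of the target.
\<close>

definition represents_inverse :: "dist_mor \<Rightarrow> 't list \<Rightarrow> ('t \<Rightarrow> 'v list) \<Rightarrow> ('t \<Rightarrow> (nat \<times> bool) list) \<Rightarrow> dist_mor" where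
  "represents_inverse f us W G = \<lparr>dsrc = dtgt f, dtgt = dsrc f, dperm = inv_into UNIV (dperm f),
     dbraids = map (\<lambda>t. braid_class (length (W t)) (inverse_word (G t))) us\<rparr>"

lemma represents_inverse:
  assumes "represents f ts us W G"
  shows "represents (represents_inverse f us W G) us ts (act W G) (\<lambda>t. inverse_word (G t))"
proof -
  have m: "match (dperm f) ts us" using assms by (simp add: represents_def)
  then have "set us = set ts" by (metis match_def mset_eq_setD)
  then show ?thesis
    using assms match_inverse[OF m] by (simp add: represents_def represents_inverse_def)
qed

lemma dist_comp_represents_inverse:
  assumes "represents f ts us W G"
  shows "dist_comp (represents_inverse f us W G) f = dist_id (dsrc f)"
proof -
  have m: "match (dperm f) ts us" using assms by (simp add: represents_def)
  have p: "dperm f permutes {..<length ts}" by (rule match_permutes[OF m])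
  have l: "length us = length ts" by (rule match_length[OF m])
  have "map (\<lambda>i. dbraids (represents_inverse f us W G) ! dperm f i \<otimes>\<^bsub>braid_group (dsrc f ! i)\<^esub> dbraids f ! i) [0..<length (dsrc f)]
     = map (\<lambda>n. \<one>\<^bsub>braid_group n\<^esub>) (dsrc f)"
  proof (rule nth_equalityI)
    fix i assume "i < length (map (\<lambda>i. dbraids (represents_inverse f us W G) ! dperm f i \<otimes>\<^bsub>braid_group (dsrc f ! i)\<^esub> dbraids f ! i) [0..<length (dsrc f)])"
    then have i: "i < length ts" using assms by (simp add: represents_def)
    let ?t = "ts ! i"
    have q: "dperm f i < length ts" "us ! dperm f i = ?t" using m i by (auto simp: match_def)
    have w: "G ?t \<in> braid_words (length (W ?t))" using assms i by (simp add: represents_def)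
    have "dbraids (represents_inverse f us W G) ! dperm f i = braid_class (length (W ?t)) (inverse_word (G ?t))"
      using q l by (simp add: represents_inverse_def)
    moreover have "dbraids f ! i = braid_class (length (W ?t)) (G ?t)" "dsrc f ! i = length (W ?t)" "length (dsrc f) = length ts"
      using assms i by (simp_all add: represents_def)
    moreover have "braid_class (length (W ?t)) (inverse_word (G ?t) @ G ?t) = braid_class (length (W ?t)) []"
      using w inverse_word_left[OF w] by (subst braid_class_eq_iff) auto
    ultimately show "map (\<lambda>i. dbraids (represents_inverse f us W G) ! dperm f i \<otimes>\<^bsub>braid_group (dsrc f ! i)\<^esub> dbraids f ! i) [0..<length (dsrc f)] ! i
       = map (\<lambda>n. \<one>\<^bsub>braid_group n\<^esub>) (dsrc f) ! i"
      using i w by (simp add: braid_class_mult braid_class_one)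
  qed simp
  then show ?thesis
    using permutes_inv_o[OF p] by (simp add: dist_comp_def dist_id_def dist_reorder_def represents_inverse_def)
qed

lemma represents_inverse_unique:
  assumes "represents f ts us W G" "g \<in> dist_arrows" "dsrc g = dtgt f" "dtgt g = dsrc f" "dist_comp g f = dist_id (dsrc f)"
  shows "g = represents_inverse f us W G"
proof -
  have m: "match (dperm f) ts us" using assms(1) by (simp add: represents_def)
  have p: "dperm f permutes {..<length ts}" by (rule match_permutes[OF m])
  have l: "length us = length ts" by (rule match_length[OF m])
  have lg: "length (dbraids g) = length ts" "length (dsrc g) = length ts"
    using assms(1,2,3) l by (auto simp: dist_arrows_def Let_def represents_def)
  have "dperm g \<circ> dperm f = id" using arg_cong[OF assms(5), of dperm] by (simp add: dist_comp_def dist_id_def dist_reorder_def)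
  then have 1: "dperm g = inv_into UNIV (dperm f)"
    by (metis comp_assoc comp_id id_comp permutes_inv_o(1)[OF p])
  have "dbraids g = map (\<lambda>t. braid_class (length (W t)) (inverse_word (G t))) us"
  proof (rule nth_equalityI)
    fix j assume "j < length (dbraids g)"
    then have "j \<in> dperm f ` {..<length ts}" by (simp add: permutes_image[OF p] lg)
    then obtain i where i: "i < length ts" "j = dperm f i" by auto
    let ?t = "ts ! i" and ?n = "length (W (ts ! i))"
    have q: "j < length ts" "us ! j = ?t" using m i by (auto simp: match_def)
    have w: "G ?t \<in> braid_words ?n" using assms(1) i by (simp add: represents_def)
    have "dbraids g ! j \<in> carrier (braid_group (dsrc g ! j))"
      using assms(2) q lg by (simp add: dist_arrows_def Let_def)
    moreover have "dsrc g ! j = ?n" using assms(1,3) q l by (simp add: represents_def)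
    ultimately obtain v where v: "v \<in> braid_words ?n" "dbraids g ! j = braid_class ?n v" using braid_class_carrier by auto
    have "dbraids (dist_comp g f) ! i = \<one>\<^bsub>braid_group ?n\<^esub>"
      unfolding assms(5) using assms(1) i by (simp add: dist_id_def dist_reorder_def represents_def)
    then have "braid_class ?n (v @ G ?t) = braid_class ?n []"
      using assms(1) i v w by (simp add: dist_comp_def represents_def braid_class_mult braid_class_one)
    then have 1: "(v @ G ?t, []) \<in> braid_rel ?n" using v w by (subst (asm) braid_class_eq_iff) auto
    have "(v @ G ?t @ inverse_word (G ?t), v @ []) \<in> braid_rel ?n"
      using braid_rel_cong2[OF braid_rel.refl[OF v(1)] inverse_word_right[OF w]] .
    moreover have "((v @ G ?t) @ inverse_word (G ?t), [] @ inverse_word (G ?t)) \<in> braid_rel ?n"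
      using braid_rel_cong2[OF 1 braid_rel.refl] w by simp
    ultimately have "(v, inverse_word (G ?t)) \<in> braid_rel ?n"
      by (metis append_Nil append_Nil2 append_assoc braid_rel.sym braid_rel.trans)
    then have "braid_class ?n v = braid_class ?n (inverse_word (G ?t))" using v w by (subst braid_class_eq_iff) auto
    then show "dbraids g ! j = map (\<lambda>t. braid_class (length (W t)) (inverse_word (G t))) us ! j"
      using v q l by simp
  qed (use lg l in simp)
  with 1 show ?thesis using assms(3,4) by (simp add: represents_inverse_def)
qed

lemma represents_arrow: "represents f ts us W G \<Longrightarrow> f \<in> dist_arrows"
  using match_length[of "dperm f" ts us] match_permutes[of "dperm f" ts us]
  by (auto simp: represents_def dist_arrows_def Let_def match_def braid_class_carrier)

text \<open>
  That \<open>\<psi>\<close> is a left inverse follows from uniqueness, because \<open>\<psi> \<bullet> \<phi>\<close> realizes an identity.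
\<close>

lemma Track_inverse:
  assumes "Track f k k' \<phi>"
  shows "\<exists>\<psi>. Track (inv_arr Dbr f) k' k \<psi> \<and> \<psi> \<bullet> \<phi> = idn (Sum k)"
proof -
  obtain ts us W G where f: "represents f (ts :: nat list) us W G" "k = map W ts" "k' = map (act W G) us" "\<phi> = realize ts us W G"
    by (rule TrackE'[OF assms])
  let ?g = "represents_inverse f us W G" and ?H = "\<lambda>t. inverse_word (G t)"
  have r: "represents ?g us ts (act W G) ?H" by (rule represents_inverse[OF f(1)])
  have gf: "dist_comp ?g f = dist_id (dsrc f)" by (rule dist_comp_represents_inverse[OF f(1)])
  have p: "dperm f permutes {..<length ts}" using f(1) match_permutes by (auto simp: represents_def)
  have "represents_inverse ?g ts (act W G) ?H = f"
    using f(1) inv_inv_eq[OF permutes_bij[OF p]] by (simp add: represents_inverse_def represents_def)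
  then have fg: "dist_comp f ?g = dist_id (dtgt f)" using dist_comp_represents_inverse[OF r] by (simp add: represents_inverse_def)
  have "inv_arr Dbr f = ?g"
    unfolding inv_arr_def
  proof (rule the_equality)
    show "?g \<in> homs Dbr (Cod Dbr f) (Dom Dbr f) \<and> Cmp Dbr ?g f = Idn Dbr (Dom Dbr f) \<and> Cmp Dbr f ?g = Idn Dbr (Cod Dbr f)"
      using represents_arrow[OF r] gf fg by (simp add: homs_def Dbr_def represents_inverse_def)
    show "g = ?g" if "g \<in> homs Dbr (Cod Dbr f) (Dom Dbr f) \<and> Cmp Dbr g f = Idn Dbr (Dom Dbr f) \<and> Cmp Dbr f g = Idn Dbr (Cod Dbr f)" for g
      using that by (intro represents_inverse_unique[OF f(1)]) (simp_all add: homs_def Dbr_def)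
  qed
  note inv = this
  have mp: "map (act (act W G) ?H) ts = map W ts"
  proof (rule map_cong[OF HOL.refl])
    fix t assume "t \<in> set ts"
    then have "G t \<in> braid_words (length (W t))" using f(1) by (simp add: represents_def)
    from times.braid_respects[OF inverse_word_left[OF this], of "W t"] show "act (act W G) ?H t = W t"
      by (simp add: word_act_append)
  qed
  have T: "Track (inv_arr Dbr f) k' k (realize us ts (act W G) ?H)"
    using TrackI[OF r f(3) HOL.refl] unfolding inv mp f(2)[symmetric] .
  have "dsrc f = map length k" using Track_arr(4)[OF assms] .
  then have "realize us ts (act W G) ?H \<bullet> \<phi> = idn (Sum k)"
    using Track_comp[OF assms T] Track_id[of k] gf inv Track_unique by metis
  then show ?thesis using T by blast
qed

end

section \<open>Normal forms of vertices\<close>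

locale vertex_bimonoidal =
  total_bimonoidal arr src tgt idn cmp VSum pA "Atom z" alP alP' laP laP' rhP rhP' zeP zeP'
    VProd mA "Atom u" alT alT' laT laT' rhT rhT' zeT zeT' lz rz dl dr
  for arr :: "'a \<Rightarrow> bool" and src tgt :: "'a \<Rightarrow> 'x vertex" and idn and cmp (infixr "\<bullet>" 55)
    and pA (infixr "\<boxplus>\<^sub>a" 65) and z :: 'x and alP alP' laP laP' rhP rhP' zeP zeP'
    and mA (infixr "\<boxtimes>\<^sub>a" 70) and u :: 'x and alT alT' laT laT' rhT rhT' zeT zeT' lz rz dl dr +
  fixes edge_arrow :: "'x edge \<Rightarrow> 'a"
  assumes z_u: "z \<noteq> u"
    and edge_arrow_sum: "edge_arrow (ESum e f) = edge_arrow e \<boxplus>\<^sub>a edge_arrow f"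
    and edge_arrow_prod: "edge_arrow (EProd e f) = edge_arrow e \<boxtimes>\<^sub>a edge_arrow f"
    and edge_arrow_simps: "edge_arrow (Elem (IdE a)) = idn a"
       "edge_arrow (Elem (Iso (AlphaP a b c))) = alP a b c" "edge_arrow (Elem (Iso (LambdaP a))) = laP a"
       "edge_arrow (Elem (Iso (RhoP a))) = rhP a" "edge_arrow (Elem (Iso (ZetaP a b))) = zeP a b"
       "edge_arrow (Elem (Iso (AlphaT a b c))) = alT a b c" "edge_arrow (Elem (Iso (LambdaT a))) = laT a"
       "edge_arrow (Elem (Iso (RhoT a))) = rhT a" "edge_arrow (Elem (Iso (ZetaT a b))) = zeT a b"
       "edge_arrow (Elem (Iso (LambdaZ a))) = lz a" "edge_arrow (Elem (Iso (RhoZ a))) = rz a"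
       "edge_arrow (Elem (DeltaL a b c)) = dl a b c" "edge_arrow (Elem (DeltaR a b c)) = dr a b c"
    and edge_arrow_inv_arr: "arr (edge_arrow (Elem (IsoInv i)))" "src (edge_arrow (Elem (IsoInv i))) = iso_cod z i"
       "tgt (edge_arrow (Elem (IsoInv i))) = iso_dom z u i"
    and edge_arrow_inv: "edge_arrow (Elem (IsoInv i)) \<bullet> edge_arrow (Elem (Iso i)) = idn (iso_dom z u i)"
       "edge_arrow (Elem (Iso i)) \<bullet> edge_arrow (Elem (IsoInv i)) = idn (iso_cod z i)"
    and edge_arrow_delta: "nonidentities e = [DeltaL a b c] \<or> nonidentities e = [DeltaR a b c] \<Longrightarrow>
       edge_arrow e \<bullet> h = edge_arrow e \<bullet> k \<Longrightarrow> arr h \<Longrightarrow> arr k \<Longrightarrow> src h = src k \<Longrightarrow> tgt h = src (edge_arrow e) \<Longrightarrow> tgt k = src (edge_arrow e) \<Longrightarrow> h = k"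
begin

abbreviation dval where "dval a \<equiv> vertex_val Dbr (dist_obj z u) a"

text \<open>
  Summands with a factor \<open>0\<close> disappear and factors \<open>1\<close> are dropped.
\<close>

primrec monomials :: "'x vertex \<Rightarrow> 'x vertex list list" where
  "monomials (Atom x) = (if x = z then [] else if x = u then [[]] else [[Atom x]])"
| "monomials (VSum a b) = monomials a @ monomials b"
| "monomials (VProd a b) = word_products (monomials a) (monomials b)"

primrec expand :: "'x vertex \<Rightarrow> 'a" where
  "expand (Atom x) = (if x = z then idn (Atom z) else if x = u then rhP' (Atom u)
     else rhP' (VProd (Atom x) (Atom u)) \<bullet> rhT' (Atom x))"
| "expand (VSum a b) = sum_append (monomials a) (monomials b) \<bullet> (expand a \<boxplus>\<^sub>a expand b)"
| "expand (VProd a b) = distr (monomials a) (monomials b) \<bullet> (expand a \<boxtimes>\<^sub>a expand b)"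

lemma expand_arr [simp]: "arr (expand a)" "src (expand a) = a" "tgt (expand a) = Sum (monomials a)"
proof -
  have "arr (expand a) \<and> src (expand a) = a \<and> tgt (expand a) = Sum (monomials a)"
    by (induction a) auto
  then show "arr (expand a)" "src (expand a) = a" "tgt (expand a) = Sum (monomials a)" by auto
qed

lemma edge_arrow_arr [simp]: "arr (edge_arrow e)" "src (edge_arrow e) = edge_dom z u e" "tgt (edge_arrow e) = edge_cod z u e"
proof -
  have "arr (edge_arrow e) \<and> src (edge_arrow e) = edge_dom z u e \<and> tgt (edge_arrow e) = edge_cod z u e"
  proof (induction e)
    case (Elem el)
    show ?case
    proof (cases el)
      case (Iso i)
      then show ?thesis by (cases i) (simp_all add: edge_arrow_simps)
    qed (simp_all add: edge_arrow_simps edge_arrow_inv_arr)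
  qed (simp_all add: edge_arrow_sum edge_arrow_prod)
  then show "arr (edge_arrow e)" "src (edge_arrow e) = edge_dom z u e" "tgt (edge_arrow e) = edge_cod z u e" by auto
qed

lemma length_word_products: "map length (word_products k l) = dist_prod_obj (map length k) (map length l)"
  using dist_prod_obj_pairs[of length k length l] word_products_pairs[of id k id l] by simp

lemma dval_monomials: "dval a = map length (monomials a)"
  by (induction a) (auto simp: dist_obj_def Dbr_def length_word_products)

text \<open>
  The square that the induction on edges has to provide: \<open>g\<close> acts on sums of monomials as the
  distortion morphism \<open>f\<close>.
\<close>

definition tracks where
  "tracks f a b g \<longleftrightarrow> (\<exists>\<phi>. Track f (monomials a) (monomials b) \<phi> \<and> \<phi> \<bullet> expand a = expand b \<bullet> g)"

lemma tracks_id: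
  assumes "monomials a = monomials b" "expand b \<bullet> g = expand a"
  shows "tracks (dist_id (map length (monomials a))) a b g"
  unfolding tracks_def using assms Track_id[of "monomials a"] by (intro exI[of _ "idn (Sum (monomials a))"]) simp

lemma word_products_one: "word_products [[]] l = l" "word_products k [[]] = k"
  by (induction l) auto

lemma tracks_iso: "tracks (iso_val Dbr (dist_obj z u) i) (iso_dom z u i) (iso_cod z i) (edge_arrow (Elem (Iso i)))"
proof (cases i)
  case (AlphaP a b c)
  have "tracks (dist_id (map length (monomials (VSum (VSum a b) c)))) (VSum (VSum a b) c) (VSum a (VSum b c)) (alP a b c)"
  proof (rule tracks_id)
    have "expand (VSum (VSum a b) c) = sum_append (monomials a @ monomials b) (monomials c) \<bullet> (sum_append (monomials a) (monomials b) \<boxplus>\<^sub>a idn (Sum (monomials c))) \<bullet> ((expand a \<boxplus>\<^sub>a expand b) \<boxplus>\<^sub>a expand c)"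
      by (simp add: plus.tA_merge)
    also have "\<dots> = sum_append (monomials a) (monomials b @ monomials c) \<bullet> (idn (Sum (monomials a)) \<boxplus>\<^sub>a sum_append (monomials b) (monomials c)) \<bullet> (expand a \<boxplus>\<^sub>a (expand b \<boxplus>\<^sub>a expand c)) \<bullet> alP a b c"
      by (simp add: reassoc[OF sum_append_assoc] plus.al_push)
    also have "\<dots> = expand (VSum a (VSum b c)) \<bullet> alP a b c"
      by (simp add: plus.tA_merge)
    finally show "expand (VSum a (VSum b c)) \<bullet> alP a b c = expand (VSum (VSum a b) c)" ..
  qed simp
  then show ?thesis using AlphaP by (simp add: edge_arrow_simps dval_monomials) (simp add: Dbr_def)
next
  case (LambdaP a)
  have "tracks (dist_id (map length (monomials (VSum (Atom z) a)))) (VSum (Atom z) a) a (laP a)"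
    by (rule tracks_id) (simp_all add: sum_append_Nil plus.unit_push)
  then show ?thesis using LambdaP by (simp add: edge_arrow_simps dval_monomials) (simp add: Dbr_def)
next
  case (RhoP a)
  have "tracks (dist_id (map length (monomials (VSum a (Atom z))))) (VSum a (Atom z)) a (rhP a)"
    by (rule tracks_id) (simp_all add: sum_append_Nil_right plus.unit_push)
  then show ?thesis using RhoP by (simp add: edge_arrow_simps dval_monomials) (simp add: Dbr_def)
next
  case (ZetaP a b)
  obtain \<chi> where "Track (dist_swap (map length (monomials a)) (map length (monomials b))) (monomials a @ monomials b) (monomials b @ monomials a) \<chi>"
      and c: "\<chi> \<bullet> sum_append (monomials a) (monomials b) = sum_append (monomials b) (monomials a) \<bullet> zeP (Sum (monomials a)) (Sum (monomials b))"
    using Track_swap by blast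
  moreover have "\<chi> \<bullet> expand (VSum a b) = expand (VSum b a) \<bullet> zeP a b"
    by (simp add: reassoc[OF c] plus.ze_push)
  ultimately have "tracks (dist_swap (map length (monomials a)) (map length (monomials b))) (VSum a b) (VSum b a) (zeP a b)"
    unfolding tracks_def by auto
  then show ?thesis using ZetaP by (simp add: edge_arrow_simps dval_monomials) (simp add: Dbr_def)
next
  case (AlphaT a b c)
  have "tracks (dist_id (map length (monomials (VProd (VProd a b) c)))) (VProd (VProd a b) c) (VProd a (VProd b c)) (alT a b c)"
  proof (rule tracks_id)
    have "expand (VProd (VProd a b) c) = distr (word_products (monomials a) (monomials b)) (monomials c) \<bullet> (distr (monomials a) (monomials b) \<boxtimes>\<^sub>a idn (Sum (monomials c))) \<bullet> ((expand a \<boxtimes>\<^sub>a expand b) \<boxtimes>\<^sub>a expand c)"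
      by (simp add: times.tA_merge)
    also have "\<dots> = distr (monomials a) (word_products (monomials b) (monomials c)) \<bullet> (idn (Sum (monomials a)) \<boxtimes>\<^sub>a distr (monomials b) (monomials c)) \<bullet> (expand a \<boxtimes>\<^sub>a (expand b \<boxtimes>\<^sub>a expand c)) \<bullet> alT a b c"
      by (simp add: reassoc[OF distr_assoc] times.al_push)
    also have "\<dots> = expand (VProd a (VProd b c)) \<bullet> alT a b c"
      by (simp add: times.tA_merge)
    finally show "expand (VProd a (VProd b c)) \<bullet> alT a b c = expand (VProd (VProd a b) c)" ..
  qed (simp add: word_products_assoc)
  moreover have "dist_prod_obj (dist_prod_obj (map length (monomials a)) (map length (monomials b))) (map length (monomials c))
     = dist_prod_obj (map length (monomials a)) (dist_prod_obj (map length (monomials b)) (map length (monomials c)))"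
    using arg_cong[OF word_products_assoc[of "monomials a" "monomials b" "monomials c"], of "map length"] by (simp only: length_word_products)
  ultimately show ?thesis using AlphaT by (simp add: edge_arrow_simps dval_monomials) (simp add: Dbr_def length_word_products)
next
  case (LambdaT a)
  have "tracks (dist_id (map length (monomials (VProd (Atom u) a)))) (VProd (Atom u) a) a (laT a)"
  proof (rule tracks_id)
    have "expand (VProd (Atom u) a) = distr [[]] (monomials a) \<bullet> (rhP' (Atom u) \<boxtimes>\<^sub>a idn (Sum (monomials a))) \<bullet> (idn (Atom u) \<boxtimes>\<^sub>a expand a)"
      using z_u by (simp add: times.tA_merge)
    also have "\<dots> = expand a \<bullet> laT a"
      using reassoc[OF distr_left[of "[]" "monomials a"]] by (simp add: distr_left_one times.unit_push)
    finally show "expand a \<bullet> laT a = expand (VProd (Atom u) a)" ..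
  qed (use z_u in \<open>simp add: word_products_one\<close>)
  then show ?thesis using LambdaT z_u by (simp add: edge_arrow_simps dval_monomials word_products_one) (simp add: Dbr_def)
next
  case (RhoT a)
  have "tracks (dist_id (map length (monomials (VProd a (Atom u))))) (VProd a (Atom u)) a (rhT a)"
  proof (rule tracks_id)
    have "expand (VProd a (Atom u)) = distr (monomials a) [[]] \<bullet> (idn (Sum (monomials a)) \<boxtimes>\<^sub>a rhP' (Atom u)) \<bullet> (expand a \<boxtimes>\<^sub>a idn (Atom u))"
      using z_u by (simp add: times.tA_merge)
    also have "\<dots> = expand a \<bullet> rhT a"
      using reassoc[OF distr_right[of "monomials a" "[]"]] by (simp add: distr_right_one times.unit_push del: distr.simps)
    finally show "expand a \<bullet> rhT a = expand (VProd a (Atom u))" ..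
  qed (use z_u in \<open>simp add: word_products_one\<close>)
  then show ?thesis using RhoT z_u by (simp add: edge_arrow_simps dval_monomials word_products_one del: word_products.simps) (simp add: Dbr_def)
next
  case (ZetaT a b)
  obtain \<chi> where "Track (dist_braiding (map length (monomials a)) (map length (monomials b))) (word_products (monomials a) (monomials b)) (word_products (monomials b) (monomials a)) \<chi>"
      and c: "\<chi> \<bullet> distr (monomials a) (monomials b) = distr (monomials b) (monomials a) \<bullet> zeT (Sum (monomials a)) (Sum (monomials b))"
    using Track_braiding by blast
  moreover have "\<chi> \<bullet> expand (VProd a b) = expand (VProd b a) \<bullet> zeT a b"
    by (simp add: reassoc[OF c] times.ze_push)
  ultimately have "tracks (dist_braiding (map length (monomials a)) (map length (monomials b))) (VProd a b) (VProd b a) (zeT a b)"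
    unfolding tracks_def by auto
  then show ?thesis using ZetaT by (simp add: edge_arrow_simps dval_monomials) (simp add: Dbr_def)
next
  case (LambdaZ a)
  have "tracks (dist_id (map length (monomials (VProd (Atom z) a)))) (VProd (Atom z) a) (Atom z) (lz a)"
    by (rule tracks_id) (simp_all add: lz_nat)
  then show ?thesis using LambdaZ by (simp add: edge_arrow_simps dval_monomials) (simp add: Dbr_def)
next
  case (RhoZ a)
  have "tracks (dist_id (map length (monomials (VProd a (Atom z))))) (VProd a (Atom z)) (Atom z) (rz a)"
    by (rule tracks_id) (simp_all add: rz_nat)
  then show ?thesis using RhoZ by (simp add: edge_arrow_simps dval_monomials) (simp add: Dbr_def)
qed

lemma tracks_iso_inv: "tracks (inv_arr Dbr (iso_val Dbr (dist_obj z u) i)) (iso_cod z i) (iso_dom z u i) (edge_arrow (Elem (IsoInv i)))"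
proof -
  let ?f = "iso_val Dbr (dist_obj z u) i" and ?e = "edge_arrow (Elem (Iso i))" and ?e' = "edge_arrow (Elem (IsoInv i))"
  let ?a = "iso_dom z u i" and ?b = "iso_cod z i"
  obtain \<phi> where t: "Track ?f (monomials ?a) (monomials ?b) \<phi>" and c: "\<phi> \<bullet> expand ?a = expand ?b \<bullet> ?e"
    using tracks_iso unfolding tracks_def by blast
  obtain \<psi> where s: "Track (inv_arr Dbr ?f) (monomials ?b) (monomials ?a) \<psi>" and i: "\<psi> \<bullet> \<phi> = idn (Sum (monomials ?a))"
    using Track_inverse[OF t] by blast
  have "\<psi> \<bullet> expand ?b = \<psi> \<bullet> expand ?b \<bullet> ?e \<bullet> ?e'" by (simp add: edge_arrow_inv Track_arr[OF s])
  also have "\<dots> = expand ?a \<bullet> ?e'"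
    using reassoc[OF c, symmetric] reassoc[OF i] by (simp add: Track_arr[OF s] Track_arr[OF t])
  finally show ?thesis using s unfolding tracks_def by blast
qed

lemma tracks_edge: "tracks (edge_val Dbr (dist_obj z u) e) (edge_dom z u e) (edge_cod z u e) (edge_arrow e)"
proof (induction e)
  case (Elem el)
  show ?case
  proof (cases el)
    case (IdE a)
    have "tracks (dist_id (map length (monomials a))) a a (idn a)" by (rule tracks_id) simp_all
    then show ?thesis using IdE by (simp add: edge_arrow_simps dval_monomials) (simp add: Dbr_def)
  next
    case (Iso i)
    then show ?thesis using tracks_iso[of i] by simp
  next
    case (IsoInv i)
    then show ?thesis using tracks_iso_inv[of i] by simp
  next
    case (DeltaL a b c)
    have "tracks (dist_id (map length (monomials (VProd a (VSum b c))))) (VProd a (VSum b c)) (VSum (VProd a b) (VProd a c)) (dl a b c)"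
    proof (rule tracks_id)
      have "expand (VProd a (VSum b c)) = distr (monomials a) (monomials b @ monomials c) \<bullet> (idn (Sum (monomials a)) \<boxtimes>\<^sub>a sum_append (monomials b) (monomials c)) \<bullet> (expand a \<boxtimes>\<^sub>a (expand b \<boxplus>\<^sub>a expand c))"
        by (simp add: times.tA_merge)
      also have "\<dots> = expand (VSum (VProd a b) (VProd a c)) \<bullet> dl a b c"
        by (simp add: reassoc[OF distr_append] dl_nat) (simp add: plus.tA_merge)
      finally show "expand (VSum (VProd a b) (VProd a c)) \<bullet> dl a b c = expand (VProd a (VSum b c))" ..
    qed (simp add: word_products_append)
    then show ?thesis using DeltaL by (simp add: edge_arrow_simps dval_monomials) (simp add: Dbr_def length_word_products)
  next
    case (DeltaR a b c)
    let ?d = "dist_deltaR (map length (monomials a)) (map length (monomials b)) (map length (monomials c))"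
    obtain \<chi> where t: "Track ?d (word_products (monomials a @ monomials b) (monomials c)) (word_products (monomials a) (monomials c) @ word_products (monomials b) (monomials c)) \<chi>"
      and c: "\<chi> \<bullet> distr (monomials a @ monomials b) (monomials c) \<bullet> (sum_append (monomials a) (monomials b) \<boxtimes>\<^sub>a idn (Sum (monomials c)))
       = sum_append (word_products (monomials a) (monomials c)) (word_products (monomials b) (monomials c)) \<bullet> (distr (monomials a) (monomials c) \<boxplus>\<^sub>a distr (monomials b) (monomials c)) \<bullet> dr (Sum (monomials a)) (Sum (monomials b)) (Sum (monomials c))"
      using Track_deltaR by blast
    have "\<chi> \<bullet> expand (VProd (VSum a b) c) = \<chi> \<bullet> distr (monomials a @ monomials b) (monomials c) \<bullet> (sum_append (monomials a) (monomials b) \<boxtimes>\<^sub>a idn (Sum (monomials c))) \<bullet> ((expand a \<boxplus>\<^sub>a expand b) \<boxtimes>\<^sub>a expand c)"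
      by (simp add: times.tA_merge)
    also have "\<dots> = expand (VSum (VProd a c) (VProd b c)) \<bullet> dr a b c"
      by (simp add: reassoc3[OF c] dr_nat) (simp add: plus.tA_merge)
    finally have "tracks ?d (VProd (VSum a b) c) (VSum (VProd a c) (VProd b c)) (dr a b c)"
      unfolding tracks_def using t by auto
    then show ?thesis using DeltaR by (simp add: edge_arrow_simps dval_monomials) (simp add: Dbr_def)
  qed
next
  case (ESum e f)
  let ?d = "edge_val Dbr (dist_obj z u)" and ?s = "edge_dom z u" and ?t = "edge_cod z u"
  obtain \<phi> where f: "Track (?d e) (monomials (?s e)) (monomials (?t e)) \<phi>" "\<phi> \<bullet> expand (?s e) = expand (?t e) \<bullet> edge_arrow e"
    using ESum(1) unfolding tracks_def by blast
  obtain \<psi> where g: "Track (?d f) (monomials (?s f)) (monomials (?t f)) \<psi>" "\<psi> \<bullet> expand (?s f) = expand (?t f) \<bullet> edge_arrow f"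
    using ESum(2) unfolding tracks_def by blast
  obtain \<chi> where t: "Track (dist_sum (?d e) (?d f)) (monomials (?s e) @ monomials (?s f)) (monomials (?t e) @ monomials (?t f)) \<chi>"
    and c: "\<chi> \<bullet> sum_append (monomials (?s e)) (monomials (?s f)) = sum_append (monomials (?t e)) (monomials (?t f)) \<bullet> (\<phi> \<boxplus>\<^sub>a \<psi>)"
    using Track_sum[OF f(1) g(1)] by blast
  have "\<chi> \<bullet> expand (?s (ESum e f)) = expand (?t (ESum e f)) \<bullet> edge_arrow (ESum e f)"
    by (simp add: reassoc[OF c] plus.tA_merge f(2) g(2) edge_arrow_sum)
  then show ?case unfolding tracks_def using t by (auto simp: Dbr_def)
next
  case (EProd e f)
  let ?d = "edge_val Dbr (dist_obj z u)" and ?s = "edge_dom z u" and ?t = "edge_cod z u"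
  obtain \<phi> where f: "Track (?d e) (monomials (?s e)) (monomials (?t e)) \<phi>" "\<phi> \<bullet> expand (?s e) = expand (?t e) \<bullet> edge_arrow e"
    using EProd(1) unfolding tracks_def by blast
  obtain \<psi> where g: "Track (?d f) (monomials (?s f)) (monomials (?t f)) \<psi>" "\<psi> \<bullet> expand (?s f) = expand (?t f) \<bullet> edge_arrow f"
    using EProd(2) unfolding tracks_def by blast
  obtain \<chi> where t: "Track (dist_prod (?d e) (?d f)) (word_products (monomials (?s e)) (monomials (?s f))) (word_products (monomials (?t e)) (monomials (?t f))) \<chi>"
    and c: "\<chi> \<bullet> distr (monomials (?s e)) (monomials (?s f)) = distr (monomials (?t e)) (monomials (?t f)) \<bullet> (\<phi> \<boxtimes>\<^sub>a \<psi>)"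
    using Track_prod[OF f(1) g(1)] by blast
  have "\<chi> \<bullet> expand (?s (EProd e f)) = expand (?t (EProd e f)) \<bullet> edge_arrow (EProd e f)"
    by (simp add: reassoc[OF c] times.tA_merge f(2) g(2) edge_arrow_prod)
  then show ?case unfolding tracks_def using t by (auto simp: Dbr_def)
qed

definition path_arrow where "path_arrow a es = foldl (\<lambda>g e. edge_arrow e \<bullet> g) (idn a) es"

lemma tracks_path: "gr_path X z u b es c \<Longrightarrow> tracks f a b g \<Longrightarrow>
   tracks (foldl (\<lambda>g e. Cmp Dbr (edge_val Dbr (dist_obj z u) e) g) f es) a c (foldl (\<lambda>g e. edge_arrow e \<bullet> g) g es)"
proof (induction es arbitrary: b f g)
  case (Cons e es)
  let ?d = "edge_val Dbr (dist_obj z u) e"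
  have e: "edge_dom z u e = b" "gr_path X z u (edge_cod z u e) es c" using Cons.prems(1) by auto
  obtain \<phi> where f: "Track f (monomials a) (monomials b) \<phi>" "\<phi> \<bullet> expand a = expand b \<bullet> g"
    using Cons.prems(2) unfolding tracks_def by blast
  obtain \<psi> where d: "Track ?d (monomials b) (monomials (edge_cod z u e)) \<psi>" "\<psi> \<bullet> expand b = expand (edge_cod z u e) \<bullet> edge_arrow e"
    using tracks_edge[of e] e unfolding tracks_def by blast
  have "(\<psi> \<bullet> \<phi>) \<bullet> expand a = expand (edge_cod z u e) \<bullet> (edge_arrow e \<bullet> g)"
    by (simp add: f(2) reassoc[OF d(2)])
  then have "tracks (Cmp Dbr ?d f) a (edge_cod z u e) (edge_arrow e \<bullet> g)"
    unfolding tracks_def using Track_comp[OF f(1) d(1)] by (auto simp: Dbr_def)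
  then show ?case using Cons.IH[OF e(2)] by simp
qed simp

lemma tracks_distortion: "gr_path X z u a es b \<Longrightarrow> tracks (braided_distortion z u a es) a b (path_arrow a es)"
proof -
  assume p: "gr_path X z u a es b"
  have "tracks (dist_id (map length (monomials a))) a a (idn a)" by (rule tracks_id) simp_all
  from tracks_path[OF p this] show ?thesis
    by (simp add: braided_distortion_def path_val_def path_arrow_def dval_monomials) (simp add: Dbr_def)
qed

lemma path_arrow_arr:
  assumes "gr_path X z u a es b"
  shows "arr (path_arrow a es)" "src (path_arrow a es) = a" "tgt (path_arrow a es) = b"
proof -
  have "arr (foldl (\<lambda>g e. edge_arrow e \<bullet> g) g es) \<and> src (foldl (\<lambda>g e. edge_arrow e \<bullet> g) g es) = src g \<and> tgt (foldl (\<lambda>g e. edge_arrow e \<bullet> g) g es) = b"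
    if "arr g" "tgt g = c" "gr_path X z u c es b" for g c
    using that by (induction es arbitrary: g c) auto
  from this[of "idn a" a] show "arr (path_arrow a es)" "src (path_arrow a es) = a" "tgt (path_arrow a es) = b"
    using assms by (auto simp: path_arrow_def)
qed

lemma expand_path_arrow:
  assumes "gr_path X z u a P b" "gr_path X z u a Q b" "braided_distortion z u a P = braided_distortion z u a Q"
  shows "expand b \<bullet> path_arrow a P = expand b \<bullet> path_arrow a Q"
  using tracks_distortion[OF assms(1)] tracks_distortion[OF assms(2)] assms(3) Track_unique
  unfolding tracks_def by metis

section \<open>The comparison with the normal form is monic\<close>

definition mono :: "'a \<Rightarrow> bool" where
  "mono f \<longleftrightarrow> arr f \<and> (\<forall>g h. arr g \<and> arr h \<and> src g = src h \<and> tgt g = src f \<and> tgt h = src f \<and> f \<bullet> g = f \<bullet> h \<longrightarrow> g = h)"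

definition whiskerings :: "('a \<Rightarrow> 'a) set" where
  "whiskerings = (\<Union>A. {\<lambda>g. g \<boxplus>\<^sub>a idn A, \<lambda>g. idn A \<boxplus>\<^sub>a g, \<lambda>g. g \<boxtimes>\<^sub>a idn A, \<lambda>g. idn A \<boxtimes>\<^sub>a g})"

lemma whiskerings:
  assumes "w \<in> whiskerings"
  shows "arr (w g) \<longleftrightarrow> arr g" "w (g \<bullet> f) = w g \<bullet> w f" "\<exists>B. w (idn A) = idn B"
    "arr g \<Longrightarrow> arr f \<Longrightarrow> src g = tgt f \<Longrightarrow> src (w g) = tgt (w f)"
  using assms by (auto simp: whiskerings_def plus.whisker times.whisker)

inductive whiskered :: "'a \<Rightarrow> 'a \<Rightarrow> bool" for f where
  refl: "whiskered f f"
| step: "whiskered f g \<Longrightarrow> w \<in> whiskerings \<Longrightarrow> whiskered f (w g)"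

text \<open>
  Sums and products of monic arrows need not be monic, so the property is asked for in every context of
  identities. A distributivity in such a context is the value of a \<open>\<delta>\<close>-prime edge.
\<close>

definition stable_mono :: "'a \<Rightarrow> bool" where
  "stable_mono f \<longleftrightarrow> (\<forall>g. whiskered f g \<longrightarrow> mono g)"

lemma whiskered_trans: "whiskered g h \<Longrightarrow> whiskered f g \<Longrightarrow> whiskered f h"
  by (induction rule: whiskered.induct) (auto intro: whiskered.intros)

lemma stable_mono_whiskering: "stable_mono f \<Longrightarrow> w \<in> whiskerings \<Longrightarrow> stable_mono (w f)"
  unfolding stable_mono_def using whiskered_trans whiskered.step[OF whiskered.refl] by blast

lemma stable_mono_whisker:
  assumes "stable_mono f"
  shows "stable_mono (f \<boxplus>\<^sub>a idn A)" "stable_mono (idn A \<boxplus>\<^sub>a f)" "stable_mono (f \<boxtimes>\<^sub>a idn A)" "stable_mono (idn A \<boxtimes>\<^sub>a f)"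
  using stable_mono_whiskering[OF assms, of "\<lambda>g. g \<boxplus>\<^sub>a idn A"] stable_mono_whiskering[OF assms, of "\<lambda>g. idn A \<boxplus>\<^sub>a g"]
    stable_mono_whiskering[OF assms, of "\<lambda>g. g \<boxtimes>\<^sub>a idn A"] stable_mono_whiskering[OF assms, of "\<lambda>g. idn A \<boxtimes>\<^sub>a g"]
  by (auto simp: whiskerings_def)

lemma mono_cmp: "mono g \<Longrightarrow> mono f \<Longrightarrow> src g = tgt f \<Longrightarrow> mono (g \<bullet> f)"
proof -
  assume g: "mono g" and f: "mono f" and gf: "src g = tgt f"
  have a: "arr g" "arr f" using g f unfolding mono_def by blast+
  have "h = k" if "arr h \<and> arr k \<and> src h = src k \<and> tgt h = src f \<and> tgt k = src f" "(g \<bullet> f) \<bullet> h = (g \<bullet> f) \<bullet> k" for h k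
  proof -
    have "g \<bullet> (f \<bullet> h) = g \<bullet> (f \<bullet> k)" using that(2) by (simp only: plus.cmp_assoc)
    moreover have "arr (f \<bullet> h)" "arr (f \<bullet> k)" "src (f \<bullet> h) = src (f \<bullet> k)" "tgt (f \<bullet> h) = src g" "tgt (f \<bullet> k) = src g"
      using that(1) a gf by simp_all
    ultimately have "f \<bullet> h = f \<bullet> k" using g[unfolded mono_def, THEN conjunct2, rule_format, of "f \<bullet> h" "f \<bullet> k"] by blast
    then show "h = k" using f[unfolded mono_def, THEN conjunct2, rule_format, of h k] that(1) by blast
  qed
  moreover have "arr (g \<bullet> f)" "src (g \<bullet> f) = src f" using a gf by simp_all
  ultimately show "mono (g \<bullet> f)" unfolding mono_def by metis
qed

lemma stable_mono_arr: "stable_mono f \<Longrightarrow> arr f"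
  using whiskered.refl[of f] unfolding stable_mono_def mono_def by blast

lemma whiskered_cmp:
  assumes "whiskered (g \<bullet> f) h" "arr g" "arr f" "src g = tgt f"
  shows "\<exists>g' f'. whiskered g g' \<and> whiskered f f' \<and> h = g' \<bullet> f' \<and> arr g' \<and> arr f' \<and> src g' = tgt f'"
  using assms(1)
proof (induction rule: whiskered.induct)
  case refl
  then show ?case using assms whiskered.refl by blast
next
  case (step h w)
  then obtain g' f' where "whiskered g g'" "whiskered f f'" "h = g' \<bullet> f'" "arr g'" "arr f'" "src g' = tgt f'" by blast
  then show ?case
    using whiskerings[OF step(2)] step(2) by (intro exI[of _ "w g'"] exI[of _ "w f'"]) (simp add: whiskered.step)
qed

lemma stable_mono_cmp: "stable_mono g \<Longrightarrow> stable_mono f \<Longrightarrow> src g = tgt f \<Longrightarrow> stable_mono (g \<bullet> f)"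
  unfolding stable_mono_def
  using whiskered_cmp mono_cmp stable_mono_arr unfolding stable_mono_def by metis

lemma stable_mono_iso:
  assumes "f' \<bullet> f = idn A" "arr f" "arr f'" "src f = A" "tgt f = src f'"
  shows "stable_mono f"
proof -
  have "\<exists>g' A. g' \<bullet> g = idn A \<and> arr g \<and> arr g' \<and> src g = A \<and> tgt g = src g'" if "whiskered f g" for g
    using that
  proof (induction rule: whiskered.induct)
    case refl
    then show ?case using assms by blast
  next
    case (step g w)
    then obtain g' A where g: "g' \<bullet> g = idn A" "arr g" "arr g'" "src g = A" "tgt g = src g'" by blast
    obtain B where "w g' \<bullet> w g = idn B"
      using whiskerings(2)[OF step(2), of g' g] whiskerings(3)[OF step(2), of A] g by metis
    moreover have a: "arr (w g)" "arr (w g')" "src (w g') = tgt (w g)"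
      using whiskerings(1,4)[OF step(2)] g by simp_all
    ultimately show ?case
      using plus.src_cmp[OF a(2,1,3)] by (intro exI[of _ "w g'"] exI[of _ B]) simp
  qed
  then show ?thesis
    unfolding stable_mono_def mono_def by (metis plus.iso_cancel_left)
qed

text \<open>
  A whiskered distributivity is the arrow of an edge with a single nonidentity elementary edge.
\<close>

lemma stable_mono_delta: "stable_mono (dl a b c)" "stable_mono (dr a b c)"
proof -
  have *: "mono g" if "whiskered (edge_arrow (Elem d)) g" and d: "d = DeltaL a b c \<or> d = DeltaR a b c" for d g
  proof -
    have "\<exists>e. g = edge_arrow e \<and> nonidentities e = [d]"
      using that(1)
    proof (induction rule: whiskered.induct)
      case refl
      then show ?case using d by (intro exI[of _ "Elem d"]) auto
    next
      case (step g w)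
      then obtain e where e: "g = edge_arrow e" "nonidentities e = [d]" by blast
      from step(2) obtain A where "w g \<in> {edge_arrow (ESum e (Elem (IdE A))), edge_arrow (ESum (Elem (IdE A)) e),
          edge_arrow (EProd e (Elem (IdE A))), edge_arrow (EProd (Elem (IdE A)) e)}"
        by (auto simp: whiskerings_def e edge_arrow_sum edge_arrow_prod edge_arrow_simps)
      moreover have "nonidentities (ESum e (Elem (IdE A))) = [d]" "nonidentities (ESum (Elem (IdE A)) e) = [d]"
        "nonidentities (EProd e (Elem (IdE A))) = [d]" "nonidentities (EProd (Elem (IdE A)) e) = [d]" for A
        using e by simp_all
      ultimately show ?case by blast
    qed
    then show ?thesis unfolding mono_def using edge_arrow_delta d by (metis edge_arrow_arr(1))
  qed
  show "stable_mono (dl a b c)" "stable_mono (dr a b c)"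
    unfolding stable_mono_def using *[of "DeltaL a b c"] *[of "DeltaR a b c"] by (auto simp: edge_arrow_simps)
qed

lemma stable_mono_basic: "stable_mono (idn A)" "stable_mono (alP A B D)" "stable_mono (laP A)" "stable_mono (rhP' A)" "stable_mono (alT A B D)" "stable_mono (laT A)" "stable_mono (rhT' A)"
  "stable_mono (lz A)" "stable_mono (rz A)"
proof -
  show "stable_mono (lz A)" "stable_mono (rz A)"
    using stable_mono_iso[OF edge_arrow_inv(1)[of "LambdaZ A"]] stable_mono_iso[OF edge_arrow_inv(1)[of "RhoZ A"]] by (simp_all add: edge_arrow_simps)
  show "stable_mono (idn A)" by (rule stable_mono_iso[of "idn A"]) simp_all
qed (rule stable_mono_iso, (rule plus.al_inv plus.la_inv plus.rh_inv times.al_inv times.la_inv times.rh_inv), simp_all)+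

lemma stable_mono_plus: "stable_mono f \<Longrightarrow> stable_mono g \<Longrightarrow> stable_mono (f \<boxplus>\<^sub>a g)"
  using stable_mono_cmp[of "f \<boxplus>\<^sub>a idn (tgt g)" "idn (src f) \<boxplus>\<^sub>a g"]
  by (simp add: stable_mono_whisker stable_mono_arr plus.tA_merge)

lemma stable_mono_times: "stable_mono f \<Longrightarrow> stable_mono g \<Longrightarrow> stable_mono (f \<boxtimes>\<^sub>a g)"
  using stable_mono_cmp[of "f \<boxtimes>\<^sub>a idn (tgt g)" "idn (src f) \<boxtimes>\<^sub>a g"]
  by (simp add: stable_mono_whisker stable_mono_arr times.tA_merge)

lemma stable_mono_pack: "stable_mono (plus.pack k A)" "stable_mono (times.pack k A)"
  by (induction k) (auto intro!: stable_mono_cmp stable_mono_whisker stable_mono_basic)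

lemma stable_mono_distr_right: "stable_mono (distr_right k w)"
  by (induction k) (auto intro!: stable_mono_cmp stable_mono_plus stable_mono_basic stable_mono_delta simp: word_append_def stable_mono_pack)

lemma stable_mono_distr: "stable_mono (distr k l)"
  by (induction l) (auto intro!: stable_mono_cmp stable_mono_plus stable_mono_basic stable_mono_delta stable_mono_distr_right simp: sum_append_def stable_mono_pack Sum_def)

lemma stable_mono_expand: "stable_mono (expand a)"
  by (induction a) (auto intro!: stable_mono_cmp stable_mono_plus stable_mono_times stable_mono_basic stable_mono_distr simp: sum_append_def stable_mono_pack Sum_def)

lemma path_arrow_eq:
  assumes "gr_path X z u a P b" "gr_path X z u a Q b" "braided_distortion z u a P = braided_distortion z u a Q"
  shows "path_arrow a P = path_arrow a Q"
proof -
  have "mono (expand b)" using stable_mono_expand whiskered.refl unfolding stable_mono_def by blast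
  then have "arr (path_arrow a P) \<and> arr (path_arrow a Q) \<and> src (path_arrow a P) = src (path_arrow a Q) \<and> tgt (path_arrow a P) = src (expand b)
      \<and> tgt (path_arrow a Q) = src (expand b) \<and> expand b \<bullet> path_arrow a P = expand b \<bullet> path_arrow a Q \<longrightarrow> ?thesis"
    unfolding mono_def by blast
  then show ?thesis
    by (simp add: expand_path_arrow[OF assms] path_arrow_arr[OF assms(1)] path_arrow_arr[OF assms(2)])
qed

end

section \<open>The category of vertices and arrows between their values\<close>

context category
begin

lemma inv_arr_unique:
  assumes "f \<in> homs C A B" "g \<in> homs C B A" "g \<cdot> f = \<iota> A" "f \<cdot> g = \<iota> B"
  shows "inv_arr C f = g"
  unfolding inv_arr_def
proof (rule the_equality)
  have d: "Dom C f = A" "Cod C f = B" using assms(1) by (auto simp: homs_def)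
  show "g \<in> homs C (Cod C f) (Dom C f) \<and> g \<cdot> f = \<iota> (Dom C f) \<and> f \<cdot> g = \<iota> (Cod C f)"
    using assms by (simp add: d)
  fix h assume h: "h \<in> homs C (Cod C f) (Dom C f) \<and> h \<cdot> f = \<iota> (Dom C f) \<and> f \<cdot> h = \<iota> (Cod C f)"
  then have hh: "h \<in> homs C B A" by (simp add: d)
  have "h = h \<cdot> (f \<cdot> g)" using Idn_right[OF hh] assms(4) by simp
  also have "\<dots> = (h \<cdot> f) \<cdot> g" using Cmp_assoc[OF assms(2,1) hh] by simp
  also have "\<dots> = g" using h Idn_left[OF assms(2)] by (simp add: d)
  finally show "h = g" .
qed

lemma inv_arr_isos:
  assumes "f \<in> isos C A B"
  shows "inv_arr C f \<in> homs C B A" "inv_arr C f \<cdot> f = \<iota> A" "f \<cdot> inv_arr C f = \<iota> B"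
  using assms inv_arr_unique unfolding isos_def by fastforce+

lemma isos_homs: "f \<in> isos C A B \<Longrightarrow> f \<in> homs C A B"
  by (simp add: isos_def)

end

text \<open>
  The function on atoms is defined everywhere, so that every vertex has a value; \<open>edge_val_map\<close>
  reduces the theorem to this case.
\<close>

locale realized_graph = braided_bimonoidal_category C
  for C :: "('o, 'm, 'z) braided_bimonoidal_data_scheme" (structure) +
  fixes \<phi> :: "'x \<Rightarrow> 'o" and z u :: 'x
  assumes \<phi>_Obj: "\<phi> x \<in> Obj C" and \<phi>_z: "\<phi> z = zeroO C" and \<phi>_u: "\<phi> u = oneO C" and z_neq_u: "z \<noteq> u"
    and delta_monic: "nonidentities e = [DeltaL a b c] \<or> nonidentities e = [DeltaR a b c] \<Longrightarrow> monic C (edge_val C \<phi> e)"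
begin

abbreviation val where "val \<equiv> vertex_val C \<phi>"

lemma val_Obj [simp]: "val a \<in> Obj C"
  by (induction a) (auto simp: \<phi>_Obj plus.tensO_Obj times.tensO_Obj)

text \<open>
  \<open>None\<close> is the value of ill-typed composites. Source and target are part of an arrow, since
  different vertices may have the same value in \<open>C\<close>.
\<close>

type_synonym (in -) ('y, 'n) farr = "('y vertex \<times> 'n \<times> 'y vertex) option"

fun farr :: "('x, 'm) farr \<Rightarrow> bool" where
  "farr None \<longleftrightarrow> False"
| "farr (Some (a, f, b)) \<longleftrightarrow> f \<in> homs C (val a) (val b)"

primrec fsrc :: "('x, 'm) farr \<Rightarrow> 'x vertex" where
  "fsrc None = Atom z" | "fsrc (Some x) = fst x"
primrec ftgt :: "('x, 'm) farr \<Rightarrow> 'x vertex" where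
  "ftgt None = Atom z" | "ftgt (Some x) = snd (snd x)"

definition mor :: "('x, 'm) farr \<Rightarrow> 'm" where
  "mor x = fst (snd (the x))"

definition mk :: "'x vertex \<Rightarrow> 'm \<Rightarrow> 'x vertex \<Rightarrow> ('x, 'm) farr" where
  "mk a f b = Some (a, f, b)"

definition fcmp where
  "fcmp g f = (if farr g \<and> farr f \<and> fsrc g = ftgt f then mk (fsrc f) (mor g \<cdot> mor f) (ftgt g) else None)"
text \<open>
  The sum and the product of arrows, for a constructor \<open>V\<close> of vertices and an operation \<open>M\<close> on the
  arrows of \<open>C\<close>.
\<close>

definition ften where
  "ften V M f g = (if farr f \<and> farr g then mk (V (fsrc f) (fsrc g)) (M (mor f) (mor g)) (V (ftgt f) (ftgt g)) else None)"

abbreviation "fsum \<equiv> ften VSum (sumM C)"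
abbreviation "fprod \<equiv> ften VProd (prodM C)"

lemma mk_simps [simp]: "farr (mk a f b) \<longleftrightarrow> f \<in> homs C (val a) (val b)" "fsrc (mk a f b) = a" "ftgt (mk a f b) = b"
  "mor (mk a f b) = f" "mk a f b = mk a' f' b' \<longleftrightarrow> a = a' \<and> f = f' \<and> b = b'" "mk a f b \<noteq> None"
  by (simp_all add: mk_def mor_def)

lemma farr_cases:
  assumes "farr x"
  obtains a f b where "x = mk a f b" "f \<in> homs C (val a) (val b)"
  using assms by (cases x) (auto simp: mk_def)

lemma mor_homs: "farr x \<Longrightarrow> mor x \<in> homs C (val (fsrc x)) (val (ftgt x))"
  by (auto elim: farr_cases)

lemma farr_eqI: "farr x \<Longrightarrow> farr y \<Longrightarrow> fsrc x = fsrc y \<Longrightarrow> ftgt x = ftgt y \<Longrightarrow> mor x = mor y \<Longrightarrow> x = y"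
  by (auto elim!: farr_cases)

lemma fcmp_simps [simp]: "farr (fcmp g f) \<longleftrightarrow> farr g \<and> farr f \<and> fsrc g = ftgt f"
  "farr g \<Longrightarrow> farr f \<Longrightarrow> fsrc g = ftgt f \<Longrightarrow> fsrc (fcmp g f) = fsrc f"
  "farr g \<Longrightarrow> farr f \<Longrightarrow> fsrc g = ftgt f \<Longrightarrow> ftgt (fcmp g f) = ftgt g"
  "farr g \<Longrightarrow> farr f \<Longrightarrow> fsrc g = ftgt f \<Longrightarrow> mor (fcmp g f) = mor g \<cdot> mor f"
  using plus.Cmp_homs[of "mor f" "val (fsrc f)" "val (ftgt f)" "mor g" "val (ftgt g)"] mor_homs[of f] mor_homs[of g]
  by (auto simp: fcmp_def)

lemma ften_simps:
  assumes "monoidal_structure C tO M un al la rh" "\<And>a b. val (V a b) = tO (val a) (val b)"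
  shows "farr (ften V M f g) \<longleftrightarrow> farr f \<and> farr g"
    "farr f \<Longrightarrow> farr g \<Longrightarrow> fsrc (ften V M f g) = V (fsrc f) (fsrc g)"
    "farr f \<Longrightarrow> farr g \<Longrightarrow> ftgt (ften V M f g) = V (ftgt f) (ftgt g)"
    "farr f \<Longrightarrow> farr g \<Longrightarrow> mor (ften V M f g) = M (mor f) (mor g)"
  using monoidal_structure.tensM_homs[OF assms(1) mor_homs[of f] mor_homs[of g]] assms(2) by (auto simp: ften_def)

lemmas fsum_simps [simp] = ften_simps[OF plus.monoidal_structure_axioms, of VSum, simplified]
lemmas fprod_simps [simp] = ften_simps[OF times.monoidal_structure_axioms, of VProd, simplified]

lemma fcmp_not: "\<not> (farr g \<and> farr f \<and> fsrc g = ftgt f) \<Longrightarrow> fcmp g f = None"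
  and ften_not: "\<not> (farr f \<and> farr g) \<Longrightarrow> ften V M f g = None"
  by (auto simp: fcmp_def ften_def)

definition fid where "fid a = mk a (\<iota> (val a)) a"

definition fiso where "fiso i = mk (iso_dom z u i) (iso_val C \<phi> i) (iso_cod z i)"
definition finv where "finv i = mk (iso_cod z i) (inv_arr C (iso_val C \<phi> i)) (iso_dom z u i)"
definition fdl where "fdl a b c = mk (VProd a (VSum b c)) (deltaL C (val a) (val b) (val c)) (VSum (VProd a b) (VProd a c))"
definition fdr where "fdr a b c = mk (VProd (VSum a b) c) (deltaR C (val a) (val b) (val c)) (VSum (VProd a c) (VProd b c))"
definition fedge where "fedge e = mk (edge_dom z u e) (edge_val C \<phi> e) (edge_cod z u e)"

lemma iso_val_isos: "iso_val C \<phi> i \<in> isos C (val (iso_dom z u i)) (val (iso_cod z i))"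
  by (cases i) (simp_all add: \<phi>_z \<phi>_u plus.\<alpha>_isos plus.lunit_isos plus.runit_isos plus.\<zeta>_isos
     times.\<alpha>_isos times.lunit_isos times.runit_isos braided_times.\<zeta>_isos lambdaZ_isos rhoZ_isos)

lemmas iso_val_homs = plus.isos_homs[OF iso_val_isos]
lemmas inv_val = plus.inv_arr_isos[OF iso_val_isos]

lemma id_homs [simp]: "\<iota> (val a) \<in> homs C (val a) (val a)"
  by (simp add: plus.Idn_homs)

lemma const_simps [simp]:
  "farr (fid a)" "fsrc (fid a) = a" "ftgt (fid a) = a" "mor (fid a) = \<iota> (val a)"
  "farr (fiso i)" "fsrc (fiso i) = iso_dom z u i" "ftgt (fiso i) = iso_cod z i" "mor (fiso i) = iso_val C \<phi> i"
  "farr (finv i)" "fsrc (finv i) = iso_cod z i" "ftgt (finv i) = iso_dom z u i" "mor (finv i) = inv_arr C (iso_val C \<phi> i)"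
  "farr (fdl a b c)" "fsrc (fdl a b c) = VProd a (VSum b c)" "ftgt (fdl a b c) = VSum (VProd a b) (VProd a c)"
  "mor (fdl a b c) = deltaL C (val a) (val b) (val c)"
  "farr (fdr a b c)" "fsrc (fdr a b c) = VProd (VSum a b) c" "ftgt (fdr a b c) = VSum (VProd a c) (VProd b c)"
  "mor (fdr a b c) = deltaR C (val a) (val b) (val c)"
  by (simp_all add: fid_def fiso_def finv_def fdl_def fdr_def iso_val_homs inv_val deltaL_homs deltaR_homs)

lemma fiso_finv: "fcmp (fiso i) (finv i) = fid (iso_cod z i)" "fcmp (finv i) (fiso i) = fid (iso_dom z u i)"
  by (auto intro!: farr_eqI simp: inv_val)

lemma total_category: "total_category farr fsrc ftgt fid fcmp"
proof
  show "fcmp (fcmp h g) f = fcmp h (fcmp g f)" for h g f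
  proof (cases "farr h \<and> farr g \<and> farr f \<and> fsrc h = ftgt g \<and> fsrc g = ftgt f")
    case True
    then show ?thesis
      using plus.Cmp_assoc[of "mor f" "val (fsrc f)" "val (ftgt f)" "mor g" "val (ftgt g)" "mor h" "val (ftgt h)"]
        mor_homs[of f] mor_homs[of g] mor_homs[of h]
      by (intro farr_eqI) simp_all
  next
    case False
    then have "fcmp (fcmp h g) f = None" "fcmp h (fcmp g f) = None"
      by (subst fcmp_not; auto)+
    then show ?thesis by simp
  qed
  show "fcmp (fid A) f = f" if "farr f" "ftgt f = A" for f A
    using that plus.Idn_left[OF mor_homs[of f]] by (intro farr_eqI) simp_all
  show "fcmp f (fid A) = f" if "farr f" "fsrc f = A" for f A
    using that plus.Idn_right[OF mor_homs[of f]] by (intro farr_eqI) simp_all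
qed simp_all

text \<open>
  Sum and product are treated alike. The axioms of \<open>C\<close> carry over because two arrows are equal
  once their sources, targets and underlying arrows of \<open>C\<close> agree.
\<close>

lemma total_braidedI:
  assumes br: "braided_monoidal_structure C tO M un al la rh ze"
    and V: "\<And>a b. val (V a b) = tO (val a) (val b)" "\<And>a b c d. V a b = V c d \<longleftrightarrow> a = c \<and> b = d" and e: "val e = un"
    and A: "\<And>a b c. iso_dom z u (A a b c) = V (V a b) c" "\<And>a b c. iso_cod z (A a b c) = V a (V b c)"
      "\<And>a b c. iso_val C \<phi> (A a b c) = al (val a) (val b) (val c)"
    and L: "\<And>a. iso_dom z u (L a) = V e a" "\<And>a. iso_cod z (L a) = a" "\<And>a. iso_val C \<phi> (L a) = la (val a)"
    and R: "\<And>a. iso_dom z u (R a) = V a e" "\<And>a. iso_cod z (R a) = a" "\<And>a. iso_val C \<phi> (R a) = rh (val a)"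
    and Z: "\<And>a b. iso_dom z u (Z a b) = V a b" "\<And>a b. iso_cod z (Z a b) = V b a"
      "\<And>a b. iso_val C \<phi> (Z a b) = ze (val a) (val b)"
  shows "total_braided farr fsrc ftgt fid fcmp V (ften V M) e
    (\<lambda>a b c. fiso (A a b c)) (\<lambda>a b c. finv (A a b c)) (\<lambda>a. fiso (L a)) (\<lambda>a. finv (L a))
    (\<lambda>a. fiso (R a)) (\<lambda>a. finv (R a)) (\<lambda>a b. fiso (Z a b)) (\<lambda>a b. finv (Z a b))"
proof -
  interpret B: braided_monoidal_structure C tO M un al la rh ze by (rule br)
  note [simp] = V e A L R Z ften_simps[OF B.monoidal_structure_axioms V(1)]
  let ?t = "ften V M"
  show ?thesis
  proof (intro total_braided.intro total_monoidal.intro total_category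
      total_monoidal_axioms.intro total_braided_axioms.intro)
    show "fcmp (?t f' g') (?t f g) = ?t (fcmp f' f) (fcmp g' g)" for f' g' f g
    proof (cases "farr f \<and> farr g \<and> farr f' \<and> farr g' \<and> fsrc f' = ftgt f \<and> fsrc g' = ftgt g")
      case True
      then show ?thesis
        using B.tensM_Cmp[OF mor_homs[of f] _ mor_homs[of g], of "mor f'" _ "mor g'"] mor_homs[of f'] mor_homs[of g']
        by (intro farr_eqI) simp_all
    next
      case False
      then have "fcmp (?t f' g') (?t f g) = None" "?t (fcmp f' f) (fcmp g' g) = None"
        by (subst fcmp_not ften_not; auto)+
      then show ?thesis by simp
    qed
    show "fcmp (fiso (A (ftgt f) (ftgt g) (ftgt h))) (?t (?t f g) h)
       = fcmp (?t f (?t g h)) (fiso (A (fsrc f) (fsrc g) (fsrc h)))" for f g h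
      using B.\<alpha>_natural[OF mor_homs[of f] mor_homs[of g] mor_homs[of h]]
      by (cases "farr f \<and> farr g \<and> farr h") (auto intro!: farr_eqI simp: ften_not fcmp_not)
    show "fcmp (fiso (L (ftgt f))) (?t (fid e) f) = fcmp f (fiso (L (fsrc f)))" for f
      using B.lunit_natural[OF mor_homs[of f]]
      by (cases "farr f") (auto intro!: farr_eqI simp: ften_not fcmp_not)
    show "fcmp (fiso (R (ftgt f))) (?t f (fid e)) = fcmp f (fiso (R (fsrc f)))" for f
      using B.runit_natural[OF mor_homs[of f]]
      by (cases "farr f") (auto intro!: farr_eqI simp: ften_not fcmp_not)
    show "fcmp (fiso (Z (ftgt f) (ftgt g))) (?t f g) = fcmp (?t g f) (fiso (Z (fsrc f) (fsrc g)))" for f g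
      using B.\<zeta>_natural[OF mor_homs[of f] mor_homs[of g]]
      by (cases "farr f \<and> farr g") (auto intro!: farr_eqI simp: ften_not fcmp_not)
    show "fcmp (fiso (A a b (V c d))) (fiso (A (V a b) c d)) = fcmp (?t (fid a) (fiso (A b c d)))
         (fcmp (fiso (A a (V b c) d)) (?t (fiso (A a b c)) (fid d)))" for a b c d
      by (rule farr_eqI) (simp_all add: B.pentagon)
    show "fcmp (?t (fid a) (fiso (L b))) (fiso (A a e b)) = ?t (fiso (R a)) (fid b)" for a b
      using B.triangle[of "val a" "val b"] by (intro farr_eqI) simp_all
    show "fcmp (fiso (A b d a)) (fcmp (fiso (Z a (V b d))) (fiso (A a b d))) = fcmp (?t (fid b) (fiso (Z a d)))
         (fcmp (fiso (A b a d)) (?t (fiso (Z a b)) (fid d)))" for a b d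
      by (rule farr_eqI) (simp_all add: B.hexagon1)
    show "fcmp (finv (A d a b)) (fcmp (fiso (Z (V a b) d)) (finv (A a b d))) = fcmp (?t (fiso (Z a d)) (fid b))
         (fcmp (finv (A a d b)) (?t (fid a) (fiso (Z b d))))" for a b d
      by (rule farr_eqI) (simp_all add: B.hexagon2)
    show "?t (fid a) (fid b) = fid (V a b)" for a b
      by (rule farr_eqI) (simp_all add: B.tensM_Idn)
  qed (simp_all add: fiso_finv)
qed

sublocale FP: total_symmetric farr fsrc ftgt fid fcmp VSum fsum "Atom z"
  "\<lambda>a b c. fiso (AlphaP a b c)" "\<lambda>a b c. finv (AlphaP a b c)" "\<lambda>a. fiso (LambdaP a)" "\<lambda>a. finv (LambdaP a)"
  "\<lambda>a. fiso (RhoP a)" "\<lambda>a. finv (RhoP a)" "\<lambda>a b. fiso (ZetaP a b)" "\<lambda>a b. finv (ZetaP a b)"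
proof (intro total_symmetric.intro total_symmetric_axioms.intro total_braidedI[OF plus.braided_monoidal_structure_axioms])
  show "fcmp (fiso (ZetaP B A)) (fiso (ZetaP A B)) = fid (VSum A B)" for A B
    by (rule farr_eqI) (simp_all add: plus.symmetry)
qed (simp_all add: \<phi>_z)

sublocale FT: total_braided farr fsrc ftgt fid fcmp VProd fprod "Atom u"
  "\<lambda>a b c. fiso (AlphaT a b c)" "\<lambda>a b c. finv (AlphaT a b c)" "\<lambda>a. fiso (LambdaT a)" "\<lambda>a. finv (LambdaT a)"
  "\<lambda>a. fiso (RhoT a)" "\<lambda>a. finv (RhoT a)" "\<lambda>a b. fiso (ZetaT a b)" "\<lambda>a b. finv (ZetaT a b)"
  by (rule total_braidedI[OF braided_times.braided_monoidal_structure_axioms]) (simp_all add: \<phi>_u)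

lemma fedge_simps:
  "fedge (ESum e f) = fsum (fedge e) (fedge f)" "fedge (EProd e f) = fprod (fedge e) (fedge f)"
  "fedge (Elem (IdE a)) = fid a" "fedge (Elem (Iso i)) = fiso i" "fedge (Elem (IsoInv i)) = finv i"
  "fedge (Elem (DeltaL a b c)) = fdl a b c" "fedge (Elem (DeltaR a b c)) = fdr a b c"
  and farr_fedge: "farr (fedge e)"
proof -
  show 1: "fedge (Elem (IdE a)) = fid a" "fedge (Elem (Iso i)) = fiso i" "fedge (Elem (IsoInv i)) = finv i"
  "fedge (Elem (DeltaL a b c)) = fdl a b c" "fedge (Elem (DeltaR a b c)) = fdr a b c" for a b c i
    by (simp_all add: fedge_def fid_def fiso_def finv_def fdl_def fdr_def)
  show 2: "farr (fedge e)" for e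
  proof (induction e)
    case (Elem x)
    then show ?case by (cases x) (simp_all add: 1)
  next
    case (ESum e f)
    then show ?case by (simp add: fedge_def plus.tensM_homs)
  next
    case (EProd e f)
    then show ?case by (simp add: fedge_def times.tensM_homs)
  qed
  show "fedge (ESum e f) = fsum (fedge e) (fedge f)" "fedge (EProd e f) = fprod (fedge e) (fedge f)"
    using 2[of e] 2[of f] by (auto simp: fedge_def ften_def)
qed

sublocale F: vertex_bimonoidal farr fsrc ftgt fid fcmp fsum z
  "\<lambda>a b c. fiso (AlphaP a b c)" "\<lambda>a b c. finv (AlphaP a b c)" "\<lambda>a. fiso (LambdaP a)" "\<lambda>a. finv (LambdaP a)"
  "\<lambda>a. fiso (RhoP a)" "\<lambda>a. finv (RhoP a)" "\<lambda>a b. fiso (ZetaP a b)" "\<lambda>a b. finv (ZetaP a b)"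
  fprod u
  "\<lambda>a b c. fiso (AlphaT a b c)" "\<lambda>a b c. finv (AlphaT a b c)" "\<lambda>a. fiso (LambdaT a)" "\<lambda>a. finv (LambdaT a)"
  "\<lambda>a. fiso (RhoT a)" "\<lambda>a. finv (RhoT a)" "\<lambda>a b. fiso (ZetaT a b)" "\<lambda>a b. finv (ZetaT a b)"
  "\<lambda>a. fiso (LambdaZ a)" "\<lambda>a. fiso (RhoZ a)" fdl fdr fedge
proof (intro vertex_bimonoidal.intro total_bimonoidal.intro FP.total_symmetric_axioms FT.total_braided_axioms
   total_bimonoidal_axioms.intro vertex_bimonoidal_axioms.intro)
  show "fcmp (fiso (LambdaZ A)) (fprod (fid (Atom z)) f) = fiso (LambdaZ (fsrc f))" if "farr f" "ftgt f = A" for f A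
    using that lambdaZ_natural[OF mor_homs[of f]] by (intro farr_eqI) (auto simp: \<phi>_z)
  show "fcmp (fiso (RhoZ A)) (fprod f (fid (Atom z))) = fiso (RhoZ (fsrc f))" if "farr f" "ftgt f = A" for f A
    using that rhoZ_natural[OF mor_homs[of f]] by (intro farr_eqI) (auto simp: \<phi>_z)
  show "fcmp (fdl A B D) (fprod f (fsum g h)) = fcmp (fsum (fprod f g) (fprod f h)) (fdl (fsrc f) (fsrc g) (fsrc h))"
    if "farr f" "farr g" "farr h" "ftgt f = A" "ftgt g = B" "ftgt h = D" for f g h A B D
    using that deltaL_natural[OF mor_homs[of f] mor_homs[of g] mor_homs[of h]] by (intro farr_eqI) auto
  show "fcmp (fdr A B D) (fprod (fsum f g) h) = fcmp (fsum (fprod f h) (fprod g h)) (fdr (fsrc f) (fsrc g) (fsrc h))"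
    if "farr f" "farr g" "farr h" "ftgt f = A" "ftgt g = B" "ftgt h = D" for f g h A B D
    using that deltaR_natural[OF mor_homs[of f] mor_homs[of g] mor_homs[of h]] by (intro farr_eqI) auto
  have m: "middle_swap C (val A) (val B) (val D) (val E)
     = mor (fcmp (finv (AlphaP A D (VSum B E))) (fcmp (fsum (fid A) (FP.sw B D E)) (fiso (AlphaP A B (VSum D E)))))" for A B D E
    unfolding FP.sw_def middle_swap_def by simp
  show "fcmp (finv (AlphaP (VProd A D) (VProd B D) (VSum (VProd A E) (VProd B E))))
      (fcmp (fsum (fid (VProd A D)) (total_braided.sw fid fcmp fsum (\<lambda>a b c. fiso (AlphaP a b c)) (\<lambda>a b c. finv (AlphaP a b c))
             (\<lambda>a b. fiso (ZetaP a b)) (VProd A E) (VProd B D) (VProd B E)))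
        (fcmp (fiso (AlphaP (VProd A D) (VProd A E) (VSum (VProd B D) (VProd B E))))
          (fcmp (fsum (fdl A D E) (fdl B D E)) (fdr A B (VSum D E)))))
     = fcmp (fsum (fdr A B D) (fdr A B E)) (fdl (VSum A B) D E)" (is "?l = ?r") for A B D E
  proof -
    have "?l = fcmp (fcmp (finv (AlphaP (VProd A D) (VProd B D) (VSum (VProd A E) (VProd B E))))
      (fcmp (fsum (fid (VProd A D)) (FP.sw (VProd A E) (VProd B D) (VProd B E)))
        (fiso (AlphaP (VProd A D) (VProd A E) (VSum (VProd B D) (VProd B E))))))
          (fcmp (fsum (fdl A D E) (fdl B D E)) (fdr A B (VSum D E)))"
      by simp
    also have "\<dots> = ?r"
      using deltaLR_middle_swap[of "val A" "val B" "val D" "val E"] m[of "VProd A D" "VProd A E" "VProd B D" "VProd B E"]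
      by (intro farr_eqI) (simp_all del: FP.cmp_assoc)
    finally show ?thesis .
  qed
  show "h = k" if e: "nonidentities e = [DeltaL a b c] \<or> nonidentities e = [DeltaR a b c]" and eq: "fcmp (fedge e) h = fcmp (fedge e) k"
    and a: "farr h" "farr k" "fsrc h = fsrc k" "ftgt h = fsrc (fedge e)" "ftgt k = fsrc (fedge e)" for e a b c h k
  proof (rule farr_eqI)
    have m: "monic C (mor (fedge e))" using delta_monic[OF e] by (simp add: fedge_def)
    have d: "Dom C (mor (fedge e)) = val (fsrc (fedge e))" using mor_homs[OF farr_fedge[of e]] by (simp add: homs_def)
    have "mor (fedge e) \<cdot> mor h = mor (fedge e) \<cdot> mor k"
      using arg_cong[OF eq, of mor] a farr_fedge[of e] by simp
    then show "mor h = mor k"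
      using m mor_homs[OF a(1)] mor_homs[OF a(2)] a(3-5) unfolding monic_def d by auto
  qed (use a in simp_all)
qed ((simp add: fedge_simps fiso_finv z_neq_u; fail)
  | (rule farr_eqI; simp add: deltaL_zetaP deltaR_zetaP deltaR_alphaP deltaL_alphaP deltaL_alphaT deltaR_alphaT deltaLR_alphaT
      lambdaZ_rhoZ_zero lambdaZ_deltaL rhoZ_deltaR rhoT_zero lambdaT_zero lambdaZ_alphaT lambdaZ_rhoZ_alphaT rhoZ_alphaT
      lambdaP_deltaL lambdaP_deltaR rhoP_deltaL rhoP_deltaR lambdaT_deltaL rhoT_deltaR deltaL_zetaT deltaR_zetaT lambdaZ_zetaT rhoZ_zetaT \<phi>_z \<phi>_u))+

lemma mor_path_arrow: "gr_path X z u a es b \<Longrightarrow> mor (F.path_arrow a es) = path_val C \<phi> a es"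
proof -
  have "mor (foldl (\<lambda>g e. fcmp (fedge e) g) g es) = foldl (\<lambda>g e. edge_val C \<phi> e \<cdot> g) (mor g) es"
    if "farr g" "ftgt g = c" "gr_path X z u c es b" for g c
    using that
  proof (induction es arbitrary: g c)
    case (Cons e es)
    have f: "fsrc (fedge e) = edge_dom z u e" "ftgt (fedge e) = edge_cod z u e" "mor (fedge e) = edge_val C \<phi> e"
      by (simp_all add: fedge_def)
    show ?case
      using Cons.prems Cons.IH[of "fcmp (fedge e) g" "edge_cod z u e"] f farr_fedge[of e] by simp
  qed simp
  from this[of "fid a" a] show "gr_path X z u a es b \<Longrightarrow> ?thesis"
    by (simp add: F.path_arrow_def path_val_def)
qed

lemma path_val_eq:
  assumes "gr_path X z u a P b" "gr_path X z u a Q b" "braided_distortion z u a P = braided_distortion z u a Q"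
  shows "path_val C \<phi> a P = path_val C \<phi> a Q"
  using arg_cong[OF F.path_arrow_eq[OF assms], of mor] mor_path_arrow[OF assms(1)] mor_path_arrow[OF assms(2)] by simp

end

section \<open>Atoms outside the given set\<close>

lemma vertex_val_map: "vertex_val C (\<lambda>x. \<phi> (h x)) a = vertex_val C \<phi> (map_vertex h a)"
  by (induction a) auto

lemma edge_val_map: "edge_val C (\<lambda>x. \<phi> (h x)) e = edge_val C \<phi> (map_edge h e)"
proof (induction e)
  case (Elem x)
  have "iso_val C (\<lambda>x. \<phi> (h x)) i = iso_val C \<phi> (map_iso_edge h i)" for i
    by (cases i) (simp_all add: vertex_val_map)
  then show ?case by (cases x) (simp_all add: vertex_val_map)
qed simp_all

lemma nonidentities_map: "nonidentities (map_edge h e) = map (map_elem_edge h) (nonidentities e)"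
proof (induction e)
  case (Elem x)
  then show ?case by (cases x) auto
qed simp_all

lemma edge_dom_atoms: "atoms (edge_dom z u e) \<subseteq> edge_atoms e \<union> {z, u}"
proof (induction e)
  case (Elem x)
  have "atoms (iso_dom z u i) \<subseteq> set_iso_edge i \<union> {z, u}" "atoms (iso_cod z i) \<subseteq> set_iso_edge i \<union> {z, u}" for i
    by (cases i; auto)+
  then show ?case by (cases x) auto
qed auto

lemma gr_path_atoms: "gr_path X z u a es b \<Longrightarrow> z \<in> X \<Longrightarrow> u \<in> X \<Longrightarrow> atoms a \<subseteq> X"
  using edge_dom_atoms[of z u] by (cases es) (fastforce simp: prime_edges_def)+

lemma gr_path_edges: "gr_path X z u a es b \<Longrightarrow> e \<in> set es \<Longrightarrow> edge_atoms e \<subseteq> X"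
  by (induction es arbitrary: a) (auto simp: prime_edges_def)

theorem mainTheorem9:
  fixes C :: "('o, 'm, 'z) braided_bimonoidal_data_scheme"
    and X :: "'x set" and z u :: 'x
    and \<phi> :: "'x \<Rightarrow> 'o"
    and a b :: "'x vertex"
    and P Q :: "'x edge list"
  assumes "braided_bimonoidal_category C"
    and "z \<in> X" and "u \<in> X" and "z \<noteq> u"
    and "\<forall>x \<in> X. \<phi> x \<in> Obj C"
    and "\<phi> z = zeroO C" and "\<phi> u = oneO C"
    and "\<forall>e \<in> delta_prime_edges X. monic C (edge_val C \<phi> e)"
    and "gr_path X z u a P b" and "gr_path X z u a Q b"
    and "braided_distortion z u a P = braided_distortion z u a Q"
  shows "path_val C \<phi> a P = path_val C \<phi> a Q"
proof -
  \<comment> \<open>Atoms outside \<open>X\<close> are sent to \<open>0\<close>, so that every edge has the value of an edge over \<open>X\<close>.\<close>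
  define h where "h = (\<lambda>x. if x \<in> X then x else z)"
  have h: "h x \<in> X" "x \<in> X \<Longrightarrow> h x = x" for x using assms(2) by (auto simp: h_def)
  let ?\<phi> = "\<lambda>x. \<phi> (h x)"
  interpret C: braided_bimonoidal_category C by (rule assms(1))
  interpret realized_graph C ?\<phi> z u
  proof
    show "?\<phi> x \<in> Obj C" for x using assms(5) h by blast
    show "?\<phi> z = zeroO C" "?\<phi> u = oneO C" "z \<noteq> u" using assms(2,3,4,6,7) h by auto
    show "monic C (edge_val C ?\<phi> e)" if e: "nonidentities e = [DeltaL a b c] \<or> nonidentities e = [DeltaR a b c]" for e a b c
    proof -
      have "map_edge h e \<in> delta_prime_edges X"
        using e h unfolding delta_prime_edges_def prime_edges_def by (auto simp: nonidentities_map edge.set_map)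
      then show ?thesis using assms(8) unfolding edge_val_map by blast
    qed
  qed
  have "path_val C ?\<phi> a R = path_val C \<phi> a R" if R: "gr_path X z u a R b" for R
  proof -
    have "map_vertex h a = map_vertex id a"
      using gr_path_atoms[OF R assms(2,3)] h(2) by (intro vertex.map_cong) auto
    then have v: "vertex_val C ?\<phi> a = vertex_val C \<phi> a"
      unfolding vertex_val_map by (simp add: vertex.map_id)
    have "edge_val C ?\<phi> e = edge_val C \<phi> e" if "e \<in> set R" for e
    proof -
      have "map_edge h e = map_edge id e"
        using gr_path_edges[OF R that] h(2) by (intro edge.map_cong) auto
      then show ?thesis unfolding edge_val_map by (simp add: edge.map_id)
    qed
    then show ?thesis
      unfolding path_val_def v by (intro foldl_cong) auto
  qed
  then show ?thesis
    using path_val_eq[OF assms(9-11)] assms(9,10) by metis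
qed

end
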